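(* Let $k$ be a positive integer and let $\lambda$ be a partition of $k$. Then $d_i(\lambda) = 0$ for every integer $i$ with $0 \le i < k/2$.
   Context: For $n \ge 1$ let $\operatorname{PConf}_n(\mathbb{C}) = \{(x_1,\dots,x_n)\in\mathbb{C}^n : x_i \ne x_j \text{ for } i\neq j\}$. The symmetric group $S_n$ acts on it by permuting coordinates, making $H^i(\operatorname{PConf}_n(\mathbb{C});\mathbb{C})$ a finite-dimensional $S_n$-representation. For a partition $\lambda = (a_1,\dots,a_r)$ of $k$ (so $a_1\ge\dots\ge a_r>0$ and $k=\sum_j a_j$) and $n \ge k + a_1$, let $V(\lambda)_n$ denote the irreducible complex representation of $S_n$ corresponding (in the usual Young labelling, where the one-row partition $(n)$ gives the trivial representation) to the partition $(n-k, a_1,\dots,a_r)$ of $n$. Let $d_{i,n}(\lambda)$ be the multiplicity of $V(\lambda)_n$ in $H^i(\operatorname{PConf}_n(\mathbb{C});\mathbb{C})$. By representation stability (Church–Farb), for fixed $i$ and $\lambda$ the number $d_{i,n}(\lambda)$ is constant for all sufficiently large $n$; this eventual value is denoted $d_i(\lambda)$ (the stable multiplicity). *)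

theory Defs
  imports
    "HOL-Homology.Homology"
    "HOL-Algebra.Module"
    "HOL-Algebra.QuotRing"
    "HOL-Algebra.Sym_Groups"
begin

section \<open>Complex linear representations\<close>

definition complex_field :: "complex ring"
  where "complex_field = \<lparr>carrier = UNIV, monoid.mult = (*), one = 1, zero = 0, add = (+)\<rparr>"

text \<open>The fields \<open>mult\<close> and \<open>one\<close>, which the record of modules inherits from
  the record of rings, play no role in a module and are left unspecified below.\<close>

record ('g, 'v) rep = "(complex, 'v) module" +
  act :: "'g \<Rightarrow> 'v \<Rightarrow> 'v"

definition rep_of :: "(complex, 'v) module \<Rightarrow> ('g \<Rightarrow> 'v \<Rightarrow> 'v) \<Rightarrow> ('g, 'v) rep"
  where "rep_of M \<rho> = module.extend M (rep.fields \<rho>)"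

locale linear_rep = G: group G + V: Module.module complex_field V
  for G :: "('g, 'x) monoid_scheme" and V :: "('g, 'v) rep" +
  assumes act_closed: "\<lbrakk>g \<in> carrier G; v \<in> carrier V\<rbrakk> \<Longrightarrow> act V g v \<in> carrier V"
    and act_add: "\<lbrakk>g \<in> carrier G; v \<in> carrier V; w \<in> carrier V\<rbrakk>
      \<Longrightarrow> act V g (v \<oplus>\<^bsub>V\<^esub> w) = act V g v \<oplus>\<^bsub>V\<^esub> act V g w"
    and act_smult: "\<lbrakk>g \<in> carrier G; v \<in> carrier V\<rbrakk>
      \<Longrightarrow> act V g (c \<odot>\<^bsub>V\<^esub> v) = c \<odot>\<^bsub>V\<^esub> act V g v"
    and act_one: "v \<in> carrier V \<Longrightarrow> act V \<one>\<^bsub>G\<^esub> v = v"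
    and act_mult: "\<lbrakk>g \<in> carrier G; h \<in> carrier G; v \<in> carrier V\<rbrakk>
      \<Longrightarrow> act V (g \<otimes>\<^bsub>G\<^esub> h) v = act V g (act V h v)"

definition subrep :: "('g, 'x) monoid_scheme \<Rightarrow> ('g, 'v) rep \<Rightarrow> 'v set \<Rightarrow> bool"
  where "subrep G V U \<longleftrightarrow>
    submodule U complex_field V \<and> (\<forall>g\<in>carrier G. \<forall>u\<in>U. act V g u \<in> U)"

definition irreducible_subrep :: "('g, 'x) monoid_scheme \<Rightarrow> ('g, 'v) rep \<Rightarrow> 'v set \<Rightarrow> bool"
  where "irreducible_subrep G V U \<longleftrightarrow>
    subrep G V U \<and> U \<noteq> {\<zero>\<^bsub>V\<^esub>} \<and>
    (\<forall>U'. subrep G V U' \<and> U' \<subseteq> U \<longrightarrow> U' = {\<zero>\<^bsub>V\<^esub>} \<or> U' = U)"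

definition rep_iso :: "('g, 'x) monoid_scheme \<Rightarrow> ('g, 'v) rep \<Rightarrow> ('g, 'w) rep \<Rightarrow> bool"
  where "rep_iso G V W \<longleftrightarrow>
    (\<exists>f. bij_betw f (carrier V) (carrier W) \<and>
      (\<forall>v\<in>carrier V. \<forall>w\<in>carrier V. f (v \<oplus>\<^bsub>V\<^esub> w) = f v \<oplus>\<^bsub>W\<^esub> f w) \<and>
      (\<forall>c. \<forall>v\<in>carrier V. f (c \<odot>\<^bsub>V\<^esub> v) = c \<odot>\<^bsub>W\<^esub> f v) \<and>
      (\<forall>g\<in>carrier G. \<forall>v\<in>carrier V. f (act V g v) = act W g (f v)))"

definition irreducible_decomposition ::
    "('g, 'x) monoid_scheme \<Rightarrow> ('g, 'v) rep \<Rightarrow> nat \<Rightarrow> (nat \<Rightarrow> 'v set) \<Rightarrow> bool"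
  where "irreducible_decomposition G V r U \<longleftrightarrow>
    (\<forall>j<r. irreducible_subrep G V (U j)) \<and>
    (\<forall>v\<in>carrier V. \<exists>!u. u \<in> (\<Pi>\<^sub>E j\<in>{..<r}. U j) \<and> v = (\<Oplus>\<^bsub>V\<^esub>j\<in>{..<r}. u j))"

text \<open>The multiplicity of the irreducible representation \<open>V\<close> in the finite-dimensional
  representation \<open>W\<close> of a finite group: the number of summands isomorphic to \<open>V\<close> in a
  decomposition of \<open>W\<close> into irreducibles, which does not depend on the decomposition.\<close>

definition multiplicity_in ::
    "('g, 'x) monoid_scheme \<Rightarrow> ('g, 'v) rep \<Rightarrow> ('g, 'w) rep \<Rightarrow> nat"
  where "multiplicity_in G V W =
    (THE m. \<exists>r U. irreducible_decomposition G W r U \<and>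
      m = card {j\<in>{..<r}. rep_iso G V (W\<lparr>carrier := U j\<rparr>)})"

definition function_module ::
    "'s set \<Rightarrow> ('s \<Rightarrow> complex) set \<Rightarrow> (complex, 's \<Rightarrow> complex) module"
  where "function_module S F =
    \<lparr>carrier = F, monoid.mult = undefined, one = undefined,
     zero = (\<lambda>s\<in>S. 0), add = (\<lambda>f g. \<lambda>s\<in>S. f s + g s),
     smult = (\<lambda>c f. \<lambda>s\<in>S. c * f s)\<rparr>"

text \<open>The quotient of a module by a submodule, with the cosets as elements; compare
  \<^const>\<open>FactRing\<close>.\<close>

definition quotient_module ::
    "(complex, 'v) module \<Rightarrow> 'v set \<Rightarrow> (complex, 'v set) module"
  where "quotient_module M N =
    \<lparr>carrier = a_rcosets\<^bsub>M\<^esub> N, monoid.mult = undefined, one = undefined,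
     zero = N, add = set_add M,
     smult = (\<lambda>c A. \<Union>a\<in>A. N +>\<^bsub>M\<^esub> (c \<odot>\<^bsub>M\<^esub> a))\<rparr>"


section \<open>Singular cohomology with complex coefficients\<close>

definition cochains :: "nat \<Rightarrow> 'a topology \<Rightarrow> ('a chain \<Rightarrow> complex) set"
  where "cochains p X =
    hom (chain_group p X) (add_monoid complex_field) \<inter> extensional (carrier (chain_group p X))"

definition coboundary ::
    "nat \<Rightarrow> 'a topology \<Rightarrow> ('a chain \<Rightarrow> complex) \<Rightarrow> 'a chain \<Rightarrow> complex"
  where "coboundary p X \<phi> =
    (\<lambda>c\<in>carrier (chain_group (Suc p) X). \<phi> (chain_boundary (Suc p) c))"

definition cocycles :: "nat \<Rightarrow> 'a topology \<Rightarrow> ('a chain \<Rightarrow> complex) set"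
  where "cocycles p X =
    {\<phi> \<in> cochains p X. coboundary p X \<phi> = (\<lambda>c\<in>carrier (chain_group (Suc p) X). 0)}"

definition coboundaries :: "nat \<Rightarrow> 'a topology \<Rightarrow> ('a chain \<Rightarrow> complex) set"
  where "coboundaries p X =
    (case p of 0 \<Rightarrow> {\<lambda>c\<in>carrier (chain_group 0 X). 0}
     | Suc q \<Rightarrow> coboundary q X ` cochains q X)"

abbreviation cocycle_module :: "nat \<Rightarrow> 'a topology \<Rightarrow> (complex, 'a chain \<Rightarrow> complex) module"
  where "cocycle_module p X \<equiv> function_module (carrier (chain_group p X)) (cocycles p X)"

definition cohomology :: "nat \<Rightarrow> 'a topology \<Rightarrow> (complex, ('a chain \<Rightarrow> complex) set) module"
  where "cohomology p X = quotient_module (cocycle_module p X) (coboundaries p X)"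

definition cochain_pullback ::
    "nat \<Rightarrow> 'a topology \<Rightarrow> ('a \<Rightarrow> 'b) \<Rightarrow> ('b chain \<Rightarrow> complex) \<Rightarrow> 'a chain \<Rightarrow> complex"
  where "cochain_pullback p X f \<phi> = (\<lambda>c\<in>carrier (chain_group p X). \<phi> (chain_map p f c))"

definition cohomology_pullback ::
    "nat \<Rightarrow> 'a topology \<Rightarrow> ('a \<Rightarrow> 'b) \<Rightarrow> ('b chain \<Rightarrow> complex) set \<Rightarrow> ('a chain \<Rightarrow> complex) set"
  where "cohomology_pullback p X f A =
    (\<Union>\<phi>\<in>A. coboundaries p X +>\<^bsub>cocycle_module p X\<^esub> cochain_pullback p X f \<phi>)"


section \<open>The ordered configuration space of the plane\<close>

definition PConf :: "nat \<Rightarrow> (nat \<Rightarrow> complex) topology"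
  where "PConf n =
    subtopology (product_topology (\<lambda>_. euclidean) {1..n}) {x. inj_on x {1..n}}"

text \<open>A permutation \<open>\<sigma>\<close> acts on points by \<open>\<sigma> \<cdot> x = x \<circ> \<sigma>\<^sup>-\<^sup>1\<close> and hence on cohomology from the
  left by pullback along \<open>x \<mapsto> \<sigma>\<^sup>-\<^sup>1 \<cdot> x = x \<circ> \<sigma>\<close>.\<close>

definition PConf_cohomology ::
    "nat \<Rightarrow> nat \<Rightarrow> (nat \<Rightarrow> nat, ((nat \<Rightarrow> complex) chain \<Rightarrow> complex) set) rep"
  where "PConf_cohomology i n =
    rep_of (cohomology i (PConf n)) (\<lambda>\<sigma>. cohomology_pullback i (PConf n) (\<lambda>x. x \<circ> \<sigma>))"


section \<open>Irreducible representations of symmetric groups\<close>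

definition is_partition :: "nat list \<Rightarrow> nat \<Rightarrow> bool"
  where "is_partition \<mu> n \<longleftrightarrow> sorted_wrt (\<ge>) \<mu> \<and> (\<forall>a\<in>set \<mu>. 0 < a) \<and> sum_list \<mu> = n"

text \<open>The entries of the tableau of shape \<open>\<mu>\<close> are \<open>1, 2, \<dots>\<close>, filled in row by row.
  Rows are counted from 0 and columns from 1.\<close>

definition tableau_row :: "nat list \<Rightarrow> nat \<Rightarrow> nat"
  where "tableau_row \<mu> j = (LEAST r. j \<le> sum_list (take (Suc r) \<mu>))"

definition tableau_col :: "nat list \<Rightarrow> nat \<Rightarrow> nat"
  where "tableau_col \<mu> j = j - sum_list (take (tableau_row \<mu> j) \<mu>)"

definition group_algebra :: "nat \<Rightarrow> ((nat \<Rightarrow> nat) \<Rightarrow> complex) set"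
  where "group_algebra n = (carrier (sym_group n) \<rightarrow>\<^sub>E UNIV)"

definition convolution ::
    "nat \<Rightarrow> ((nat \<Rightarrow> nat) \<Rightarrow> complex) \<Rightarrow> ((nat \<Rightarrow> nat) \<Rightarrow> complex) \<Rightarrow> (nat \<Rightarrow> nat) \<Rightarrow> complex"
  where "convolution n f g =
    (\<lambda>x\<in>carrier (sym_group n). \<Sum>y\<in>carrier (sym_group n). f y * g (inv' y \<circ> x))"

definition row_symmetrizer :: "nat list \<Rightarrow> (nat \<Rightarrow> nat) \<Rightarrow> complex"
  where "row_symmetrizer \<mu> =
    (\<lambda>p\<in>carrier (sym_group (sum_list \<mu>)).
      if \<forall>j\<in>{1..sum_list \<mu>}. tableau_row \<mu> (p j) = tableau_row \<mu> j then 1 else 0)"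

definition column_antisymmetrizer :: "nat list \<Rightarrow> (nat \<Rightarrow> nat) \<Rightarrow> complex"
  where "column_antisymmetrizer \<mu> =
    (\<lambda>q\<in>carrier (sym_group (sum_list \<mu>)).
      if \<forall>j\<in>{1..sum_list \<mu>}. tableau_col \<mu> (q j) = tableau_col \<mu> j
      then of_int (sign q) else 0)"

definition young_symmetrizer :: "nat list \<Rightarrow> (nat \<Rightarrow> nat) \<Rightarrow> complex"
  where "young_symmetrizer \<mu> =
    convolution (sum_list \<mu>) (row_symmetrizer \<mu>) (column_antisymmetrizer \<mu>)"

text \<open>The irreducible representation labelled by \<open>\<mu>\<close>: the left ideal of the group algebra
  generated by the Young symmetrizer, with the action by left multiplication.  The one-row
  partition gives the trivial representation.\<close>

definition young_rep :: "nat list \<Rightarrow> (nat \<Rightarrow> nat, (nat \<Rightarrow> nat) \<Rightarrow> complex) rep"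
  where "young_rep \<mu> =
    rep_of
      (function_module (carrier (sym_group (sum_list \<mu>)))
        ((\<lambda>f. convolution (sum_list \<mu>) f (young_symmetrizer \<mu>)) ` group_algebra (sum_list \<mu>)))
      (\<lambda>\<sigma> f. \<lambda>x\<in>carrier (sym_group (sum_list \<mu>)). f (inv' \<sigma> \<circ> x))"


section \<open>Stable multiplicities\<close>

text \<open>The shape \<open>(n - k, a\<^sub>1, \<dots>, a\<^sub>r)\<close> is a partition of \<open>n\<close> only for \<open>n \<ge> k + a\<^sub>1\<close>; smaller
  values of \<open>n\<close> are irrelevant for the stable multiplicity.\<close>

definition padded :: "nat list \<Rightarrow> nat \<Rightarrow> nat list"
  where "padded \<mu> n = (n - sum_list \<mu>) # \<mu>"

definition PConf_multiplicity :: "nat \<Rightarrow> nat \<Rightarrow> nat list \<Rightarrow> nat"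
  where "PConf_multiplicity i n \<mu> =
    multiplicity_in (sym_group n) (young_rep (padded \<mu> n)) (PConf_cohomology i n)"

definition stable_multiplicity :: "nat \<Rightarrow> nat list \<Rightarrow> nat"
  where "stable_multiplicity i \<mu> =
    (THE d. eventually (\<lambda>n. PConf_multiplicity i n \<mu> = d) sequentially)"


section \<open>The modules with action defined above are linear representations\<close>

lemma cring_complex_field: "cring complex_field"
proof (rule cringI)
  show "abelian_group complex_field"
    by (rule abelian_groupI) (auto simp: complex_field_def algebra_simps intro: exI[of _ "- x" for x])
  show "comm_monoid complex_field"
    by (rule comm_monoidI) (auto simp: complex_field_def algebra_simps)
qed (auto simp: complex_field_def algebra_simps)

lemma module_function_module:
  assumes F: "F \<subseteq> extensional S" "(\<lambda>s\<in>S. 0) \<in> F"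
    and add: "\<And>f g. \<lbrakk>f \<in> F; g \<in> F\<rbrakk> \<Longrightarrow> (\<lambda>s\<in>S. f s + g s) \<in> F"
    and smult: "\<And>c f. f \<in> F \<Longrightarrow> (\<lambda>s\<in>S. c * f s) \<in> F"
  shows "Module.module complex_field (function_module S F)"
proof (rule Module.moduleI)
  have ext: "f s = undefined" if "f \<in> F" "s \<notin> S" for f s
    using F that by (auto simp: extensional_def)
  show "abelian_group (function_module S F)"
  proof (rule abelian_groupI)
    fix x assume "x \<in> carrier (function_module S F)"
    then show "\<exists>y\<in>carrier (function_module S F). y \<oplus>\<^bsub>function_module S F\<^esub> x = \<zero>\<^bsub>function_module S F\<^esub>"
      using smult[of x "-1"] 
      by (intro bexI[of _ "\<lambda>s\<in>S. -1 * x s"]) (auto simp: function_module_def restrict_def)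
  qed (use assms in \<open>auto simp: function_module_def restrict_def fun_eq_iff algebra_simps dest: ext\<close>)
  show "cring complex_field" by (rule cring_complex_field)
qed (use assms in \<open>auto simp: function_module_def complex_field_def fun_eq_iff
      extensional_def restrict_def algebra_simps\<close>)

lemma module_quotient_module:
  assumes M: "Module.module complex_field M" and N: "submodule N complex_field M"
  shows "Module.module complex_field (quotient_module M N)"
    and "\<And>c a. a \<in> carrier M \<Longrightarrow> c \<odot>\<^bsub>quotient_module M N\<^esub> (N +>\<^bsub>M\<^esub> a) = N +>\<^bsub>M\<^esub> (c \<odot>\<^bsub>M\<^esub> a)"
    and "\<And>a b. a \<in> carrier M \<Longrightarrow> b \<in> carrier M \<Longrightarrow> (N +>\<^bsub>M\<^esub> a) \<oplus>\<^bsub>quotient_module M N\<^esub> (N +>\<^bsub>M\<^esub> b) = N +>\<^bsub>M\<^esub> (a \<oplus>\<^bsub>M\<^esub> b)"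
proof -
  interpret M: Module.module complex_field M by (rule M)
  interpret N: submodule N complex_field M by (rule N)
  have sg: "subgroup N (add_monoid M)" by unfold_locales
  interpret AN: abelian_subgroup N M
    by (rule abelian_subgroupI3) (use sg M.abelian_group_axioms in \<open>auto simp: additive_subgroup_def\<close>)
  have add: "(N +>\<^bsub>M\<^esub> a) \<oplus>\<^bsub>quotient_module M N\<^esub> (N +>\<^bsub>M\<^esub> b) = N +>\<^bsub>M\<^esub> (a \<oplus>\<^bsub>M\<^esub> b)"
    if "a \<in> carrier M" "b \<in> carrier M" for a b
    using AN.a_rcos_sum[OF that] by (simp add: quotient_module_def)
  have sm: "c \<odot>\<^bsub>quotient_module M N\<^esub> (N +>\<^bsub>M\<^esub> a) = N +>\<^bsub>M\<^esub> (c \<odot>\<^bsub>M\<^esub> a)"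
    if a: "a \<in> carrier M" for c a
  proof -
    have "N +>\<^bsub>M\<^esub> (c \<odot>\<^bsub>M\<^esub> b) = N +>\<^bsub>M\<^esub> (c \<odot>\<^bsub>M\<^esub> a)" if b: "b \<in> N +>\<^bsub>M\<^esub> a" for b
    proof -
      obtain n where n: "n \<in> N" "b = n \<oplus>\<^bsub>M\<^esub> a"
        using b by (auto simp: a_r_coset_defs)
      have nc: "n \<in> carrier M" using n(1) AN.a_Hcarr by blast
      have "c \<odot>\<^bsub>M\<^esub> b = c \<odot>\<^bsub>M\<^esub> n \<oplus>\<^bsub>M\<^esub> c \<odot>\<^bsub>M\<^esub> a"
        using n nc a by (simp add: M.smult_r_distr complex_field_def)
      moreover have "c \<odot>\<^bsub>M\<^esub> n \<in> N"
        using N.smult_closed[of c n] n by (simp add: complex_field_def)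
      ultimately have "c \<odot>\<^bsub>M\<^esub> b \<in> N +>\<^bsub>M\<^esub> (c \<odot>\<^bsub>M\<^esub> a)"
        by (auto simp: a_r_coset_defs)
      then show ?thesis
        using a M.smult_closed[of c a] by (metis AN.a_repr_independence' sg UNIV_I complex_field_def partial_object.select_convs(1))
    qed
    moreover have "a \<in> N +>\<^bsub>M\<^esub> a" using a by (rule AN.a_rcos_self)
    ultimately have "(\<Union>b\<in>N +>\<^bsub>M\<^esub> a. N +>\<^bsub>M\<^esub> (c \<odot>\<^bsub>M\<^esub> b)) = N +>\<^bsub>M\<^esub> (c \<odot>\<^bsub>M\<^esub> a)"
      by blast
    then show ?thesis by (simp only: quotient_module_def module.simps)
  qed
  have rep: "\<exists>a\<in>carrier M. x = N +>\<^bsub>M\<^esub> a" if "x \<in> carrier (quotient_module M N)" for x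
    using that by (auto simp: quotient_module_def A_RCOSETS_def')
  have car: "N +>\<^bsub>M\<^esub> a \<in> carrier (quotient_module M N)" if "a \<in> carrier M" for a
    using that by (auto simp: quotient_module_def A_RCOSETS_def')
  have zero: "\<zero>\<^bsub>quotient_module M N\<^esub> = N +>\<^bsub>M\<^esub> \<zero>\<^bsub>M\<^esub>"
    using AN.a_subset by (auto simp: quotient_module_def a_r_coset_def' )
  have smc: "c \<odot>\<^bsub>M\<^esub> a \<in> carrier M" if "a \<in> carrier M" for c a
    using M.smult_closed[of c a] that by (simp add: complex_field_def)
  show "Module.module complex_field (quotient_module M N)"
  proof (rule Module.moduleI)
    show "abelian_group (quotient_module M N)"
    proof (rule abelian_groupI)
      fix x assume "x \<in> carrier (quotient_module M N)"
      then obtain a where a: "a \<in> carrier M" "x = N +>\<^bsub>M\<^esub> a" using rep by blast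
      then show "\<exists>y\<in>carrier (quotient_module M N). y \<oplus>\<^bsub>quotient_module M N\<^esub> x = \<zero>\<^bsub>quotient_module M N\<^esub>"
        by (intro bexI[of _ "N +>\<^bsub>M\<^esub> (\<ominus>\<^bsub>M\<^esub> a)"]) (auto simp: add zero car M.l_neg)
    qed (auto dest!: rep simp: add zero car M.a_ac)
  next
    show "cring complex_field" by (rule cring_complex_field)
  qed (auto dest!: rep simp: add sm car smc M.smult_r_distr M.smult_l_distr M.smult_assoc1)
  show "c \<odot>\<^bsub>quotient_module M N\<^esub> (N +>\<^bsub>M\<^esub> a) = N +>\<^bsub>M\<^esub> (c \<odot>\<^bsub>M\<^esub> a)"  if "a \<in> carrier M" for c a
    by (rule sm[OF that])
  show "(N +>\<^bsub>M\<^esub> a) \<oplus>\<^bsub>quotient_module M N\<^esub> (N +>\<^bsub>M\<^esub> b) = N +>\<^bsub>M\<^esub> (a \<oplus>\<^bsub>M\<^esub> b)"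
    if "a \<in> carrier M" "b \<in> carrier M" for a b
    by (rule add[OF that])
qed

lemma rep_of_simps [simp]:
  "carrier (rep_of M \<rho>) = carrier M" "\<zero>\<^bsub>rep_of M \<rho>\<^esub> = \<zero>\<^bsub>M\<^esub>"
  "v \<oplus>\<^bsub>rep_of M \<rho>\<^esub> w = v \<oplus>\<^bsub>M\<^esub> w" "c \<odot>\<^bsub>rep_of M \<rho>\<^esub> v = c \<odot>\<^bsub>M\<^esub> v"
  "act (rep_of M \<rho>) = \<rho>"
  by (simp_all add: rep_of_def module.defs rep.defs)

lemma module_rep_of:
  assumes "Module.module complex_field M"
  shows "Module.module complex_field (rep_of M \<rho>)"
proof -
  interpret M: Module.module complex_field M by (rule assms)
  show ?thesis
  proof (rule Module.moduleI)
    show "abelian_group (rep_of M \<rho>)"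
    proof (rule abelian_groupI)
      fix x assume "x \<in> carrier (rep_of M \<rho>)"
      then show "\<exists>y\<in>carrier (rep_of M \<rho>). y \<oplus>\<^bsub>rep_of M \<rho>\<^esub> x = \<zero>\<^bsub>rep_of M \<rho>\<^esub>"
        by (intro bexI[of _ "\<ominus>\<^bsub>M\<^esub> x"]) (auto simp: M.l_neg)
    qed (auto simp: M.a_ac)
  qed (auto simp: cring_complex_field M.smult_l_distr M.smult_r_distr M.smult_assoc1)
qed

lemma linear_rep_young_rep: "linear_rep (sym_group (sum_list \<mu>)) (young_rep \<mu>)"
proof -
  define n where "n = sum_list \<mu>"
  define c where "c = young_symmetrizer \<mu>"
  let ?S = "carrier (sym_group n)"
  let ?F = "(\<lambda>f. convolution n f c) ` group_algebra n"
  let ?L = "\<lambda>\<sigma> f. \<lambda>x\<in>?S. f (inv' \<sigma> \<circ> x)"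
  let ?M = "function_module ?S ?F"
  interpret G: group "sym_group n" by (rule sym_group_is_group)
  have eq: "young_rep \<mu> = rep_of ?M ?L"
    by (simp add: young_rep_def n_def c_def)
  have closed: "p \<circ> q \<in> ?S" if "p \<in> ?S" "q \<in> ?S" for p q
    using G.m_closed[OF that] by (simp add: sym_group_mult)
  have invS: "inv' p \<in> ?S" if "p \<in> ?S" for p
    by (rule sym_group_inv_closed[OF that])
  have mod: "Module.module complex_field ?M"
  proof (rule module_function_module)
    show "?F \<subseteq> extensional ?S" by (auto simp: convolution_def)
    show "(\<lambda>s\<in>?S. 0) \<in> ?F"
      by (rule image_eqI[of _ _ "\<lambda>s\<in>?S. 0"]) (auto simp: convolution_def group_algebra_def cong: restrict_cong)
  next
    fix f g assume "f \<in> ?F" "g \<in> ?F"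
    then obtain f' g' where f: "f = convolution n f' c" "f' \<in> group_algebra n"
      and g: "g = convolution n g' c" "g' \<in> group_algebra n" by blast
    show "(\<lambda>s\<in>?S. f s + g s) \<in> ?F"
      by (rule image_eqI[of _ _ "\<lambda>s\<in>?S. f' s + g' s"])
        (auto simp: f g convolution_def group_algebra_def fun_eq_iff sum.distrib algebra_simps)
  next
    fix f and k :: complex assume "f \<in> ?F"
    then obtain f' where f: "f = convolution n f' c" "f' \<in> group_algebra n" by blast
    show "(\<lambda>s\<in>?S. k * f s) \<in> ?F"
      by (rule image_eqI[of _ _ "\<lambda>s\<in>?S. k * f' s"])
        (auto simp: f convolution_def group_algebra_def fun_eq_iff sum_distrib_left algebra_simps)
  qed
  have L: "?L \<sigma> (convolution n f c) = convolution n (?L \<sigma> f) c" if s: "\<sigma> \<in> ?S" for \<sigma> f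
  proof
    fix x
    show "?L \<sigma> (convolution n f c) x = convolution n (?L \<sigma> f) c x"
    proof (cases "x \<in> ?S")
      case True
      have ss: "inv' \<sigma> \<circ> \<sigma> = id" "\<sigma> \<circ> inv' \<sigma> = id" "bij \<sigma>"
        using s permutes_inv_o permutes_bij by (auto simp: sym_group_def)
      have "(\<Sum>y\<in>?S. f y * c (inv' y \<circ> (inv' \<sigma> \<circ> x))) = (\<Sum>z\<in>?S. f (inv' \<sigma> \<circ> z) * c (inv' z \<circ> x))"
      proof (rule sum.reindex_bij_witness[of _ "\<lambda>z. inv' \<sigma> \<circ> z" "\<lambda>y. \<sigma> \<circ> y"])
        fix y assume y: "y \<in> ?S"
        then have "bij y" using permutes_bij by (auto simp: sym_group_def)
        then show "f (inv' \<sigma> \<circ> (\<sigma> \<circ> y)) * c (inv' (\<sigma> \<circ> y) \<circ> x) = f y * c (inv' y \<circ> (inv' \<sigma> \<circ> x))"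
          using ss by (simp add: o_inv_distrib o_assoc)
      qed (use s ss in \<open>auto intro: closed invS simp: o_assoc\<close>)
      then show ?thesis using True closed[OF invS[OF s] True] by (simp add: convolution_def)
    qed (simp add: convolution_def)
  qed
  have "linear_rep (sym_group n) (rep_of ?M ?L)"
  proof (intro linear_rep.intro linear_rep_axioms.intro module_rep_of mod G.is_group)
    fix \<sigma> v assume s: "\<sigma> \<in> ?S" and v: "v \<in> carrier (rep_of ?M ?L)"
    then obtain f where f: "f \<in> group_algebra n" "v = convolution n f c"
      by (auto simp: function_module_def)
    have "?L \<sigma> f \<in> group_algebra n" by (auto simp: group_algebra_def)
    then show "act (rep_of ?M ?L) \<sigma> v \<in> carrier (rep_of ?M ?L)"
      using f L[OF s, of f] by (auto simp: function_module_def)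
  next
    fix v assume "v \<in> carrier (rep_of ?M ?L)"
    then have "v \<in> extensional ?S" by (auto simp: function_module_def convolution_def)
    then show "act (rep_of ?M ?L) \<one>\<^bsub>sym_group n\<^esub> v = v"
      by (simp add: sym_group_one) (auto simp: fun_eq_iff extensional_def)
  next
    fix \<sigma> \<tau> v assume "\<sigma> \<in> ?S" "\<tau> \<in> ?S"
    moreover from this have "bij \<sigma>" "bij \<tau>" using permutes_bij by (auto simp: sym_group_def)
    ultimately show "act (rep_of ?M ?L) (\<sigma> \<otimes>\<^bsub>sym_group n\<^esub> \<tau>) v = act (rep_of ?M ?L) \<sigma> (act (rep_of ?M ?L) \<tau> v)"
      by (auto simp: sym_group_mult o_inv_distrib fun_eq_iff o_assoc intro: closed invS)
  qed (auto simp: function_module_def fun_eq_iff intro: closed invS)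
  then show ?thesis by (simp add: eq n_def)
qed


lemma cochains_iff:
  "\<phi> \<in> cochains p X \<longleftrightarrow>
    (\<forall>a b. singular_chain p X a \<longrightarrow> singular_chain p X b \<longrightarrow> \<phi> (a + b) = \<phi> a + \<phi> b) \<and>
    (\<forall>c. \<not> singular_chain p X c \<longrightarrow> \<phi> c = undefined)"
  by (auto simp: cochains_def hom_def complex_field_def extensional_def)

lemma cocycles_iff:
  "\<phi> \<in> cocycles p X \<longleftrightarrow> \<phi> \<in> cochains p X \<and>
    (\<forall>c. singular_chain (Suc p) X c \<longrightarrow> \<phi> (chain_boundary (Suc p) c) = 0)"
  by (auto simp: cocycles_def coboundary_def fun_eq_iff restrict_def)

lemma coboundary_cocycle: "\<phi> \<in> cochains p X \<Longrightarrow> coboundary p X \<phi> \<in> cocycles (Suc p) X"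
proof -
  assume \<phi>: "\<phi> \<in> cochains p X"
  have "\<phi> (0 + 0) = \<phi> 0 + \<phi> 0" using \<phi> unfolding cochains_iff by blast
  then have "\<phi> 0 = 0" by simp
  with \<phi> show ?thesis
    by (auto simp: cocycles_iff cochains_iff coboundary_def singular_chain_boundary_alt
        chain_boundary_boundary_alt chain_boundary_add singular_chain_add)
qed

lemma module_cocycle_module: "Module.module complex_field (cocycle_module p X)"
  by (rule module_function_module)
    (auto simp: cocycles_iff cochains_iff extensional_def singular_chain_boundary_alt
      singular_chain_add algebra_simps)

lemma coboundaries_subset: "coboundaries p X \<subseteq> cocycles p X"
proof (cases p)
  case 0
  then show ?thesis
    by (auto simp: coboundaries_def cocycles_iff cochains_iff singular_chain_add singular_chain_boundary_alt)
qed (auto simp: coboundaries_def coboundary_cocycle)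

lemma submodule_coboundaries: "submodule (coboundaries p X) complex_field (cocycle_module p X)"
proof (rule module.submoduleI[OF module_cocycle_module])
  interpret M: Module.module complex_field "cocycle_module p X" by (rule module_cocycle_module)
  let ?C = "carrier (chain_group p X)"
  show sub: "coboundaries p X \<subseteq> carrier (cocycle_module p X)"
    using coboundaries_subset by (simp add: function_module_def)
  show 0: "\<zero>\<^bsub>cocycle_module p X\<^esub> \<in> coboundaries p X"
  proof (cases p)
    case (Suc q)
    have "(\<lambda>c\<in>carrier (chain_group q X). 0) \<in> cochains q X"
      by (auto simp: cochains_iff singular_chain_add)
    then show ?thesis using Suc
      by (auto simp: coboundaries_def function_module_def coboundary_def singular_chain_boundary_alt
          fun_eq_iff intro!: rev_image_eqI)
  qed (simp add: coboundaries_def function_module_def)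
  show smult: "k \<odot>\<^bsub>cocycle_module p X\<^esub> a \<in> coboundaries p X" if a: "a \<in> coboundaries p X" for k a
  proof (cases p)
    case 0
    with a show ?thesis by (auto simp: coboundaries_def function_module_def cong: restrict_cong)
  next
    case (Suc q)
    then obtain b where b: "b \<in> cochains q X" "a = coboundary q X b"
      using a by (auto simp: coboundaries_def)
    have "(\<lambda>c\<in>carrier (chain_group q X). k * b c) \<in> cochains q X"
      using b by (auto simp: cochains_iff singular_chain_add algebra_simps)
    moreover have "k \<odot>\<^bsub>cocycle_module p X\<^esub> a = coboundary q X (\<lambda>c\<in>carrier (chain_group q X). k * b c)"
      by (auto simp: b Suc function_module_def coboundary_def singular_chain_boundary_alt fun_eq_iff)
    ultimately show ?thesis using Suc by (simp add: coboundaries_def)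
  qed
  show "\<ominus>\<^bsub>cocycle_module p X\<^esub> a \<in> coboundaries p X" if a: "a \<in> coboundaries p X" for a
  proof -
    have "a \<in> carrier (cocycle_module p X)" using a sub by blast
    then have "(\<ominus>\<^bsub>complex_field\<^esub> \<one>\<^bsub>complex_field\<^esub>) \<odot>\<^bsub>cocycle_module p X\<^esub> a = \<ominus>\<^bsub>cocycle_module p X\<^esub> a"
      using M.smult_l_minus[of "\<one>\<^bsub>complex_field\<^esub>" a] M.smult_one[of a] M.R.one_closed by simp
    then show ?thesis using smult[OF a] by metis
  qed
  show "a \<oplus>\<^bsub>cocycle_module p X\<^esub> b \<in> coboundaries p X"
    if a: "a \<in> coboundaries p X" and b: "b \<in> coboundaries p X" for a b
  proof (cases p)
    case 0
    with a b show ?thesis by (auto simp: coboundaries_def function_module_def cong: restrict_cong)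
  next
    case (Suc q)
    then obtain a' b' where b: "a' \<in> cochains q X" "a = coboundary q X a'" "b' \<in> cochains q X" "b = coboundary q X b'"
      using a b by (auto simp: coboundaries_def)
    have "(\<lambda>c\<in>carrier (chain_group q X). a' c + b' c) \<in> cochains q X"
      using b by (auto simp: cochains_iff singular_chain_add algebra_simps)
    moreover have "a \<oplus>\<^bsub>cocycle_module p X\<^esub> b = coboundary q X (\<lambda>c\<in>carrier (chain_group q X). a' c + b' c)"
      by (auto simp: b Suc function_module_def coboundary_def singular_chain_boundary_alt fun_eq_iff)
    ultimately show ?thesis using Suc by (simp add: coboundaries_def)
  qed
qed

lemma cochain_pullback_cochain:
  assumes f: "continuous_map X Y f" and \<phi>: "\<phi> \<in> cochains p Y"
  shows "cochain_pullback p X f \<phi> \<in> cochains p X"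
  using \<phi> singular_chain_chain_map[OF _ f]
  by (auto simp: cochains_iff cochain_pullback_def singular_chain_add chain_map_add)

lemma cochain_pullback_coboundary:
  assumes f: "continuous_map X Y f"
  shows "cochain_pullback (Suc p) X f (coboundary p Y \<phi>) = coboundary p X (cochain_pullback p X f \<phi>)"
  using singular_chain_chain_map[OF _ f]
  by (auto simp: fun_eq_iff cochain_pullback_def coboundary_def singular_chain_boundary_alt
      chain_boundary_chain_map)

lemma cochain_pullback_cocycle:
  assumes f: "continuous_map X Y f" and \<phi>: "\<phi> \<in> cocycles p Y"
  shows "cochain_pullback p X f \<phi> \<in> cocycles p X"
proof -
  have "cochain_pullback p X f \<phi> (chain_boundary (Suc p) c) = 0" if c: "singular_chain (Suc p) X c" for c
  proof -
    have "chain_map p f (chain_boundary (Suc p) c) = chain_boundary (Suc p) (chain_map (Suc p) f c)"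
      using chain_boundary_chain_map[OF c, of f] by simp
    then show ?thesis
      using \<phi> singular_chain_chain_map[OF c f] singular_chain_boundary_alt[OF c]
      by (auto simp: cocycles_iff cochain_pullback_def)
  qed
  then show ?thesis using cochain_pullback_cochain[OF f] \<phi> by (auto simp: cocycles_iff)
qed

lemma cochain_pullback_coboundaries:
  assumes f: "continuous_map X Y f" and \<phi>: "\<phi> \<in> coboundaries p Y"
  shows "cochain_pullback p X f \<phi> \<in> coboundaries p X"
proof (cases p)
  case 0
  with \<phi> singular_chain_chain_map[OF _ f] show ?thesis
    by (auto simp: coboundaries_def cochain_pullback_def fun_eq_iff)
next
  case (Suc q)
  with \<phi> show ?thesis
    by (auto simp: coboundaries_def cochain_pullback_coboundary[OF f] cochain_pullback_cochain[OF f])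
qed

abbreviation cohomology_class :: "nat \<Rightarrow> 'a topology \<Rightarrow> ('a chain \<Rightarrow> complex) \<Rightarrow> ('a chain \<Rightarrow> complex) set"
  where "cohomology_class p X \<phi> \<equiv> coboundaries p X +>\<^bsub>cocycle_module p X\<^esub> \<phi>"

lemma cohomology_pullback_class:
  assumes f: "continuous_map X Y f" and \<phi>: "\<phi> \<in> cocycles p Y"
  shows "cohomology_pullback p X f (cohomology_class p Y \<phi>) =
    cohomology_class p X (cochain_pullback p X f \<phi>)"
proof -
  interpret M: Module.module complex_field "cocycle_module p X" by (rule module_cocycle_module)
  interpret N: submodule "coboundaries p X" complex_field "cocycle_module p X"
    by (rule submodule_coboundaries)
  have sg: "subgroup (coboundaries p X) (add_monoid (cocycle_module p X))" by unfold_locales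
  interpret AN: abelian_subgroup "coboundaries p X" "cocycle_module p X"
    by (rule abelian_subgroupI3) (use sg M.abelian_group_axioms in \<open>auto simp: additive_subgroup_def\<close>)
  have *: "cohomology_class p X (cochain_pullback p X f \<psi>) = cohomology_class p X (cochain_pullback p X f \<phi>)"
    if \<psi>: "\<psi> \<in> cohomology_class p Y \<phi>" for \<psi>
  proof -
    obtain \<beta> where \<beta>: "\<beta> \<in> coboundaries p Y" "\<psi> = \<beta> \<oplus>\<^bsub>cocycle_module p Y\<^esub> \<phi>"
      using \<psi> by (auto simp: a_r_coset_defs)
    have "cochain_pullback p X f \<psi> = cochain_pullback p X f \<beta> \<oplus>\<^bsub>cocycle_module p X\<^esub> cochain_pullback p X f \<phi>"
      using singular_chain_chain_map[OF _ f]
      by (auto simp: \<beta>(2) function_module_def cochain_pullback_def fun_eq_iff)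
    then have "cochain_pullback p X f \<psi> \<in> cohomology_class p X (cochain_pullback p X f \<phi>)"
      using cochain_pullback_coboundaries[OF f \<beta>(1)] by (auto simp: a_r_coset_defs)
    moreover have "cochain_pullback p X f \<phi> \<in> carrier (cocycle_module p X)"
      using cochain_pullback_cocycle[OF f \<phi>] by (simp add: function_module_def)
    ultimately show ?thesis by (metis AN.a_repr_independence')
  qed
  have "\<zero>\<^bsub>cocycle_module p Y\<^esub> \<in> coboundaries p Y"
    using submodule_coboundaries[of p Y] subgroup.one_closed submodule.axioms(1) by fastforce
  moreover have "\<zero>\<^bsub>cocycle_module p Y\<^esub> \<oplus>\<^bsub>cocycle_module p Y\<^esub> \<phi> = \<phi>"
    using \<phi> by (auto simp: function_module_def fun_eq_iff cocycles_iff cochains_iff)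
  ultimately have "\<phi> \<in> cohomology_class p Y \<phi>"
    by (force simp: a_r_coset_defs)
  with * show ?thesis unfolding cohomology_pullback_def by blast
qed

lemma continuous_map_PConf:
  assumes "\<sigma> permutes {1..n}"
  shows "continuous_map (PConf n) (PConf n) (\<lambda>x. x \<circ> \<sigma>)"
proof -
  have "continuous_map (PConf n) (product_topology (\<lambda>_. euclidean) {1..n}) (\<lambda>x. x \<circ> \<sigma>)"
    unfolding continuous_map_componentwise PConf_def
  proof (intro conjI ballI)
    show "(\<lambda>x. x \<circ> \<sigma>) ` topspace (subtopology (product_topology (\<lambda>_. euclidean) {1..n}) {x. inj_on x {1..n}})
        \<subseteq> extensional {1..n}"
      using permutes_not_in[OF assms] by (auto simp: PiE_def extensional_def)
    fix k assume "k \<in> {1..n}"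
    then have "\<sigma> k \<in> {1..n}" using permutes_in_image[OF assms] by blast
    then show "continuous_map (subtopology (product_topology (\<lambda>_. euclidean) {1..n}) {x. inj_on x {1..n}})
        euclidean (\<lambda>x. (x \<circ> \<sigma>) k)"
      using continuous_map_from_subtopology[OF continuous_map_product_projection[of "\<sigma> k" "{1..n}" "\<lambda>_. euclidean"]]
      by (simp add: comp_def)
  qed
  moreover have "inj_on (x \<circ> \<sigma>) {1..n}" if "inj_on x {1..n}" for x :: "nat \<Rightarrow> complex"
    using that assms by (metis comp_inj_on permutes_image permutes_inj_on)
  ultimately show ?thesis
    by (auto simp: PConf_def continuous_map_in_subtopology)
qed

lemma linear_rep_PConf_cohomology: "linear_rep (sym_group n) (PConf_cohomology i n)"
proof -
  let ?X = "PConf n" and ?M = "cocycle_module i (PConf n)" and ?N = "coboundaries i (PConf n)"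
  let ?f = "\<lambda>\<sigma> x. x \<circ> (\<sigma> :: nat \<Rightarrow> nat)" and ?V = "PConf_cohomology i n"
  let ?S = "carrier (sym_group n)" and ?cl = "cohomology_class i (PConf n)"
  interpret G: group "sym_group n" by (rule sym_group_is_group)
  interpret M: Module.module complex_field ?M by (rule module_cocycle_module)
  note Q = module_quotient_module[OF module_cocycle_module[of i ?X] submodule_coboundaries[of i ?X]]
  have cont: "continuous_map ?X ?X (?f \<sigma>)" if "\<sigma> \<in> ?S" for \<sigma>
    using continuous_map_PConf that by (simp add: sym_group_def)
  have cM: "carrier (function_module S F) = F" for S and F :: "('s \<Rightarrow> complex) set"
    by (simp add: function_module_def)
  have rep: "\<exists>\<phi>\<in>cocycles i ?X. v = ?cl \<phi>" if "v \<in> carrier ?V" for v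
    using that by (auto simp: PConf_cohomology_def cohomology_def quotient_module_def A_RCOSETS_def' cM)
  have car: "?cl \<phi> \<in> carrier ?V" if "\<phi> \<in> cocycles i ?X" for \<phi>
    using that by (auto simp: PConf_cohomology_def cohomology_def quotient_module_def A_RCOSETS_def' cM)
  have act: "act ?V \<sigma> (?cl \<phi>) = ?cl (cochain_pullback i ?X (?f \<sigma>) \<phi>)"
    if "\<sigma> \<in> ?S" "\<phi> \<in> cocycles i ?X" for \<sigma> \<phi>
    using cohomology_pullback_class[OF cont] that by (simp add: PConf_cohomology_def)
  have pb: "cochain_pullback i ?X (?f \<sigma>) \<phi> \<in> cocycles i ?X" if "\<sigma> \<in> ?S" "\<phi> \<in> cocycles i ?X" for \<sigma> \<phi>
    using cochain_pullback_cocycle[OF cont] that by blast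
  have add: "?cl \<phi> \<oplus>\<^bsub>?V\<^esub> ?cl \<psi> = ?cl (\<phi> \<oplus>\<^bsub>?M\<^esub> \<psi>)" if "\<phi> \<in> cocycles i ?X" "\<psi> \<in> cocycles i ?X" for \<phi> \<psi>
    using Q(3) that by (simp add: PConf_cohomology_def cohomology_def cM)
  have smult: "c \<odot>\<^bsub>?V\<^esub> ?cl \<phi> = ?cl (c \<odot>\<^bsub>?M\<^esub> \<phi>)" if "\<phi> \<in> cocycles i ?X" for c \<phi>
    using Q(2) that by (simp add: PConf_cohomology_def cohomology_def cM)
  have add_closed: "\<phi> \<oplus>\<^bsub>?M\<^esub> \<psi> \<in> cocycles i ?X" if "\<phi> \<in> cocycles i ?X" "\<psi> \<in> cocycles i ?X" for \<phi> \<psi>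
    using M.a_closed[of \<phi> \<psi>] that by (simp only: cM)
  have smult_closed: "c \<odot>\<^bsub>?M\<^esub> \<phi> \<in> cocycles i ?X" if "\<phi> \<in> cocycles i ?X" for c \<phi>
    using M.smult_closed[of c \<phi>] that by (simp add: cM complex_field_def)
  have chain: "singular_chain i ?X (chain_map i (?f \<sigma>) c)" if "\<sigma> \<in> ?S" "singular_chain i ?X c" for \<sigma> c
    using singular_chain_chain_map[OF that(2) cont[OF that(1)]] .
  show ?thesis
  proof (intro linear_rep.intro linear_rep_axioms.intro G.is_group)
    show "Module.module complex_field ?V"
      using Q(1) by (simp add: PConf_cohomology_def cohomology_def module_rep_of)
  next
    fix \<sigma> v assume s: "\<sigma> \<in> ?S" and v: "v \<in> carrier ?V"
    then obtain \<phi> where \<phi>: "\<phi> \<in> cocycles i ?X" "v = ?cl \<phi>" using rep by blast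
    show "act ?V \<sigma> v \<in> carrier ?V" using \<phi> s by (simp add: act car pb del: carrier_chain_group)
    show "act ?V \<sigma> (c \<odot>\<^bsub>?V\<^esub> v) = c \<odot>\<^bsub>?V\<^esub> act ?V \<sigma> v" for c
    proof -
      have "cochain_pullback i ?X (?f \<sigma>) (c \<odot>\<^bsub>?M\<^esub> \<phi>) = c \<odot>\<^bsub>?M\<^esub> cochain_pullback i ?X (?f \<sigma>) \<phi>"
        by (auto simp: function_module_def cochain_pullback_def fun_eq_iff chain s)
      with \<phi> s show ?thesis by (simp add: act smult smult_closed pb del: carrier_chain_group)
    qed
    fix w assume "w \<in> carrier ?V"
    then obtain \<psi> where \<psi>: "\<psi> \<in> cocycles i ?X" "w = ?cl \<psi>" using rep by blast
    have "cochain_pullback i ?X (?f \<sigma>) (\<phi> \<oplus>\<^bsub>?M\<^esub> \<psi>)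
        = cochain_pullback i ?X (?f \<sigma>) \<phi> \<oplus>\<^bsub>?M\<^esub> cochain_pullback i ?X (?f \<sigma>) \<psi>"
      by (auto simp: function_module_def cochain_pullback_def fun_eq_iff chain s)
    with \<phi> \<psi> s show "act ?V \<sigma> (v \<oplus>\<^bsub>?V\<^esub> w) = act ?V \<sigma> v \<oplus>\<^bsub>?V\<^esub> act ?V \<sigma> w"
      by (simp add: act add add_closed pb del: carrier_chain_group)
  next
    fix v assume v: "v \<in> carrier ?V"
    then obtain \<phi> where \<phi>: "\<phi> \<in> cocycles i ?X" "v = ?cl \<phi>" using rep by blast
    have "chain_map i (?f id) c = c" if "singular_chain i ?X c" for c
      using chain_map_id_gen[OF that, of "?f id"] by simp
    then have "cochain_pullback i ?X (?f id) \<phi> = \<phi>"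
      using \<phi>(1) by (auto simp: cochain_pullback_def fun_eq_iff cocycles_iff cochains_iff)
    then show "act ?V \<one>\<^bsub>sym_group n\<^esub> v = v"
      using \<phi> act[OF G.one_closed] by (simp add: sym_group_one del: carrier_chain_group)
  next
    fix \<sigma> \<tau> v assume s: "\<sigma> \<in> ?S" and t: "\<tau> \<in> ?S" and v: "v \<in> carrier ?V"
    then obtain \<phi> where \<phi>: "\<phi> \<in> cocycles i ?X" "v = ?cl \<phi>" using rep by blast
    have "?f (\<sigma> \<circ> \<tau>) = (?f \<tau> \<circ> ?f \<sigma> :: (nat \<Rightarrow> complex) \<Rightarrow> _)" by (auto simp: fun_eq_iff)
    then have "chain_map i (?f (\<sigma> \<circ> \<tau>)) c = chain_map i (?f \<tau>) (chain_map i (?f \<sigma>) c)"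
      for c :: "(nat \<Rightarrow> complex) chain"
      by (simp only: chain_map_compose comp_apply)
    then have "cochain_pullback i ?X (?f (\<sigma> \<circ> \<tau>)) \<phi>
        = cochain_pullback i ?X (?f \<sigma>) (cochain_pullback i ?X (?f \<tau>) \<phi>)"
      by (auto simp: cochain_pullback_def fun_eq_iff chain s)
    then show "act ?V (\<sigma> \<otimes>\<^bsub>sym_group n\<^esub> \<tau>) v = act ?V \<sigma> (act ?V \<tau> v)"
      using \<phi> s t act[OF G.m_closed[OF s t]] by (simp add: act pb sym_group_mult del: carrier_chain_group)
  qed
qed

end

theory Submission
  imports Defs "HOL-Library.Function_Algebras"
begin

text \<open>Forgetting all conditions on the last point except \<open>x\<^sub>n \<noteq> x\<^sub>a\<close>, for each \<open>a < n\<close>, gives jointly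
  injective maps on homology by Mayer--Vietoris, because each of the resulting spaces surjects in
  homology onto the space without any condition on \<open>x\<^sub>n\<close>.  Iterating, \<open>H\<^sub>i(PConf\<^sub>n)\<close> embeds into a
  sum of groups \<open>H\<^sub>i((\<complex> - 0)\<^sup>n\<^sup>-\<^sup>1)\<close> under maps with coordinates \<open>x\<^sub>j - x\<^sub>f\<^sub>(\<^sub>j\<^sub>)\<close>, \<open>f j < j\<close>, and a class of
  degree \<open>i\<close> on such a torus is detected by the projections to \<open>i\<close> coordinates.  Dually,
  \<open>H\<^sup>i(PConf\<^sub>n; \<complex>)\<close> is spanned by finitely many classes that each involve at most \<open>2 i\<close> points and
  are therefore fixed by the permutations of the other \<open>n - 2 i\<close> or more points.  If \<open>2 i < k\<close>, these
  outnumber the \<open>n - k\<close> columns of the Young diagram of \<open>V(\<lambda>)\<^sub>n\<close>, and a permutation group on more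
  points than there are columns fixes no nonzero vector of \<open>V(\<lambda>)\<^sub>n\<close>.\<close>

section \<open>Functionals on abelian groups\<close>

text \<open>Classes are tracked in homology, where exactness and excision are at hand, and reach
  cohomology only at the end. This loses nothing because \<open>complex\<close> is divisible, hence
  injective as an abelian group: functionals extend from subgroups, a joint embedding of homology
  groups dualizes to a surjection between spaces of functionals, and cohomology is the full space of
  functionals on homology. What has to be shown about configuration spaces is therefore joint
  injectivity of maps to simpler spaces; their homology is never computed.

  Finite dimension has to travel along. A multiplicity is a definite description, and to conclude
  that it is 0 one needs some decomposition into irreducibles, which Maschke's theorem yields from a
  finite spanning set.

  The restriction \<open>f j < j\<close> reflects that points are added one at a time, each compared
  with an earlier one.\<close>

definition cdual :: "('a, 'b) monoid_scheme \<Rightarrow> ('a \<Rightarrow> complex) set"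
  where "cdual G = {\<psi>. \<forall>x\<in>carrier G. \<forall>y\<in>carrier G. \<psi> (x \<otimes>\<^bsub>G\<^esub> y) = \<psi> x + \<psi> y}"

lemma cdualD: "\<psi> \<in> cdual G \<Longrightarrow> x \<in> carrier G \<Longrightarrow> y \<in> carrier G \<Longrightarrow> \<psi> (x \<otimes>\<^bsub>G\<^esub> y) = \<psi> x + \<psi> y"
  by (simp add: cdual_def)

context group begin

lemma cdual_one: "\<psi> \<in> cdual G \<Longrightarrow> \<psi> \<one> = 0"
  using cdualD[of \<psi> G \<one> \<one>] by simp

lemma cdual_inv: "\<psi> \<in> cdual G \<Longrightarrow> x \<in> carrier G \<Longrightarrow> \<psi> (inv x) = - \<psi> x"
  using cdualD[of \<psi> G x "inv x"] cdual_one[of \<psi>] by (simp add: add.commute eq_neg_iff_add_eq_0)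

end

lemma cdual_comp: "g \<in> hom B C \<Longrightarrow> \<psi> \<in> cdual C \<Longrightarrow> (\<lambda>x. \<psi> (g x)) \<in> cdual B"
  by (auto simp: cdual_def hom_def)

text \<open>\<open>R\<close> is the graph of a homomorphism from a subgroup to the additive group of
  \<open>complex\<close>. As graphs, partial homomorphisms are ordered by inclusion, and unions of
  chains serve as upper bounds for Zorn's lemma.\<close>

locale partial_character = comm_group +
  fixes R :: "('a \<times> complex) set"
  assumes R_carrier: "(x, r) \<in> R \<Longrightarrow> x \<in> carrier G"
    and R_one: "(\<one>, 0) \<in> R"
    and R_mult: "(x, r) \<in> R \<Longrightarrow> (y, s) \<in> R \<Longrightarrow> (x \<otimes> y, r + s) \<in> R"
    and R_inv: "(x, r) \<in> R \<Longrightarrow> (inv x, - r) \<in> R"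
    and R_unique: "(x, r) \<in> R \<Longrightarrow> (x, s) \<in> R \<Longrightarrow> r = s"
begin

lemma R_nat_pow: "(x, r) \<in> R \<Longrightarrow> (x [^] (k::nat), of_nat k * r) \<in> R"
proof (induction k)
  case (Suc k)
  then show ?case using R_mult[OF Suc.IH Suc.prems] by (simp add: algebra_simps)
qed (simp add: R_one)

lemma R_int_pow:
  assumes "(x, r) \<in> R"
  shows "(x [^] (k::int), of_int k * r) \<in> R"
proof (cases k rule: int_cases2)
  case (nonneg n)
  then show ?thesis using R_nat_pow[OF assms, of n] by (simp add: int_pow_int)
next
  case (nonpos n)
  then show ?thesis using R_inv[OF R_nat_pow[OF assms, of n]] R_carrier[OF assms]
    by (simp add: int_pow_neg int_pow_int)
qed

text \<open>Divisibility of \<open>complex\<close> enters here: if some power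
  \<open>g [^] k0\<close> with nonzero \<open>k0\<close> already has a value \<open>r0\<close>, then
  \<open>g\<close> receives \<open>r0 / k0\<close>. Otherwise any value would do, and 0 is
  taken.\<close>

lemma extend_one:
  assumes g: "g \<in> carrier G"
  shows "\<exists>R'. partial_character G R' \<and> R \<subseteq> R' \<and> g \<in> Domain R'"
proof -
  obtain v where v: "\<And>k r. (g [^] (k::int), r) \<in> R \<Longrightarrow> r = of_int k * v"
  proof (cases "\<exists>k r. k \<noteq> 0 \<and> (g [^] (k::int), r) \<in> R")
    case True
    then obtain k0 :: int and r0 where k0: "k0 \<noteq> 0" "(g [^] k0, r0) \<in> R" by blast
    show thesis
    proof (rule that[of "r0 / of_int k0"])
      fix k :: int and r assume "(g [^] k, r) \<in> R"
      then have "(g [^] (k * k0), of_int k0 * r) \<in> R" "(g [^] (k * k0), of_int k * r0) \<in> R"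
        using R_int_pow[of "g [^] k" r k0] R_int_pow[OF k0(2), of k] g
        by (simp_all add: int_pow_pow mult.commute)
      then have "of_int k0 * r = of_int k * r0" by (rule R_unique)
      then show "r = of_int k * (r0 / of_int k0)" using k0(1) by (simp add: field_simps)
    qed
  next
    case False
    show thesis
    proof (rule that[of 0])
      fix k :: int and r assume kr: "(g [^] k, r) \<in> R"
      then have "k = 0" using False by blast
      then show "r = of_int k * 0" using R_unique[OF _ R_one] kr by simp
    qed
  qed
  define R' where "R' = {(x \<otimes> g [^] (k::int), r + of_int k * v) | x r k. (x, r) \<in> R}"
  have R'I: "(x \<otimes> g [^] (k::int), r + of_int k * v) \<in> R'" if "(x, r) \<in> R" for x r k
    using that by (auto simp: R'_def)
  have "partial_character G R'"
  proof unfold_locales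
    fix x r assume "(x, r) \<in> R'"
    then obtain a s k where a: "x = a \<otimes> g [^] (k::int)" "r = s + of_int k * v" "(a, s) \<in> R"
      by (auto simp: R'_def)
    show "x \<in> carrier G" using a R_carrier g by auto
    have "inv x = inv a \<otimes> g [^] (- k)" using a R_carrier[OF a(3)] g
      by (simp add: inv_mult int_pow_neg)
    then show "(inv x, - r) \<in> R'" using R'I[OF R_inv[OF a(3)], of "- k"] a by simp
    fix y s' assume "(y, s') \<in> R'"
    then obtain b t l where b: "y = b \<otimes> g [^] (l::int)" "s' = t + of_int l * v" "(b, t) \<in> R"
      by (auto simp: R'_def)
    have "x \<otimes> y = (a \<otimes> b) \<otimes> g [^] (k + l)" using a b R_carrier[OF a(3)] R_carrier[OF b(3)] g
      by (simp add: int_pow_mult[OF g] m_ac)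
    then show "(x \<otimes> y, r + s') \<in> R'" using R'I[OF R_mult[OF a(3) b(3)], of "k + l"] a b
      by (simp add: algebra_simps)
  next
    show "(\<one>, 0) \<in> R'" using R'I[OF R_one, of 0] by simp
  next
    fix x r s assume "(x, r) \<in> R'" "(x, s) \<in> R'"
    obtain a r' k where a: "x = a \<otimes> g [^] (k::int)" "r = r' + of_int k * v" "(a, r') \<in> R"
      using \<open>(x, r) \<in> R'\<close> unfolding R'_def by blast
    obtain b s' l where b: "x = b \<otimes> g [^] (l::int)" "s = s' + of_int l * v" "(b, s') \<in> R"
      using \<open>(x, s) \<in> R'\<close> unfolding R'_def by blast
    have ac: "a \<in> carrier G" and bc: "b \<in> carrier G" using a b R_carrier by auto
    \<comment> \<open>Two ways to write \<open>x\<close> differ by a power of \<open>g\<close> that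
      lies in the old domain, where its value is forced to be a multiple of
      \<open>v\<close>.\<close>
    have "g [^] (k - l) = inv a \<otimes> (a \<otimes> g [^] k) \<otimes> inv (g [^] l)"
      using g ac by (simp add: int_pow_diff m_assoc[symmetric])
    also have "\<dots> = inv a \<otimes> (b \<otimes> g [^] l) \<otimes> inv (g [^] l)" using a(1) b(1) by simp
    also have "\<dots> = inv a \<otimes> b" using g ac bc by (simp add: m_assoc)
    finally have "(g [^] (k - l), - r' + s') \<in> R" using R_mult[OF R_inv[OF a(3)] b(3)] by simp
    then have "- r' + s' = of_int (k - l) * v" by (rule v)
    then show "r = s" using a b by (simp add: algebra_simps)
  qed
  moreover have "R \<subseteq> R'"
  proof
    fix z assume z: "z \<in> R"
    then show "z \<in> R'" using R'I[of "fst z" "snd z" 0] R_carrier[of "fst z" "snd z"] by simp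
  qed
  moreover have "g \<in> Domain R'" using R'I[OF R_one, of 1] g by auto
  ultimately show ?thesis by blast
qed

end

text \<open>Baer's argument: a maximal extension is defined everywhere, because
  \<open>extend_one\<close> could enlarge any other.\<close>

lemma (in comm_group) partial_character_extends:
  assumes "partial_character G R"
  shows "\<exists>\<eta>\<in>cdual G. \<forall>x r. (x, r) \<in> R \<longrightarrow> \<eta> x = r"
proof -
  let ?A = "{R'. partial_character G R' \<and> R \<subseteq> R'}"
  have "\<exists>M\<in>?A. \<forall>X\<in>?A. M \<subseteq> X \<longrightarrow> X = M"
  proof (rule subset_Zorn_nonempty)
    show "?A \<noteq> {}" using assms by blast
    fix C assume C: "C \<noteq> {}" "subset.chain ?A C"
    have Cp: "partial_character G X" "R \<subseteq> X" if "X \<in> C" for X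
      using C that by (auto simp: subset.chain_def)
    have two: "\<exists>X\<in>C. z \<in> X \<and> w \<in> X" if "z \<in> \<Union>C" "w \<in> \<Union>C" for z w
    proof -
      obtain X Y where XY: "X \<in> C" "Y \<in> C" "z \<in> X" "w \<in> Y" using \<open>z \<in> \<Union>C\<close> \<open>w \<in> \<Union>C\<close> by blast
      then have "X \<subseteq> Y \<or> Y \<subseteq> X" using C(2) by (auto simp: subset_chain_def)
      then show ?thesis using XY by blast
    qed
    have "partial_character G (\<Union>C)"
    proof unfold_locales
      show "(\<one>, 0) \<in> \<Union>C" using C Cp(1) partial_character.R_one by blast
    next
      fix x r y s assume "(x, r) \<in> \<Union>C" "(y, s) \<in> \<Union>C"
      then obtain X where X: "X \<in> C" "(x, r) \<in> X" "(y, s) \<in> X" using two by blast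
      interpret X: partial_character G X by (rule Cp(1)[OF X(1)])
      show "(x \<otimes> y, r + s) \<in> \<Union>C" using X.R_mult X by blast
    next
      fix x r assume "(x, r) \<in> \<Union>C"
      then obtain X where X: "X \<in> C" "(x, r) \<in> X" by blast
      interpret X: partial_character G X by (rule Cp(1)[OF X(1)])
      show "(inv x, - r) \<in> \<Union>C" "x \<in> carrier G" using X.R_inv X.R_carrier X by blast+
    next
      fix x r s assume "(x, r) \<in> \<Union>C" "(x, s) \<in> \<Union>C"
      then obtain X where X: "X \<in> C" "(x, r) \<in> X" "(x, s) \<in> X" using two by blast
      interpret X: partial_character G X by (rule Cp(1)[OF X(1)])
      show "r = s" using X.R_unique X by blast
    qed
    then show "\<Union>C \<in> ?A" using C Cp(2) by blast
  qed
  then obtain M where M: "partial_character G M" "R \<subseteq> M"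
    and max: "\<forall>X\<in>?A. M \<subseteq> X \<longrightarrow> X = M" by auto
  interpret M: partial_character G M by (rule M)
  have dom: "\<exists>r. (x, r) \<in> M" if x: "x \<in> carrier G" for x
  proof -
    obtain R' where R': "partial_character G R'" "M \<subseteq> R'" "x \<in> Domain R'"
      using M.extend_one[OF x] by auto
    then have "R' = M" using max M(2) by simp
    then show ?thesis using R'(3) by auto
  qed
  define \<eta> where "\<eta> x = (THE r. (x, r) \<in> M)" for x
  have \<eta>: "\<eta> x = r" if "(x, r) \<in> M" for x r
    unfolding \<eta>_def by (rule the_equality) (use that M.R_unique in auto)
  have "\<eta> (x \<otimes> y) = \<eta> x + \<eta> y" if xy: "x \<in> carrier G" "y \<in> carrier G" for x y
  proof -
    obtain r s where "(x, r) \<in> M" "(y, s) \<in> M" using dom xy by meson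
    then show ?thesis using \<eta> M.R_mult by simp
  qed
  then have "\<eta> \<in> cdual G" by (simp add: cdual_def)
  then show ?thesis using \<eta> M(2) by (intro bexI[of _ \<eta>]) auto
qed

text \<open>Injectivity of \<open>complex\<close>: a functional that vanishes on the kernel of
  \<open>g\<close> descends to the image of \<open>g\<close>, a subgroup of \<open>C\<close>, and
  extends from there.\<close>

lemma cdual_factor:
  assumes "comm_group B" "comm_group C" and g: "g \<in> hom B C" and \<psi>: "\<psi> \<in> cdual B"
    and ker: "\<And>b. b \<in> carrier B \<Longrightarrow> g b = \<one>\<^bsub>C\<^esub> \<Longrightarrow> \<psi> b = 0"
  shows "\<exists>\<eta>\<in>cdual C. \<forall>b\<in>carrier B. \<psi> b = \<eta> (g b)"
proof -
  interpret B: comm_group B by fact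
  interpret C: comm_group C by fact
  interpret g: group_hom B C g using g by unfold_locales
  let ?R = "(\<lambda>b. (g b, \<psi> b)) ` carrier B"
  have "partial_character C ?R"
  proof unfold_locales
    show "(\<one>\<^bsub>C\<^esub>, 0) \<in> ?R" using B.cdual_one[OF \<psi>] by (intro image_eqI[of _ _ "\<one>\<^bsub>B\<^esub>"]) auto
  next
    fix x r y s assume "(x, r) \<in> ?R" "(y, s) \<in> ?R"
    then obtain a b where "a \<in> carrier B" "b \<in> carrier B" "x = g a" "r = \<psi> a" "y = g b" "s = \<psi> b"
      by auto
    then show "(x \<otimes>\<^bsub>C\<^esub> y, r + s) \<in> ?R"
      by (intro image_eqI[of _ _ "a \<otimes>\<^bsub>B\<^esub> b"]) (auto simp: cdualD[OF \<psi>])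
  next
    fix x r assume "(x, r) \<in> ?R"
    then obtain a where a: "a \<in> carrier B" "x = g a" "r = \<psi> a" by auto
    then show "x \<in> carrier C" by auto
    show "(inv\<^bsub>C\<^esub> x, - r) \<in> ?R"
      using a by (intro image_eqI[of _ _ "inv\<^bsub>B\<^esub> a"]) (auto simp: B.cdual_inv[OF \<psi>])
  next
    fix x r s assume "(x, r) \<in> ?R" "(x, s) \<in> ?R"
    then obtain a b where ab: "a \<in> carrier B" "b \<in> carrier B" "x = g a" "r = \<psi> a" "x = g b" "s = \<psi> b"
      by auto
    then have "\<psi> (a \<otimes>\<^bsub>B\<^esub> inv\<^bsub>B\<^esub> b) = 0" by (intro ker) (auto simp: C.r_inv)
    then show "r = s" using ab by (simp add: cdualD[OF \<psi>] B.cdual_inv[OF \<psi>])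
  qed
  from C.partial_character_extends[OF this] obtain \<eta> where
    \<eta>: "\<eta> \<in> cdual C" "\<forall>x r. (x, r) \<in> ?R \<longrightarrow> \<eta> x = r" by blast
  show ?thesis
  proof (intro bexI[of _ \<eta>] ballI)
    fix b assume "b \<in> carrier B"
    then have "(g b, \<psi> b) \<in> ?R" by simp
    then show "\<psi> b = \<eta> (g b)" using \<eta>(2) by metis
  qed (rule \<eta>)
qed

text \<open>Apply \<open>cdual_factor\<close> to the map \<open>(g, h)\<close> into the product; a
  functional on a product is the sum of its restrictions to the factors.\<close>

lemma cdual_factor2:
  assumes "comm_group B" "comm_group C" "comm_group D" and g: "g \<in> hom B C" and h: "h \<in> hom B D"
    and \<psi>: "\<psi> \<in> cdual B"
    and ker: "\<And>b. b \<in> carrier B \<Longrightarrow> g b = \<one>\<^bsub>C\<^esub> \<Longrightarrow> h b = \<one>\<^bsub>D\<^esub> \<Longrightarrow> \<psi> b = 0"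
  shows "\<exists>\<eta>\<in>cdual C. \<exists>\<xi>\<in>cdual D. \<forall>b\<in>carrier B. \<psi> b = \<eta> (g b) + \<xi> (h b)"
proof -
  interpret B: comm_group B by fact
  interpret C: comm_group C by fact
  interpret D: comm_group D by fact
  have CD: "comm_group (C \<times>\<times> D)"
    by (intro group.group_comm_groupI DirProd_group C.is_group D.is_group)
      (auto simp: DirProd_def C.m_comm D.m_comm)
  have "(\<lambda>b. (g b, h b)) \<in> hom B (C \<times>\<times> D)" using g h by (auto simp: hom_def DirProd_def)
  from cdual_factor[OF assms(1) CD this \<psi>] obtain \<theta> where
    \<theta>: "\<theta> \<in> cdual (C \<times>\<times> D)" "\<And>b. b \<in> carrier B \<Longrightarrow> \<psi> b = \<theta> (g b, h b)"
    using ker by auto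
  have "(\<lambda>c. \<theta> (c, \<one>\<^bsub>D\<^esub>)) \<in> cdual C" "(\<lambda>d. \<theta> (\<one>\<^bsub>C\<^esub>, d)) \<in> cdual D"
    using cdualD[OF \<theta>(1), of "(_, \<one>\<^bsub>D\<^esub>)" "(_, \<one>\<^bsub>D\<^esub>)"]
      cdualD[OF \<theta>(1), of "(\<one>\<^bsub>C\<^esub>, _)" "(\<one>\<^bsub>C\<^esub>, _)"]
    by (auto simp: cdual_def DirProd_def)
  moreover have "\<psi> b = \<theta> (g b, \<one>\<^bsub>D\<^esub>) + \<theta> (\<one>\<^bsub>C\<^esub>, h b)" if b: "b \<in> carrier B" for b
  proof -
    have "g b \<in> carrier C" "h b \<in> carrier D" using g h b by (auto simp: hom_def)
    then show ?thesis using \<theta>(2)[OF b] cdualD[OF \<theta>(1), of "(g b, \<one>\<^bsub>D\<^esub>)" "(\<one>\<^bsub>C\<^esub>, h b)"]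
      by (simp add: DirProd_def)
  qed
  ultimately show ?thesis
    by (intro bexI[of _ "\<lambda>c. \<theta> (c, \<one>\<^bsub>D\<^esub>)"] bexI[of _ "\<lambda>d. \<theta> (\<one>\<^bsub>C\<^esub>, d)"] ballI)
qed

section \<open>Finitely spanned spaces of functionals\<close>

text \<open>Linear combinations of \<open>F\<close> up to equality on \<open>A\<close>. Functionals
  are total functions whose values off the carrier of the group mean nothing, so the span must not
  see those values.\<close>

inductive_set lspan :: "'a set \<Rightarrow> ('a \<Rightarrow> complex) set \<Rightarrow> ('a \<Rightarrow> complex) set" for A F
  where
    lspan_zero: "\<forall>x\<in>A. \<psi> x = 0 \<Longrightarrow> \<psi> \<in> lspan A F"
  | lspan_step: "\<eta> \<in> F \<Longrightarrow> \<phi> \<in> lspan A F \<Longrightarrow> \<forall>x\<in>A. \<psi> x = c * \<eta> x + \<phi> x \<Longrightarrow> \<psi> \<in> lspan A F"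

lemma lspan_cong: "\<phi> \<in> lspan A F \<Longrightarrow> (\<And>x. x \<in> A \<Longrightarrow> \<psi> x = \<phi> x) \<Longrightarrow> \<psi> \<in> lspan A F"
  by (erule lspan.cases) (auto intro: lspan.intros)

lemma lspan_add:
  assumes "\<phi> \<in> lspan A F" "\<psi> \<in> lspan A F"
  shows "(\<lambda>x. \<phi> x + \<psi> x) \<in> lspan A F"
  using assms(1)
proof induction
  case (lspan_zero \<phi>)
  then show ?case by (auto intro: lspan_cong[OF assms(2)])
next
  case (lspan_step \<eta> \<phi>' \<phi> c)
  then show ?case by (intro lspan.lspan_step[OF lspan_step(1,4), where c = c]) auto
qed

lemma lspan_comp:
  assumes "\<phi> \<in> lspan A F" "\<And>x. x \<in> B \<Longrightarrow> g x \<in> A"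
    and "\<And>\<eta>. \<eta> \<in> F \<Longrightarrow> \<exists>\<eta>'\<in>F'. \<forall>x\<in>B. \<eta>' x = \<eta> (g x)"
  shows "(\<lambda>x. \<phi> (g x)) \<in> lspan B F'"
  using assms(1)
proof induction
  case (lspan_zero \<phi>)
  then show ?case using assms(2) by (auto intro: lspan.lspan_zero)
next
  case (lspan_step \<eta> \<phi>' \<phi> c)
  then obtain \<eta>' where "\<eta>' \<in> F'" "\<forall>x\<in>B. \<eta>' x = \<eta> (g x)" using assms(3) by blast
  then show ?case using lspan_step assms(2)
    by (intro lspan.lspan_step[OF _ lspan_step(4), where c = c and \<eta> = \<eta>']) auto
qed

text \<open>\<open>P\<close> is demanded of a finite spanning set rather than of all functionals,
  since properties such as dependence on few coordinates do not survive addition.\<close>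

definition cogenerated :: "('a, 'b) monoid_scheme \<Rightarrow> (('a \<Rightarrow> complex) \<Rightarrow> bool) \<Rightarrow> bool"
  where "cogenerated H P \<longleftrightarrow>
    (\<exists>F. finite F \<and> F \<subseteq> cdual H \<and> (\<forall>\<eta>\<in>F. P \<eta>) \<and> cdual H \<subseteq> lspan (carrier H) F)"

lemma cogenerated_mono: "cogenerated H P \<Longrightarrow> (\<And>\<eta>. \<eta> \<in> cdual H \<Longrightarrow> P \<eta> \<Longrightarrow> Q \<eta>) \<Longrightarrow> cogenerated H Q"
  unfolding cogenerated_def by (meson subsetD)

text \<open>By \<open>cdual_factor2\<close> each functional on \<open>B\<close> is the sum of one
  pulled back along \<open>g\<close> and one pulled back along \<open>h\<close>, so the pullbacks of
  the two spanning sets together span.\<close>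

lemma cogenerated_jointly_injective:
  assumes "comm_group B" "comm_group C" "comm_group D" and g: "g \<in> hom B C" and h: "h \<in> hom B D"
    and inj: "\<And>b. b \<in> carrier B \<Longrightarrow> g b = \<one>\<^bsub>C\<^esub> \<Longrightarrow> h b = \<one>\<^bsub>D\<^esub> \<Longrightarrow> b = \<one>\<^bsub>B\<^esub>"
    and C: "cogenerated C P" and D: "cogenerated D Q"
    and P: "\<And>\<eta>. \<eta> \<in> cdual C \<Longrightarrow> P \<eta> \<Longrightarrow> R (\<lambda>b. \<eta> (g b))"
    and Q: "\<And>\<eta>. \<eta> \<in> cdual D \<Longrightarrow> Q \<eta> \<Longrightarrow> R (\<lambda>b. \<eta> (h b))"
  shows "cogenerated B R"
proof -
  interpret B: comm_group B by fact
  obtain F where F: "finite F" "F \<subseteq> cdual C" "\<forall>\<eta>\<in>F. P \<eta>" "cdual C \<subseteq> lspan (carrier C) F"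
    using C by (auto simp: cogenerated_def)
  obtain E where E: "finite E" "E \<subseteq> cdual D" "\<forall>\<eta>\<in>E. Q \<eta>" "cdual D \<subseteq> lspan (carrier D) E"
    using D by (auto simp: cogenerated_def)
  define M where "M = (\<lambda>\<eta> b. \<eta> (g b)) ` F \<union> (\<lambda>\<eta> b. \<eta> (h b)) ` E"
  have "\<psi> \<in> lspan (carrier B) M" if \<psi>: "\<psi> \<in> cdual B" for \<psi>
  proof -
    obtain \<eta> \<xi> where *: "\<eta> \<in> cdual C" "\<xi> \<in> cdual D" "\<forall>b\<in>carrier B. \<psi> b = \<eta> (g b) + \<xi> (h b)"
      using cdual_factor2[OF assms(1-5) \<psi>] inj B.cdual_one[OF \<psi>] by fastforce
    have "(\<lambda>b. \<eta> (g b)) \<in> lspan (carrier B) M"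
      by (rule lspan_comp[where F = F and A = "carrier C"])
        (use * F(4) g in \<open>auto simp: M_def hom_def\<close>)
    moreover have "(\<lambda>b. \<xi> (h b)) \<in> lspan (carrier B) M"
      by (rule lspan_comp[where F = E and A = "carrier D"])
        (use * E(4) h in \<open>auto simp: M_def hom_def\<close>)
    ultimately have "(\<lambda>b. \<eta> (g b) + \<xi> (h b)) \<in> lspan (carrier B) M" by (rule lspan_add)
    then show ?thesis by (rule lspan_cong) (use * in auto)
  qed
  moreover have "finite M" "M \<subseteq> cdual B" "\<forall>\<eta>\<in>M. R \<eta>"
    using F E P Q cdual_comp[OF g] cdual_comp[OF h] by (auto simp: M_def)
  ultimately show ?thesis unfolding cogenerated_def by (intro exI[of _ M]) auto
qed

lemma cogenerated_injective:
  assumes "comm_group B" "comm_group C" and g: "g \<in> hom B C"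
    and inj: "\<And>b. b \<in> carrier B \<Longrightarrow> g b = \<one>\<^bsub>C\<^esub> \<Longrightarrow> b = \<one>\<^bsub>B\<^esub>"
    and C: "cogenerated C P"
    and P: "\<And>\<eta>. \<eta> \<in> cdual C \<Longrightarrow> P \<eta> \<Longrightarrow> R (\<lambda>b. \<eta> (g b))"
  shows "cogenerated B R"
  by (rule cogenerated_jointly_injective[OF assms(1,2,2) g g _ C C P P]) (use inj in auto)

text \<open>A functional on \<open>B\<close> is expanded after composition with
  \<open>\<tau>\<close>; the expansion descends to \<open>B\<close> term by term because every
  spanning functional on \<open>C\<close> does.\<close>

lemma cogenerated_surjective:
  assumes \<tau>: "\<tau> \<in> hom C B" and surj: "carrier B \<subseteq> \<tau> ` carrier C"
    and C: "cogenerated C P"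
    and P: "\<And>\<eta>. \<eta> \<in> cdual C \<Longrightarrow> P \<eta> \<Longrightarrow> \<exists>\<xi>\<in>cdual B. R \<xi> \<and> (\<forall>c\<in>carrier C. \<eta> c = \<xi> (\<tau> c))"
  shows "cogenerated B R"
proof -
  obtain F where F: "finite F" "F \<subseteq> cdual C" "\<forall>\<eta>\<in>F. P \<eta>" "cdual C \<subseteq> lspan (carrier C) F"
    using C by (auto simp: cogenerated_def)
  have "\<forall>\<eta>\<in>F. \<exists>\<xi>. \<xi> \<in> cdual B \<and> R \<xi> \<and> (\<forall>c\<in>carrier C. \<eta> c = \<xi> (\<tau> c))"
    using F P by blast
  then obtain e where e: "\<And>\<eta>. \<eta> \<in> F \<Longrightarrow> e \<eta> \<in> cdual B \<and> R (e \<eta>) \<and> (\<forall>c\<in>carrier C. \<eta> c = e \<eta> (\<tau> c))"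
    by metis
  \<comment> \<open>A set-theoretic section, in general not a homomorphism; this suffices because
    \<open>lspan\<close> compares values only.\<close>
  define s where "s = inv_into (carrier C) \<tau>"
  have s: "s b \<in> carrier C" "\<tau> (s b) = b" if "b \<in> carrier B" for b
    using surj that by (auto simp: s_def inv_into_into f_inv_into_f subset_iff)
  have "\<psi> \<in> lspan (carrier B) (e ` F)" if \<psi>: "\<psi> \<in> cdual B" for \<psi>
  proof -
    have "(\<lambda>c. \<psi> (\<tau> c)) \<in> lspan (carrier C) F" using cdual_comp[OF \<tau> \<psi>] F(4) by blast
    then have "(\<lambda>b. \<psi> (\<tau> (s b))) \<in> lspan (carrier B) (e ` F)"
    proof (rule lspan_comp)
      fix \<eta> assume "\<eta> \<in> F"
      then show "\<exists>\<eta>'\<in>e ` F. \<forall>b\<in>carrier B. \<eta>' b = \<eta> (s b)"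
        using e[of \<eta>] s by (intro bexI[of _ "e \<eta>"]) auto
    qed (rule s)
    then show ?thesis by (rule lspan_cong) (use s in auto)
  qed
  then show ?thesis unfolding cogenerated_def using F(1) e by (intro exI[of _ "e ` F"]) auto
qed


section \<open>Homology of pairs\<close>

abbreviation relhom :: "int \<Rightarrow> 'a::topological_space set \<Rightarrow> 'a set \<Rightarrow> 'a chain set monoid"
  where "relhom p A B \<equiv> relative_homology_group p (top_of_set A) B"

abbreviation incl :: "int \<Rightarrow> 'a::topological_space set \<Rightarrow> 'a set \<Rightarrow> 'a set \<Rightarrow> 'a set \<Rightarrow> 'a chain set \<Rightarrow> 'a chain set"
  where "incl p A B A' B' \<equiv> hom_induced p (top_of_set A) B (top_of_set A') B' id"

abbreviation bdry :: "int \<Rightarrow> 'a::topological_space set \<Rightarrow> 'a set \<Rightarrow> 'a chain set \<Rightarrow> 'a chain set"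
  where "bdry p A B \<equiv> hom_boundary p (top_of_set A) B"

lemma hom_one_relhom [simp]:
  "hom_induced p X S Y T f \<one>\<^bsub>relative_homology_group p X S\<^esub> = \<one>\<^bsub>relative_homology_group p Y T\<^esub>"
  "hom_boundary p X S \<one>\<^bsub>relative_homology_group p X S\<^esub> = \<one>\<^bsub>relative_homology_group (p - 1) (subtopology X S) {}\<^esub>"
  by (rule hom_one[OF hom_induced_hom] hom_one[OF hom_boundary_hom]; simp)+

lemma incl_incl:
  assumes "A \<subseteq> A'" "A' \<subseteq> A''" "B \<subseteq> B'" "B' \<subseteq> B''"
  shows "incl p A' B' A'' B'' (incl p A B A' B' z) = incl p A B A'' B'' z"
  using assms by (subst hom_induced_compose') (auto simp: continuous_map_in_subtopology)

lemma subtopology_top_of_set: "B \<subseteq> A \<Longrightarrow> subtopology (top_of_set A) B = top_of_set B"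
  by (simp add: subtopology_subtopology Int_absorb1)

lemma bdry_incl:
  assumes "A \<subseteq> A'" "B \<subseteq> B'" "B \<subseteq> A" "B' \<subseteq> A'"
  shows "bdry p A' B' (incl p A B A' B' z) = incl (p - 1) B {} B' {} (bdry p A B z)"
proof -
  have "continuous_map (top_of_set A) (top_of_set A') id" "id \<in> B \<rightarrow> B'"
    using assms by (auto simp: continuous_map_in_subtopology)
  from naturality_hom_induced[OF this, of p] show ?thesis
    using assms by (simp add: subtopology_top_of_set fun_eq_iff)
qed

lemma bdry_hom: "B \<subseteq> A \<Longrightarrow> bdry p A B \<in> hom (relhom p A B) (relhom (p - 1) B {})"
  using hom_boundary_hom[of p "top_of_set A" B] by (simp add: subtopology_subtopology Int_absorb1)

lemma bdry_one: "B \<subseteq> A \<Longrightarrow> bdry p A B \<one>\<^bsub>relhom p A B\<^esub> = \<one>\<^bsub>relhom (p - 1) B {}\<^esub>"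
  using hom_one_relhom(2)[of p "top_of_set A" B] by (simp add: subtopology_subtopology Int_absorb1 del: hom_one_relhom)

lemma bdry_carrier: "B \<subseteq> A \<Longrightarrow> bdry p A B z \<in> carrier (relhom (p - 1) B {})"
  using hom_boundary_carrier[of p "top_of_set A" B] by (simp add: subtopology_subtopology Int_absorb1)

lemma kernel_incl_relative:
  assumes "B \<subseteq> A"
  shows "kernel (relhom p A {}) (relhom p A B) (incl p A {} A B) = incl p B {} A {} ` carrier (relhom p B {})"
  using homology_exactness_axiom_3[of p "top_of_set A" B] assms by (simp add: subtopology_top_of_set)

lemma kernel_bdry:
  assumes "B \<subseteq> A"
  shows "kernel (relhom p A B) (relhom (p - 1) B {}) (bdry p A B) = incl p A {} A B ` carrier (relhom p A {})"
  using homology_exactness_axiom_1[of p "top_of_set A" B] assms by (simp add: subtopology_top_of_set)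

lemma kernel_incl_absolute:
  assumes "B \<subseteq> A"
  shows "kernel (relhom (p - 1) B {}) (relhom (p - 1) A {}) (incl (p - 1) B {} A {}) = bdry p A B ` carrier (relhom p A B)"
  using homology_exactness_axiom_2[of p "top_of_set A" B] assms by (simp add: subtopology_top_of_set)

lemma exact_absolute:
  assumes "B \<subseteq> A" "z \<in> carrier (relhom p A {})" "incl p A {} A B z = \<one>\<^bsub>relhom p A B\<^esub>"
  obtains w where "w \<in> carrier (relhom p B {})" "incl p B {} A {} w = z"
proof -
  have "z \<in> kernel (relhom p A {}) (relhom p A B) (incl p A {} A B)"
    using assms unfolding kernel_def by simp
  then show thesis using that unfolding kernel_incl_relative[OF assms(1)] by blast
qed

lemma exact_relative:
  assumes "B \<subseteq> A" "z \<in> carrier (relhom p A B)" "bdry p A B z = \<one>\<^bsub>relhom (p - 1) B {}\<^esub>"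
  obtains w where "w \<in> carrier (relhom p A {})" "incl p A {} A B w = z"
proof -
  have "z \<in> kernel (relhom p A B) (relhom (p - 1) B {}) (bdry p A B)"
    using assms unfolding kernel_def by simp
  then show thesis using that unfolding kernel_bdry[OF assms(1)] by blast
qed

lemma exact_boundary:
  assumes "B \<subseteq> A" "z \<in> carrier (relhom (p - 1) B {})" "incl (p - 1) B {} A {} z = \<one>\<^bsub>relhom (p - 1) A {}\<^esub>"
  obtains w where "w \<in> carrier (relhom p A B)" "bdry p A B w = z"
proof -
  have "z \<in> kernel (relhom (p - 1) B {}) (relhom (p - 1) A {}) (incl (p - 1) B {} A {})"
    using assms unfolding kernel_def by simp
  then show thesis using that unfolding kernel_incl_absolute[OF assms(1)] by blast
qed

lemma incl_bdry:
  assumes "B \<subseteq> A" "z \<in> carrier (relhom p A B)"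
  shows "incl (p - 1) B {} A {} (bdry p A B z) = \<one>\<^bsub>relhom (p - 1) A {}\<^esub>"
proof -
  have "bdry p A B z \<in> kernel (relhom (p - 1) B {}) (relhom (p - 1) A {}) (incl (p - 1) B {} A {})"
    unfolding kernel_incl_absolute[OF assms(1)] using assms(2) by (rule imageI)
  then show ?thesis by (simp add: kernel_def)
qed

lemma incl_exact:
  assumes "B \<subseteq> A" "z \<in> carrier (relhom p B {})"
  shows "incl p B {} A B z = \<one>\<^bsub>relhom p A B\<^esub>"
proof -
  have "incl p B {} A {} z \<in> kernel (relhom p A {}) (relhom p A B) (incl p A {} A B)"
    unfolding kernel_incl_relative[OF assms(1)] using assms(2) by (rule imageI)
  then show ?thesis using assms(1) by (simp add: kernel_def incl_incl)
qed

text \<open>The excised set is \<open>X - A\<close>, which is closed and contained in the open set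
  \<open>B\<close>, as the excision axiom requires.\<close>

lemma excision_iso:
  assumes "openin (top_of_set X) A" "openin (top_of_set X) B" "A \<union> B = X"
  shows "incl p A (A \<inter> B) X B \<in> iso (relhom p A (A \<inter> B)) (relhom p X B)"
proof -
  have sub: "A \<subseteq> X" "B \<subseteq> X" using assms by auto
  have "(top_of_set X) closure_of (X - A) \<subseteq> (top_of_set X) interior_of B"
    using assms sub closedin_diff[OF closedin_topspace assms(1)]
    by (auto simp: closure_of_closedin interior_of_openin)
  from homology_excision_axiom[OF this sub(2), of p]
  moreover have "X - (X - A) = A" "B - (X - A) = A \<inter> B" using sub by auto
  ultimately show ?thesis using sub by (simp only: subtopology_top_of_set order_refl)
qed

lemma incl_hom: "incl p A B A' B' \<in> hom (relhom p A B) (relhom p A' B')"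
  by (rule hom_induced_hom)

lemma incl_carrier: "incl p A B A' B' z \<in> carrier (relhom p A' B')"
  by (rule hom_induced_carrier)

lemma iso_eq_one:
  assumes "f \<in> iso G H" "group G" "group H" "x \<in> carrier G" "f x = \<one>\<^bsub>H\<^esub>"
  shows "x = \<one>\<^bsub>G\<^esub>"
proof -
  have "inj_on f (carrier G)" "f \<one>\<^bsub>G\<^esub> = \<one>\<^bsub>H\<^esub>"
    using assms(1) hom_one[OF iso_imp_homomorphism[OF assms(1)] assms(2,3)] by (auto simp: iso_def bij_betw_def)
  then show ?thesis using assms(4,5) inj_onD[of f "carrier G" x "\<one>\<^bsub>G\<^esub>"]
    by (simp add: monoid.one_closed[OF group.is_monoid[OF assms(2)]])
qed

text \<open>In the Mayer-Vietoris sequence, the kernel of the map from \<open>A \<inter> B\<close>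
  to \<open>A\<close> and \<open>B\<close> is the image of the connecting map on degree
  \<open>p + 1\<close> of \<open>X\<close>. That map kills whatever comes from \<open>B\<close>,
  which by \<open>surj\<close> is everything. The argument is carried out with the exact sequences
  of two pairs and excision.\<close>

lemma Mayer_Vietoris_injective:
  assumes opn: "openin (top_of_set X) A" "openin (top_of_set X) B" "A \<union> B = X"
    and surj: "carrier (relhom (p + 1) X {}) \<subseteq> incl (p + 1) B {} X {} ` carrier (relhom (p + 1) B {})"
    and z: "z \<in> carrier (relhom p (A \<inter> B) {})"
    and zA: "incl p (A \<inter> B) {} A {} z = \<one>\<^bsub>relhom p A {}\<^esub>"
    and zB: "incl p (A \<inter> B) {} B {} z = \<one>\<^bsub>relhom p B {}\<^esub>"
  shows "z = \<one>\<^bsub>relhom p (A \<inter> B) {}\<^esub>"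
proof -
  have sub: "A \<subseteq> X" "B \<subseteq> X" using opn(3) by auto
  obtain w where w: "w \<in> carrier (relhom (p + 1) A (A \<inter> B))" "bdry (p + 1) A (A \<inter> B) w = z"
    using exact_boundary[of "A \<inter> B" A z "p + 1"] z zA by auto
  \<comment> \<open>The boundary of \<open>w'\<close> is the image of \<open>z\<close> in
    \<open>B\<close>, which is trivial, so \<open>w'\<close> lifts to \<open>X\<close>; by
    \<open>surj\<close> the lift comes from \<open>B\<close> and dies in the pair.\<close>
  define w' where "w' = incl (p + 1) A (A \<inter> B) X B w"
  have "bdry (p + 1) X B w' = \<one>\<^bsub>relhom p B {}\<^esub>"
    using bdry_incl[of A X "A \<inter> B" B "p + 1" w] sub w zB by (simp add: w'_def)
  then obtain y where y: "y \<in> carrier (relhom (p + 1) X {})" "incl (p + 1) X {} X B y = w'"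
    using exact_relative[of B X w' "p + 1"] sub by (auto simp: w'_def incl_carrier)
  then obtain x where x: "x \<in> carrier (relhom (p + 1) B {})" "y = incl (p + 1) B {} X {} x"
    using surj by blast
  have "w' = \<one>\<^bsub>relhom (p + 1) X B\<^esub>"
    using y(2) x incl_incl[of B X X "{}" "{}" B "p + 1" x] incl_exact[OF sub(2) x(1)] sub by simp
  then have "w = \<one>\<^bsub>relhom (p + 1) A (A \<inter> B)\<^esub>"
    using iso_eq_one[OF excision_iso[OF opn, of "p + 1"] _ _ w(1)] by (simp add: w'_def)
  then show ?thesis using w(2) bdry_one[of "A \<inter> B" A "p + 1"] by simp
qed

text \<open>Only the segments from \<open>f x\<close> to \<open>g x\<close> have to stay in
  \<open>A\<close>: the sets of interest are complements of hyperplanes and need not be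
  convex.\<close>

lemma homotopic_linear:
  fixes f g :: "'a \<Rightarrow> 'i \<Rightarrow> complex"
  assumes f: "continuous_map X (top_of_set A) f" and g: "continuous_map X (top_of_set A) g"
    and conv: "\<And>x t. x \<in> topspace X \<Longrightarrow> 0 \<le> t \<Longrightarrow> t \<le> 1 \<Longrightarrow> (\<lambda>j. (1 - t) *\<^sub>R f x j + t *\<^sub>R g x j) \<in> A"
  shows "homotopic_with (\<lambda>_. True) X (top_of_set A) f g"
proof -
  let ?I = "top_of_set {0..1::real}"
  let ?h = "\<lambda>(t, x). \<lambda>j. (1 - t) *\<^sub>R f x j + t *\<^sub>R g x j"
  have comp: "continuous_map X euclidean (\<lambda>x. k x j)" if "continuous_map X (top_of_set A) k" for k j
    using that unfolding continuous_map_in_subtopology euclidean_product_topology[symmetric]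
    by (simp add: continuous_map_componentwise_UNIV)
  have t: "continuous_map (prod_topology ?I X) euclideanreal fst"
    using continuous_map_fst[of ?I X] by (simp add: continuous_map_in_subtopology)
  have kc: "continuous_map (prod_topology ?I X) euclidean (\<lambda>z. k (snd z) j)"
    if "continuous_map X (top_of_set A) k" for k j
    using continuous_map_compose[OF continuous_map_snd comp[OF that, of j]] by (simp add: o_def)
  have "continuous_map (prod_topology ?I X) euclidean (\<lambda>z. ?h z j)" for j
    using t kc[OF f, of j] kc[OF g, of j] unfolding case_prod_beta continuous_map_atin
    by (simp add: tendsto_intros)
  then have "continuous_map (prod_topology ?I X) euclidean ?h"
    unfolding euclidean_product_topology[symmetric] by (simp add: continuous_map_componentwise_UNIV)
  then have "continuous_map (prod_topology ?I X) (top_of_set A) ?h"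
    by (auto simp: continuous_map_in_subtopology conv)
  then show ?thesis unfolding homotopic_with_def by (intro exI[of _ ?h]) auto
qed


section \<open>Removing a coordinate hyperplane\<close>

text \<open>If \<open>free_coord a S\<close> holds, then \<open>S\<close> is a product with the full
  complex line in coordinate \<open>a\<close>, and the slab is the same product with
  \<open>R\<close> in place of the line.\<close>

definition slab :: "('i \<Rightarrow> complex) set \<Rightarrow> 'i \<Rightarrow> complex set \<Rightarrow> ('i \<Rightarrow> complex) set"
  where "slab S a R = {x \<in> S. x a \<in> R}"

definition free_coord :: "'i \<Rightarrow> ('i \<Rightarrow> complex) set \<Rightarrow> bool"
  where "free_coord a S \<longleftrightarrow> (\<forall>x\<in>S. \<forall>c. x(a := c) \<in> S)"

lemma slab_mono: "S \<subseteq> S' \<Longrightarrow> R \<subseteq> R' \<Longrightarrow> slab S a R \<subseteq> slab S' a R'"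
  by (auto simp: slab_def)

lemma slab_subset: "slab S a R \<subseteq> S"
  by (auto simp: slab_def)

lemma slab_Int: "slab S a R \<inter> slab S a R' = slab S a (R \<inter> R')"
  and slab_Un: "slab S a R \<union> slab S a R' = slab S a (R \<union> R')"
  by (auto simp: slab_def)

lemma openin_slab:
  assumes "open R"
  shows "openin (top_of_set S) (slab S a R)"
proof -
  have "continuous_on S (\<lambda>x. x a)" by (rule continuous_on_subset[OF continuous_on_product_coordinates]) simp
  from continuous_openin_preimage_gen[OF this assms] show ?thesis
    by (simp add: slab_def vimage_def Int_def)
qed

lemma openin_slab_slab:
  assumes "open R" "R \<subseteq> R'"
  shows "openin (top_of_set (slab S a R')) (slab S a R)"
proof -
  have "slab S a R = slab (slab S a R') a R" using assms(2) by (auto simp: slab_def)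
  then show ?thesis using openin_slab[OF assms(1), of "slab S a R'" a] by simp
qed

lemma continuous_map_upd:
  assumes "continuous_on S f" "\<And>x. x \<in> S \<Longrightarrow> x(a := f x) \<in> S'"
  shows "continuous_map (top_of_set S) (top_of_set S') (\<lambda>x. x(a := f x :: complex))"
proof -
  have "continuous_on S (\<lambda>x. (x(a := f x)) j)" for j
    by (cases "j = a") (simp_all add: assms(1) continuous_on_product_coordinates continuous_on_subset[OF continuous_on_product_coordinates])
  then have "continuous_on S (\<lambda>x. x(a := f x))" by (rule continuous_on_coordinatewise_then_product)
  then show ?thesis using assms(2) by (auto simp: continuous_map_in_subtopology)
qed

text \<open>A homotopy inverse moves coordinate \<open>a\<close> to the centre \<open>c\<close> of
  the star-shaped region \<open>R\<close>; both homotopies are straight lines in that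
  coordinate.\<close>

lemma incl_slab_iso:
  fixes R :: "complex set"
  assumes S: "free_coord a S" and c: "c \<in> R"
    and star: "\<And>r t. r \<in> R \<Longrightarrow> 0 \<le> t \<Longrightarrow> t \<le> 1 \<Longrightarrow> (1 - t) *\<^sub>R r + t *\<^sub>R c \<in> R"
  shows "incl p (slab S a R) {} S {} \<in> iso (relhom p (slab S a R) {}) (relhom p S {})"
proof (rule homotopy_equivalence_homology_group_isomorphism[where g = "\<lambda>x. x(a := c)"])
  have up: "x(a := d) \<in> S" if "x \<in> S" for x d using S that by (auto simp: free_coord_def)
  have line: "(\<lambda>j. (1 - t) *\<^sub>R (x(a := c)) j + t *\<^sub>R x j) = x(a := (1 - t) *\<^sub>R c + t *\<^sub>R x a)" for x t
    by (auto simp: fun_eq_iff scaleR_left_distrib[symmetric])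
  show 1: "continuous_map (top_of_set (slab S a R)) (top_of_set S) id"
    using slab_subset by (auto simp: continuous_map_in_subtopology slab_def)
  show 2: "continuous_map (top_of_set S) (top_of_set (slab S a R)) (\<lambda>x. x(a := c))"
    by (rule continuous_map_upd) (auto simp: slab_def up c)
  show "homotopic_with (\<lambda>k. True) (top_of_set (slab S a R)) (top_of_set (slab S a R)) ((\<lambda>x. x(a := c)) \<circ> id) id"
  proof (rule homotopic_linear)
    show "continuous_map (top_of_set (slab S a R)) (top_of_set (slab S a R)) ((\<lambda>x. x(a := c)) \<circ> id)"
      by (rule continuous_map_compose[OF 1 2])
    fix x and t :: real assume x: "x \<in> topspace (top_of_set (slab S a R))" and t: "0 \<le> t" "t \<le> 1"
    have "(1 - t) *\<^sub>R c + t *\<^sub>R x a \<in> R" using star[of "x a" "1 - t"] x t by (simp add: slab_def add.commute)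
    then show "(\<lambda>j. (1 - t) *\<^sub>R ((\<lambda>x. x(a := c)) \<circ> id) x j + t *\<^sub>R id x j) \<in> slab S a R"
      using line[of t x] x up by (simp add: slab_def)
  qed simp
  show "homotopic_with (\<lambda>k. True) (top_of_set S) (top_of_set S) (id \<circ> (\<lambda>x. x(a := c))) id"
  proof (rule homotopic_linear)
    show "continuous_map (top_of_set S) (top_of_set S) (id \<circ> (\<lambda>x. x(a := c)))"
      by (rule continuous_map_compose[OF 2 1])
    fix x and t :: real assume x: "x \<in> topspace (top_of_set S)"
    show "(\<lambda>j. (1 - t) *\<^sub>R (id \<circ> (\<lambda>x. x(a := c))) x j + t *\<^sub>R id x j) \<in> S"
      using line[of t x] x up by simp
  qed simp
qed

text \<open>The punctured plane is covered by the left half plane and the plane slit along the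
  nonpositive real axis, which overlap in the two open left quadrants. Every region except
  \<open>puncture\<close> itself is star-shaped, so its slab has the homology of
  \<open>S\<close>.\<close>

definition puncture :: "complex set" where "puncture = - {0}"
definition half_plane :: "complex set" where "half_plane = {z. Re z < 0}"
definition slit_plane :: "complex set" where "slit_plane = {z. Re z > 0 \<or> Im z \<noteq> 0}"
definition upper_quadrant :: "complex set" where "upper_quadrant = {z. Re z < 0 \<and> Im z > 0}"
definition lower_quadrant :: "complex set" where "lower_quadrant = {z. Re z < 0 \<and> Im z < 0}"

lemmas region_defs = puncture_def half_plane_def slit_plane_def upper_quadrant_def lower_quadrant_def

lemma open_regions: "open puncture" "open half_plane" "open slit_plane" "open upper_quadrant" "open lower_quadrant"
  unfolding region_defs
  by (auto intro!: open_Collect_conj open_Collect_disj open_Collect_less open_Collect_neq continuous_intros)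

lemma region_Un_Int:
  "half_plane \<union> slit_plane = puncture"
  "upper_quadrant \<union> lower_quadrant = half_plane \<inter> slit_plane"
  "upper_quadrant \<inter> lower_quadrant = {}"
  by (auto simp: region_defs complex_eq_iff)

lemma incl_slab_regions_iso:
  assumes "free_coord a S"
  shows "incl p (slab S a half_plane) {} S {} \<in> iso (relhom p (slab S a half_plane) {}) (relhom p S {})"
    and "incl p (slab S a slit_plane) {} S {} \<in> iso (relhom p (slab S a slit_plane) {}) (relhom p S {})"
    and "incl p (slab S a upper_quadrant) {} S {} \<in> iso (relhom p (slab S a upper_quadrant) {}) (relhom p S {})"
    and "incl p (slab S a lower_quadrant) {} S {} \<in> iso (relhom p (slab S a lower_quadrant) {}) (relhom p S {})"
proof -
  have neg: "(1 - t) * u + t * v < 0" if "u < 0" "v < 0" "0 \<le> t" "t \<le> 1" for t u v :: real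
    using convex_bound_lt[of u 0 v "1 - t" t] that by simp
  have pos: "0 < (1 - t) * u + t * v" if "u > 0" "v > 0" "0 \<le> t" "t \<le> 1" for t u v :: real
    using convex_bound_lt[of "-u" 0 "-v" "1 - t" t] that by simp
  show "incl p (slab S a half_plane) {} S {} \<in> iso (relhom p (slab S a half_plane) {}) (relhom p S {})"
    by (rule incl_slab_iso[OF assms, of "-1"]) (use neg[of _ "-1"] in \<open>auto simp: half_plane_def\<close>)
  show "incl p (slab S a slit_plane) {} S {} \<in> iso (relhom p (slab S a slit_plane) {}) (relhom p S {})"
  proof (rule incl_slab_iso[OF assms, of 1])
    \<comment> \<open>The slit plane is star-shaped about 1 without being convex. For
      \<open>t < 1\<close> a nonzero imaginary part is scaled but stays nonzero; at
      \<open>t = 1\<close> the point is the centre.\<close>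
    fix r and t :: real assume "r \<in> slit_plane" "0 \<le> t" "t \<le> 1"
    then show "(1 - t) *\<^sub>R r + t *\<^sub>R 1 \<in> slit_plane"
      using pos[of "Re r" 1 t] by (cases "t = 1") (auto simp: slit_plane_def)
  qed (simp add: slit_plane_def)
  show "incl p (slab S a upper_quadrant) {} S {} \<in> iso (relhom p (slab S a upper_quadrant) {}) (relhom p S {})"
    by (rule incl_slab_iso[OF assms, of "Complex (-1) 1"])
      (use neg[of _ "-1"] pos[of _ 1] in \<open>auto simp: upper_quadrant_def\<close>)
  show "incl p (slab S a lower_quadrant) {} S {} \<in> iso (relhom p (slab S a lower_quadrant) {}) (relhom p S {})"
    by (rule incl_slab_iso[OF assms, of "Complex (-1) (-1)"])
      (use neg[of _ "-1"] in \<open>auto simp: lower_quadrant_def\<close>)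
qed

lemma iso_inj_onto:
  assumes "f \<in> iso G H"
  shows "inj_on f (carrier G)" "f ` carrier G = carrier H" "f \<in> hom G H"
  using assms by (auto simp: iso_def bij_betw_def)

text \<open>Two out of three: both inclusions into \<open>S\<close> induce isomorphisms, and the
  triangle commutes.\<close>

lemma incl_slab_slab_iso:
  assumes R: "incl p (slab S a R) {} S {} \<in> iso (relhom p (slab S a R) {}) (relhom p S {})"
    and R': "incl p (slab S a R') {} S {} \<in> iso (relhom p (slab S a R') {}) (relhom p S {})"
    and "R \<subseteq> R'"
  shows "incl p (slab S a R) {} (slab S a R') {} \<in> iso (relhom p (slab S a R) {}) (relhom p (slab S a R') {})"
proof -
  let ?f = "incl p (slab S a R) {} (slab S a R') {}" and ?g = "incl p (slab S a R') {} S {}"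
  have eq: "?g (?f z) = incl p (slab S a R) {} S {} z" for z
    by (rule incl_incl) (auto simp: slab_def subsetD[OF assms(3)])
  have inj: "inj_on ?g (carrier (relhom p (slab S a R') {}))"
    using R' by (auto simp: iso_def bij_betw_def)
  have "inj_on ?f (carrier (relhom p (slab S a R) {}))"
  proof (rule inj_onI)
    fix x y assume xy: "x \<in> carrier (relhom p (slab S a R) {})" "y \<in> carrier (relhom p (slab S a R) {})" "?f x = ?f y"
    then have "incl p (slab S a R) {} S {} x = incl p (slab S a R) {} S {} y" using eq by metis
    then show "x = y" using inj_onD[OF iso_inj_onto(1)[OF R]] xy by blast
  qed
  moreover have "carrier (relhom p (slab S a R') {}) \<subseteq> ?f ` carrier (relhom p (slab S a R) {})"
  proof
    fix y assume y: "y \<in> carrier (relhom p (slab S a R') {})"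
    have "?g y \<in> incl p (slab S a R) {} S {} ` carrier (relhom p (slab S a R) {})"
      using R incl_carrier by (auto simp: iso_def bij_betw_def)
    then obtain x where x: "x \<in> carrier (relhom p (slab S a R) {})" "?g (?f x) = ?g y"
      using eq by force
    then have "?f x = y" using inj y incl_carrier by (meson inj_onD)
    then show "y \<in> ?f ` carrier (relhom p (slab S a R) {})" using x by blast
  qed
  moreover have "?f ` carrier (relhom p (slab S a R) {}) \<subseteq> carrier (relhom p (slab S a R') {})"
    by (auto simp: incl_carrier)
  ultimately show ?thesis using incl_hom unfolding iso_def bij_betw_def by blast
qed

text \<open>A class that dies relative to the slit plane comes from the slab over the slit plane,
  and the homology of that slab is detected in \<open>S\<close>. The relative group will be compared
  with the homology of \<open>S\<close> one degree lower.\<close>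

lemma puncture_jointly_injective:
  assumes S: "free_coord a S"
    and z: "z \<in> carrier (relhom p (slab S a puncture) {})"
    and z1: "incl p (slab S a puncture) {} S {} z = \<one>\<^bsub>relhom p S {}\<^esub>"
    and z2: "incl p (slab S a puncture) {} (slab S a puncture) (slab S a slit_plane) z
      = \<one>\<^bsub>relhom p (slab S a puncture) (slab S a slit_plane)\<^esub>"
  shows "z = \<one>\<^bsub>relhom p (slab S a puncture) {}\<^esub>"
proof -
  have sub: "slab S a slit_plane \<subseteq> slab S a puncture"
    by (rule slab_mono) (auto simp: region_defs)
  obtain w where w: "w \<in> carrier (relhom p (slab S a slit_plane) {})"
    "incl p (slab S a slit_plane) {} (slab S a puncture) {} w = z"
    using exact_absolute[OF sub z z2] .
  have "incl p (slab S a slit_plane) {} S {} w = \<one>\<^bsub>relhom p S {}\<^esub>"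
    using incl_incl[OF sub slab_subset, of "{}" "{}" "{}" p w] z1 w by simp
  then have "w = \<one>\<^bsub>relhom p (slab S a slit_plane) {}\<^esub>"
    using iso_eq_one[OF incl_slab_regions_iso(2)[OF S]] w by simp
  then show ?thesis using w(2) by simp
qed

text \<open>The composite is the connecting map of the triple \<open>A\<close>, \<open>A0\<close>,
  \<open>Q\<close>. Its kernel is the image of the homology of the pair \<open>(A, Q)\<close>, which
  vanishes because the inclusion of \<open>Q\<close> into \<open>A\<close> induces isomorphisms in
  all degrees.\<close>

lemma quadrant_bdry_injective:
  fixes S :: "('i \<Rightarrow> complex) set" and a :: 'i
  defines "A \<equiv> slab S a half_plane" and "A0 \<equiv> slab S a (half_plane \<inter> slit_plane)"
    and "Q \<equiv> slab S a lower_quadrant"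
  assumes S: "free_coord a S" and w: "w \<in> carrier (relhom p A A0)"
    and w1: "incl (p - 1) A0 {} A0 Q (bdry p A A0 w) = \<one>\<^bsub>relhom (p - 1) A0 Q\<^esub>"
  shows "w = \<one>\<^bsub>relhom p A A0\<^esub>"
proof -
  have sub: "A0 \<subseteq> A" "Q \<subseteq> A0" "Q \<subseteq> A"
    by (auto simp: A_def A0_def Q_def region_defs slab_def)
  have isoQ: "incl q Q {} A {} \<in> iso (relhom q Q {}) (relhom q A {})" for q
    unfolding Q_def A_def
    by (rule incl_slab_slab_iso[OF incl_slab_regions_iso(4)[OF S] incl_slab_regions_iso(1)[OF S]])
      (auto simp: region_defs)
  obtain v where v: "v \<in> carrier (relhom (p - 1) Q {})" "incl (p - 1) Q {} A0 {} v = bdry p A A0 w"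
    using exact_absolute[OF sub(2) bdry_carrier[OF sub(1)] w1] .
  have "incl (p - 1) Q {} A {} v = \<one>\<^bsub>relhom (p - 1) A {}\<^esub>"
    using incl_bdry[OF sub(1) w] incl_incl[OF sub(2,1), of "{}" "{}" "{}" "p - 1" v] v by simp
  then have "v = \<one>\<^bsub>relhom (p - 1) Q {}\<^esub>"
    using iso_eq_one[OF isoQ] v(1) by simp
  then have "bdry p A A0 w = \<one>\<^bsub>relhom (p - 1) A0 {}\<^esub>" using v(2) by simp
  then obtain u where u: "u \<in> carrier (relhom p A {})" "incl p A {} A A0 u = w"
    using exact_relative[OF sub(1) w] by blast
  have "u \<in> incl p Q {} A {} ` carrier (relhom p Q {})"
    using iso_inj_onto(2)[OF isoQ] u(1) by blast
  then obtain t where t: "t \<in> carrier (relhom p Q {})" "u = incl p Q {} A {} t" by blast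
  define t' where "t' = incl p Q {} A0 {} t"
  have "u = incl p A0 {} A {} t'"
    using t(2) incl_incl[OF sub(2,1), of "{}" "{}" "{}" p t] by (simp add: t'_def)
  then have "w = incl p A0 {} A A0 t'" using u(2) incl_incl[OF sub(1), of A "{}" "{}" A0 p t'] by simp
  then show ?thesis using incl_exact[OF sub(1), of t' p] by (simp add: t'_def incl_carrier)
qed

section \<open>Functionals that depend on few coordinates\<close>

text \<open>In use, \<open>X\<close> and \<open>Y\<close> are families that grow as the index set
  shrinks, so \<open>J\<close> selects the coordinates on which the functional depends. The degree
  \<open>p\<close> and the bound \<open>q\<close> are separate because the Thom isomorphism shifts
  the former and keeps the latter.\<close>

definition from_smaller ::
    "nat set \<Rightarrow> int \<Rightarrow> int \<Rightarrow> (nat set \<Rightarrow> 'a::topological_space set) \<Rightarrow> (nat set \<Rightarrow> 'a set) \<Rightarrow> ('a chain set \<Rightarrow> complex) \<Rightarrow> bool"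
  where "from_smaller I q p X Y \<psi> \<longleftrightarrow> (\<exists>J\<subseteq>I. int (card J) \<le> q \<and>
    (\<exists>\<eta>\<in>cdual (relhom p (X J) (Y J)). \<forall>x\<in>carrier (relhom p (X I) (Y I)). \<psi> x = \<eta> (incl p (X I) (Y I) (X J) (Y J) x)))"

text \<open>Functionals pull back along \<open>\<tau> I\<close>, and naturality turns one that
  factors through the index \<open>J\<close> after \<open>\<tau> I\<close> into one that factors
  through \<open>J\<close> before any \<open>\<tau>\<close> is applied.\<close>

lemma cogenerated_natural_injective:
  fixes X X' :: "nat set \<Rightarrow> 'a::topological_space set"
  assumes cog: "cogenerated (relhom p' (X' I) (Y' I)) (from_smaller I q p' X' Y')"
    and hom: "\<And>J. J \<subseteq> I \<Longrightarrow> \<tau> J \<in> hom (relhom p (X J) (Y J)) (relhom p' (X' J) (Y' J))"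
    and inj: "\<And>x. x \<in> carrier (relhom p (X I) (Y I)) \<Longrightarrow> \<tau> I x = \<one>\<^bsub>relhom p' (X' I) (Y' I)\<^esub> \<Longrightarrow> x = \<one>\<^bsub>relhom p (X I) (Y I)\<^esub>"
    and nat: "\<And>J x. J \<subseteq> I \<Longrightarrow> x \<in> carrier (relhom p (X I) (Y I)) \<Longrightarrow>
      incl p' (X' I) (Y' I) (X' J) (Y' J) (\<tau> I x) = \<tau> J (incl p (X I) (Y I) (X J) (Y J) x)"
  shows "cogenerated (relhom p (X I) (Y I)) (from_smaller I q p X Y)"
proof (rule cogenerated_injective[OF _ _ hom[OF subset_refl] inj cog])
  fix \<eta> assume "from_smaller I q p' X' Y' \<eta>"
  then obtain J \<xi> where J: "J \<subseteq> I" "int (card J) \<le> q" "\<xi> \<in> cdual (relhom p' (X' J) (Y' J))"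
    "\<forall>x\<in>carrier (relhom p' (X' I) (Y' I)). \<eta> x = \<xi> (incl p' (X' I) (Y' I) (X' J) (Y' J) x)"
    unfolding from_smaller_def by blast
  have "\<tau> I x \<in> carrier (relhom p' (X' I) (Y' I))" if "x \<in> carrier (relhom p (X I) (Y I))" for x
    using hom_in_carrier[OF hom[OF subset_refl] that] .
  then show "from_smaller I q p X Y (\<lambda>x. \<eta> (\<tau> I x))"
    unfolding from_smaller_def using J nat[OF J(1)] cdual_comp[OF hom[OF J(1)] J(3)]
    by (intro exI[of _ J] conjI bexI[of _ "\<lambda>x. \<xi> (\<tau> J x)"]) auto
qed simp_all

text \<open>The counterpart for arrows that point towards the group in question. Functionals are
  pushed forward instead of pulled back, so the factor \<open>\<xi>\<close> at the index
  \<open>J\<close> has to descend along \<open>\<tau> J\<close>, which is done by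
  \<open>cdual_factor\<close>.\<close>

lemma cogenerated_natural_iso:
  fixes X X' :: "nat set \<Rightarrow> 'a::topological_space set"
  assumes cog: "cogenerated (relhom p' (X' I) (Y' I)) (from_smaller I q p' X' Y')"
    and iso: "\<And>J. J \<subseteq> I \<Longrightarrow> \<tau> J \<in> iso (relhom p' (X' J) (Y' J)) (relhom p (X J) (Y J))"
    and nat: "\<And>J x. J \<subseteq> I \<Longrightarrow> x \<in> carrier (relhom p' (X' I) (Y' I)) \<Longrightarrow>
      incl p (X I) (Y I) (X J) (Y J) (\<tau> I x) = \<tau> J (incl p' (X' I) (Y' I) (X' J) (Y' J) x)"
  shows "cogenerated (relhom p (X I) (Y I)) (from_smaller I q p X Y)"
proof (rule cogenerated_surjective[OF iso_inj_onto(3)[OF iso[OF subset_refl]] _ cog])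
  show "carrier (relhom p (X I) (Y I)) \<subseteq> \<tau> I ` carrier (relhom p' (X' I) (Y' I))"
    using iso_inj_onto(2)[OF iso[OF subset_refl]] by blast
  fix \<eta> assume \<eta>: "\<eta> \<in> cdual (relhom p' (X' I) (Y' I))" "from_smaller I q p' X' Y' \<eta>"
  then obtain J \<xi> where J: "J \<subseteq> I" "int (card J) \<le> q" "\<xi> \<in> cdual (relhom p' (X' J) (Y' J))"
    "\<forall>x\<in>carrier (relhom p' (X' I) (Y' I)). \<eta> x = \<xi> (incl p' (X' I) (Y' I) (X' J) (Y' J) x)"
    unfolding from_smaller_def by blast
  have "group (relhom p' (X' J) (Y' J))" by simp
  then have "\<exists>\<zeta>\<in>cdual (relhom p (X J) (Y J)). \<forall>b\<in>carrier (relhom p' (X' J) (Y' J)). \<xi> b = \<zeta> (\<tau> J b)"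
    using iso_eq_one[OF iso[OF J(1)]] group.cdual_one[OF _ J(3)]
    by (intro cdual_factor[OF _ _ iso_inj_onto(3)[OF iso[OF J(1)]] J(3)]) auto
  then obtain \<zeta> where \<zeta>: "\<zeta> \<in> cdual (relhom p (X J) (Y J))"
    "\<And>b. b \<in> carrier (relhom p' (X' J) (Y' J)) \<Longrightarrow> \<xi> b = \<zeta> (\<tau> J b)" by blast
  let ?e = "\<lambda>x. \<zeta> (incl p (X I) (Y I) (X J) (Y J) x)"
  have "?e \<in> cdual (relhom p (X I) (Y I))" by (rule cdual_comp[OF incl_hom \<zeta>(1)])
  moreover have "from_smaller I q p X Y ?e" unfolding from_smaller_def using J \<zeta>(1) by blast
  moreover have "\<eta> c = ?e (\<tau> I c)" if c: "c \<in> carrier (relhom p' (X' I) (Y' I))" for c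
    using J(4) nat[OF J(1) c] \<zeta>(2)[OF incl_carrier] c by simp
  ultimately show "\<exists>\<xi>\<in>cdual (relhom p (X I) (Y I)). from_smaller I q p X Y \<xi> \<and>
      (\<forall>c\<in>carrier (relhom p' (X' I) (Y' I)). \<eta> c = \<xi> (\<tau> I c))"
    by (intro bexI[of _ ?e] conjI ballI)
qed


section \<open>Complements of coordinate hyperplanes\<close>

text \<open>A Thom isomorphism between \<open>H\<^sub>p(S \<times> (\<complex> - 0, slit_plane))\<close> and \<open>H\<^sub>p\<^sub>-\<^sub>1(S)\<close>, as a zigzag of
  natural maps: excise to the half plane, take the boundary, project to one of the two quadrants.\<close>

lemma cogenerated_punctured_slab:
  fixes S :: "nat set \<Rightarrow> ('i \<Rightarrow> complex) set" and a :: 'i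
  defines "U \<equiv> \<lambda>R J. slab (S J) a R"
  assumes free: "\<And>J. J \<subseteq> I \<Longrightarrow> free_coord a (S J)" and mono: "\<And>J. J \<subseteq> I \<Longrightarrow> S I \<subseteq> S J"
    and cog: "cogenerated (relhom (p - 1) (S I) {}) (from_smaller I q (p - 1) S (\<lambda>_. {}))"
  shows "cogenerated (relhom p (U puncture I) (U slit_plane I)) (from_smaller I q p (U puncture) (U slit_plane))"
proof -
  have UI: "U R I \<subseteq> U R J" if "J \<subseteq> I" for R J
    unfolding U_def by (rule slab_mono[OF mono[OF that]]) simp
  have UR: "U R J \<subseteq> U R' J" if "R \<subseteq> R'" for R R' J
    unfolding U_def by (rule slab_mono[OF _ that]) simp
  have US: "U R J \<subseteq> S J" for R J unfolding U_def by (rule slab_subset)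
  let ?H = half_plane and ?B = slit_plane and ?P = upper_quadrant and ?N = lower_quadrant and ?C = puncture
  let ?HB = "half_plane \<inter> slit_plane"
  have sub: "?P \<subseteq> ?HB" "?N \<subseteq> ?HB" "?HB \<subseteq> ?H" "?HB \<subseteq> ?B" "?H \<subseteq> ?C" "?B \<subseteq> ?C" by (auto simp: region_defs)
  have opn: "openin (top_of_set (U R' J)) (U R J)" if "open R" "R \<subseteq> R'" for R R' J
    unfolding U_def using that by (rule openin_slab_slab)
  \<comment> \<open>The zigzag is followed from \<open>S\<close> outwards: arrows towards
    \<open>S\<close> are handled by \<open>cogenerated_natural_injective\<close>, arrows away from
    it by \<open>cogenerated_natural_iso\<close>.\<close>
  have 1: "cogenerated (relhom (p - 1) (U ?P I) {}) (from_smaller I q (p - 1) (U ?P) (\<lambda>_. {}))"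
  proof (rule cogenerated_natural_injective[where \<tau> = "\<lambda>J. incl (p - 1) (U ?P J) {} (S J) {}", OF cog])
    fix x assume "x \<in> carrier (relhom (p - 1) (U ?P I) {})"
      "incl (p - 1) (U ?P I) {} (S I) {} x = \<one>\<^bsub>relhom (p - 1) (S I) {}\<^esub>"
    then show "x = \<one>\<^bsub>relhom (p - 1) (U ?P I) {}\<^esub>"
      using iso_eq_one[OF incl_slab_regions_iso(3)[OF free[OF subset_refl]]] by (simp add: U_def)
  next
    fix J x assume "J \<subseteq> I"
    then show "incl (p - 1) (S I) {} (S J) {} (incl (p - 1) (U ?P I) {} (S I) {} x)
        = incl (p - 1) (U ?P J) {} (S J) {} (incl (p - 1) (U ?P I) {} (U ?P J) {} x)"
      by (subst (1 2) incl_incl) (use mono US UI in auto)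
  qed (rule incl_hom)
  have 2: "cogenerated (relhom (p - 1) (U ?HB I) (U ?N I)) (from_smaller I q (p - 1) (U ?HB) (U ?N))"
  proof (rule cogenerated_natural_iso[where \<tau> = "\<lambda>J. incl (p - 1) (U ?P J) {} (U ?HB J) (U ?N J)", OF 1])
    fix J
    \<comment> \<open>The overlap of half plane and slit plane is the disjoint union of the two
      quadrants, so excising the lower one leaves the upper one relative to the empty set.\<close>
    have "U ?P J \<inter> U ?N J = {}" "U ?P J \<union> U ?N J = U ?HB J"
      using region_Un_Int by (simp_all add: U_def slab_Int slab_Un) (simp add: slab_def)
    then show "incl (p - 1) (U ?P J) {} (U ?HB J) (U ?N J) \<in> iso (relhom (p - 1) (U ?P J) {}) (relhom (p - 1) (U ?HB J) (U ?N J))"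
      using excision_iso[OF opn[OF open_regions(4) sub(1)] opn[OF open_regions(5) sub(2)], of J "p - 1"] by simp
  next
    fix J x assume "J \<subseteq> I"
    then show "incl (p - 1) (U ?HB I) (U ?N I) (U ?HB J) (U ?N J) (incl (p - 1) (U ?P I) {} (U ?HB I) (U ?N I) x)
        = incl (p - 1) (U ?P J) {} (U ?HB J) (U ?N J) (incl (p - 1) (U ?P I) {} (U ?P J) {} x)"
      by (subst (1 2) incl_incl) (use UI UR[OF sub(1)] in auto)
  qed
  have 3: "cogenerated (relhom p (U ?H I) (U ?HB I)) (from_smaller I q p (U ?H) (U ?HB))"
  proof (rule cogenerated_natural_injective[where \<tau> = "\<lambda>J x. incl (p - 1) (U ?HB J) {} (U ?HB J) (U ?N J) (bdry p (U ?H J) (U ?HB J) x)", OF 2])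
    fix J
    show "(\<lambda>x. incl (p - 1) (U ?HB J) {} (U ?HB J) (U ?N J) (bdry p (U ?H J) (U ?HB J) x))
        \<in> hom (relhom p (U ?H J) (U ?HB J)) (relhom (p - 1) (U ?HB J) (U ?N J))"
      using hom_compose[OF bdry_hom[OF UR[OF sub(3)]] incl_hom] by (simp add: o_def)
  next
    fix x assume "x \<in> carrier (relhom p (U ?H I) (U ?HB I))"
      "incl (p - 1) (U ?HB I) {} (U ?HB I) (U ?N I) (bdry p (U ?H I) (U ?HB I) x) = \<one>\<^bsub>relhom (p - 1) (U ?HB I) (U ?N I)\<^esub>"
    then show "x = \<one>\<^bsub>relhom p (U ?H I) (U ?HB I)\<^esub>"
      using quadrant_bdry_injective[OF free[OF subset_refl]] by (simp add: U_def)
  next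
    fix J x assume J: "J \<subseteq> I"
    show "incl (p - 1) (U ?HB I) (U ?N I) (U ?HB J) (U ?N J) (incl (p - 1) (U ?HB I) {} (U ?HB I) (U ?N I) (bdry p (U ?H I) (U ?HB I) x))
      = incl (p - 1) (U ?HB J) {} (U ?HB J) (U ?N J) (bdry p (U ?H J) (U ?HB J) (incl p (U ?H I) (U ?HB I) (U ?H J) (U ?HB J) x))"
      by (subst bdry_incl; (subst (1 2) incl_incl)?) (use UI[OF J] UR[OF sub(3)] in auto)
  qed
  show ?thesis
  proof (rule cogenerated_natural_iso[where \<tau> = "\<lambda>J. incl p (U ?H J) (U ?HB J) (U ?C J) (U ?B J)", OF 3])
    fix J
    have "U ?H J \<inter> U ?B J = U ?HB J" "U ?H J \<union> U ?B J = U ?C J"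
      using region_Un_Int by (simp_all add: U_def slab_Int slab_Un)
    then show "incl p (U ?H J) (U ?HB J) (U ?C J) (U ?B J) \<in> iso (relhom p (U ?H J) (U ?HB J)) (relhom p (U ?C J) (U ?B J))"
      using excision_iso[OF opn[OF open_regions(2) sub(5)] opn[OF open_regions(3) sub(6)], of J p] by simp
  next
    fix J x assume "J \<subseteq> I"
    then show "incl p (U ?C I) (U ?B I) (U ?C J) (U ?B J) (incl p (U ?H I) (U ?HB I) (U ?C I) (U ?B I) x)
        = incl p (U ?H J) (U ?HB J) (U ?C J) (U ?B J) (incl p (U ?H I) (U ?HB I) (U ?H J) (U ?HB J) x)"
      by (subst (1 2) incl_incl) (use UI UR[OF sub(4)] UR[OF sub(5)] in auto)
  qed
qed

lemma cogenerated_trivial: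
  assumes "trivial_group H"
  shows "cogenerated H P"
proof -
  interpret group H using assms by (simp add: trivial_group_def)
  have "carrier H = {\<one>\<^bsub>H\<^esub>}" using assms by (simp add: trivial_group_def)
  then have "cdual H \<subseteq> lspan (carrier H) {}" using cdual_one by (auto intro: lspan_zero)
  then show ?thesis unfolding cogenerated_def by (intro exI[of _ "{}"]) auto
qed

lemma cogenerated_integer_group: "cogenerated integer_group (\<lambda>_. True)"
proof -
  have "\<psi> \<in> lspan (carrier integer_group) {of_int}" if \<psi>: "\<psi> \<in> cdual integer_group" for \<psi>
  proof -
    have add: "\<psi> (x + y) = \<psi> x + \<psi> y" for x y using cdualD[OF \<psi>] by (simp add: integer_group_def)
    obtain c where c: "\<psi> 1 = c" by simp
    have "\<psi> x = c * of_int x" for x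
    proof (induction x rule: int_induct[where k = 0])
      case base
      then show ?case using add[of 0 0] by simp
    next
      case (step1 i)
      then show ?case using add[of i 1] c by (simp add: algebra_simps)
    next
      case (step2 i)
      then show ?case using add[of "i - 1" 1] c by (simp add: algebra_simps)
    qed
    then show ?thesis
      by (intro lspan_step[OF _ lspan_zero[of _ "\<lambda>_. 0"], where c = c and \<eta> = of_int]) auto
  qed
  then show ?thesis unfolding cogenerated_def
    by (intro exI[of _ "{of_int}"]) (auto simp: cdual_def integer_group_def)
qed

text \<open>Coordinates outside \<open>J\<close> are free, so forgetting coordinates becomes an
  inclusion of sets, as the naturality lemmas need. For finite \<open>J\<close> this is, up to
  homotopy, a torus of dimension \<open>card J\<close>.\<close>

definition torus :: "nat set \<Rightarrow> (nat \<Rightarrow> complex) set"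
  where "torus J = {x. \<forall>j\<in>J. x j \<noteq> 0}"

lemma torus_mono: "J \<subseteq> I \<Longrightarrow> torus I \<subseteq> torus J"
  by (auto simp: torus_def)

lemma torus_insert: "torus (insert a J) = slab (torus J) a puncture"
  by (auto simp: torus_def slab_def puncture_def)

lemma free_coord_torus: "a \<notin> J \<Longrightarrow> free_coord a (torus J)"
  by (auto simp: torus_def free_coord_def)

text \<open>The whole space contracts to the origin. In degree 0 the functionals form a line and
  depend on no coordinate; in all other degrees the homology is trivial.\<close>

lemma cogenerated_torus_empty:
  "cogenerated (relhom p (torus {}) {}) (from_smaller {} p p torus (\<lambda>_. {}))"
proof -
  let ?O = "\<lambda>_ :: nat. 0 :: complex"
  have T: "torus {} = UNIV" by (simp add: torus_def)
  have iso: "incl p {?O} {} UNIV {} \<in> iso (relhom p {?O} {}) (relhom p UNIV {})" for p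
  proof (rule homotopy_equivalence_homology_group_isomorphism[where g = "\<lambda>_. ?O"])
    show "homotopic_with (\<lambda>k. True) (top_of_set {?O}) (top_of_set {?O}) ((\<lambda>_. ?O) \<circ> id) id"
      by (rule homotopic_with_equal) (auto simp: continuous_map_in_subtopology)
    show "homotopic_with (\<lambda>k. True) (top_of_set UNIV) (top_of_set UNIV) (id \<circ> (\<lambda>_. ?O)) id"
      by (rule homotopic_linear) (auto simp: continuous_map_in_subtopology)
  qed (auto simp: continuous_map_in_subtopology)
  have isc: "relhom p {?O} {} \<cong> relhom p (UNIV :: (nat \<Rightarrow> complex) set) {}" for p by (rule is_isoI[OF iso])
  show ?thesis
  proof (cases "p = 0")
    case False
    have "trivial_group (relhom p {?O} {})" using False by (intro homology_dimension_axiom) auto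
    then have "trivial_group (relhom p (UNIV :: (nat \<Rightarrow> complex) set) {})"
      using isomorphic_group_triviality[OF isc] by simp
    then show ?thesis using cogenerated_trivial by (simp add: T)
  next
    case True
    have "relhom p (UNIV :: (nat \<Rightarrow> complex) set) {} \<cong> integer_group"
    proof -
      have "relhom 0 (UNIV :: (nat \<Rightarrow> complex) set) {} \<cong> relhom 0 {?O} {}"
        by (rule group.iso_sym[OF _ isc]) simp
      also have "\<dots> \<cong> integer_group" by (rule homology_coefficients) simp
      finally show ?thesis using True by simp
    qed
    then obtain h where h: "h \<in> iso (relhom p (UNIV :: (nat \<Rightarrow> complex) set) {}) integer_group"
      unfolding is_iso_def by auto
    have "cogenerated (relhom p (UNIV :: (nat \<Rightarrow> complex) set) {}) (\<lambda>_. True)"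
      by (rule cogenerated_injective[OF _ _ iso_inj_onto(3)[OF h] _ cogenerated_integer_group])
        (use iso_eq_one[OF h] abelian_integer_group in auto)
    then have "cogenerated (relhom p (torus {}) {}) (\<lambda>_. True)" by (simp add: T)
    then show ?thesis
    proof (rule cogenerated_mono)
      fix \<psi> assume "\<psi> \<in> cdual (relhom p (torus {}) {})"
      then show "from_smaller {} p p torus (\<lambda>_. {}) \<psi>"
        unfolding from_smaller_def using True
        by (intro exI[of _ "{}"] conjI bexI[of _ \<psi>] ballI) (auto simp: hom_induced_id)
    qed
  qed
qed

text \<open>Each coordinate of a torus contributes at most one degree. A new coordinate
  \<open>a\<close> embeds degree \<open>p\<close> into degree \<open>p\<close> of the old torus and,
  through the Thom isomorphism, into degree \<open>p - 1\<close>; functionals of the second kind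
  involve \<open>a\<close> and at most \<open>p - 1\<close> other coordinates. Hence the degree has
  to vary in the induction.\<close>

theorem cogenerated_torus:
  "finite I \<Longrightarrow> cogenerated (relhom p (torus I) {}) (from_smaller I p p torus (\<lambda>_. {}))"
proof (induction I arbitrary: p rule: finite_induct)
  case empty
  then show ?case by (rule cogenerated_torus_empty)
next
  case (insert a I)
  let ?X = "\<lambda>J. slab (torus J) a puncture" and ?Y = "\<lambda>J. slab (torus J) a slit_plane"
  have free: "free_coord a (torus J)" if "J \<subseteq> I" for J
    using free_coord_torus insert.hyps that by blast
  have G: "cogenerated (relhom p (?X I) (?Y I)) (from_smaller I (p - 1) p ?X ?Y)"
    by (rule cogenerated_punctured_slab[OF free torus_mono insert.IH])
  have "cogenerated (relhom p (?X I) {}) (from_smaller (insert a I) p p torus (\<lambda>_. {}))"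
  proof (rule cogenerated_jointly_injective[OF _ _ _ incl_hom incl_hom _ insert.IH G])
    fix b assume "b \<in> carrier (relhom p (?X I) {})" "incl p (?X I) {} (torus I) {} b = \<one>\<^bsub>relhom p (torus I) {}\<^esub>"
      "incl p (?X I) {} (?X I) (?Y I) b = \<one>\<^bsub>relhom p (?X I) (?Y I)\<^esub>"
    then show "b = \<one>\<^bsub>relhom p (?X I) {}\<^esub>" by (rule puncture_jointly_injective[OF free[OF subset_refl]])
  next
    fix \<eta> assume "from_smaller I p p torus (\<lambda>_. {}) \<eta>"
    then obtain J \<xi> where J: "J \<subseteq> I" "int (card J) \<le> p" "\<xi> \<in> cdual (relhom p (torus J) {})"
      "\<forall>x\<in>carrier (relhom p (torus I) {}). \<eta> x = \<xi> (incl p (torus I) {} (torus J) {} x)"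
      unfolding from_smaller_def by blast
    have "\<eta> (incl p (?X I) {} (torus I) {} b) = \<xi> (incl p (torus (insert a I)) {} (torus J) {} b)" for b
      using J(4) incl_carrier[of p "?X I" "{}" "torus I" "{}" b]
        incl_incl[OF slab_subset[of "torus I" a puncture] torus_mono[OF J(1)] subset_refl subset_refl, of p "{}" b]
      by (simp add: torus_insert)
    then show "from_smaller (insert a I) p p torus (\<lambda>_. {}) (\<lambda>b. \<eta> (incl p (?X I) {} (torus I) {} b))"
      unfolding from_smaller_def using J by (intro exI[of _ J] conjI bexI[of _ \<xi>]) auto
  next
    fix \<eta> assume "from_smaller I (p - 1) p ?X ?Y \<eta>"
    then obtain J \<xi> where J: "J \<subseteq> I" "int (card J) \<le> p - 1" "\<xi> \<in> cdual (relhom p (?X J) (?Y J))"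
      "\<forall>x\<in>carrier (relhom p (?X I) (?Y I)). \<eta> x = \<xi> (incl p (?X I) (?Y I) (?X J) (?Y J) x)"
      unfolding from_smaller_def by blast
    have XI: "?X I \<subseteq> ?X J" "?Y I \<subseteq> ?Y J" using slab_mono[OF torus_mono[OF J(1)]] by auto
    have fin: "finite J" using J(1) insert.hyps(1) finite_subset by blast
    have eq: "\<eta> (incl p (?X I) {} (?X I) (?Y I) b)
        = \<xi> (incl p (torus (insert a J)) {} (?X J) (?Y J) (incl p (torus (insert a I)) {} (torus (insert a J)) {} b))" for b
      using J(4) incl_carrier[of p "?X I" "{}" "?X I" "?Y I" b] incl_incl[of "?X I" "?X I" "?X J" "{}" "?Y I" "?Y J" p b]
        incl_incl[of "?X I" "?X J" "?X J" "{}" "{}" "?Y J" p b] XI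
      by (simp add: torus_insert)
    have "insert a J \<subseteq> insert a I" "int (card (insert a J)) \<le> p"
      using J(1,2) fin by (auto simp: card_insert_if)
    moreover have "(\<lambda>x. \<xi> (incl p (torus (insert a J)) {} (?X J) (?Y J) x)) \<in> cdual (relhom p (torus (insert a J)) {})"
      by (rule cdual_comp[OF incl_hom J(3)])
    ultimately show "from_smaller (insert a I) p p torus (\<lambda>_. {}) (\<lambda>b. \<eta> (incl p (?X I) {} (?X I) (?Y I) b))"
      unfolding from_smaller_def using eq
      by (intro exI[of _ "insert a J"] conjI bexI[of _ "\<lambda>x. \<xi> (incl p (torus (insert a J)) {} (?X J) (?Y J) x)"] ballI)
  qed simp_all
  then show ?case by (simp add: torus_insert)
qed


section \<open>Configuration spaces\<close>

text \<open>The point \<open>Suc b\<close> is being added and has to avoid the points in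
  \<open>S\<close>. For \<open>S = {1..b}\<close> the result is \<open>conf_torus (Suc b) N\<close>;
  for a single point it is, after a shear, \<open>conf_torus b N\<close>.\<close>

definition partial_conf :: "nat \<Rightarrow> nat \<Rightarrow> nat set \<Rightarrow> (nat \<Rightarrow> complex) set"
  where "partial_conf b N S =
    {x. inj_on x {1..b} \<and> (\<forall>j\<in>S. x (Suc b) \<noteq> x j) \<and> (\<forall>j\<in>{Suc b<..N}. x j \<noteq> 0)}"

text \<open>In \<open>conf_torus b N\<close> the first \<open>b\<close> coordinates are positions of points; a coordinate \<open>j\<close> beyond
  them stands for the difference between the \<open>j\<close>-th point and some earlier point.\<close>

definition conf_torus :: "nat \<Rightarrow> nat \<Rightarrow> (nat \<Rightarrow> complex) set"
  where "conf_torus b N = {x. inj_on x {1..b} \<and> (\<forall>j\<in>{b<..N}. x j \<noteq> 0)}"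

definition coord_diffs :: "nat \<Rightarrow> (nat \<Rightarrow> nat) \<Rightarrow> (nat \<Rightarrow> complex) \<Rightarrow> nat \<Rightarrow> complex"
  where "coord_diffs b f x j = (if j \<in> {2..b} then x j - x (f j) else x j)"

text \<open>The analogue of \<open>from_smaller\<close> for projections to difference coordinates.
  The choice \<open>f\<close> depends on the functional, since the terms of the Mayer-Vietoris
  argument compare a point with different earlier ones.\<close>

definition via_differences ::
    "(nat \<Rightarrow> complex) set \<Rightarrow> nat \<Rightarrow> nat \<Rightarrow> int \<Rightarrow> ((nat \<Rightarrow> complex) chain set \<Rightarrow> complex) \<Rightarrow> bool"
  where "via_differences X b N p \<psi> \<longleftrightarrow>
    (\<exists>f J. (\<forall>j\<in>{2..b}. f j \<in> {1..<j}) \<and> J \<subseteq> {2..N} \<and> int (card J) \<le> p \<and> coord_diffs b f \<in> X \<rightarrow> torus J \<and>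
      (\<exists>\<eta>\<in>cdual (relhom p (torus J) {}). \<forall>z\<in>carrier (relhom p X {}).
        \<psi> z = \<eta> (hom_induced p (top_of_set X) {} (top_of_set (torus J)) {} (coord_diffs b f) z)))"

lemma hom_induced_section_eq_one:
  assumes "section_map X Y f" "z \<in> carrier (homology_group p X)"
    and "hom_induced p X {} Y {} f z = \<one>\<^bsub>homology_group p Y\<^esub>"
  shows "z = \<one>\<^bsub>homology_group p X\<^esub>"
  by (rule inj_onD[OF inj_on_hom_induced_section_map[OF assms(1)]])
    (use assms(2,3) in \<open>auto intro: monoid.one_closed[OF group.is_monoid]\<close>)

lemma continuous_on_coordinate: "continuous_on S (\<lambda>x :: 'i \<Rightarrow> 'a::topological_space. x j)"
  by (rule continuous_on_subset[OF continuous_on_product_coordinates]) simp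

lemma continuous_on_coord_diffs: "continuous_on S (coord_diffs b f)"
proof -
  have "continuous_on S (\<lambda>x. coord_diffs b f x j)" for j
    unfolding coord_diffs_def by (cases "j \<in> {2..b}") (auto intro!: continuous_intros continuous_on_coordinate)
  then show ?thesis using continuous_on_coordinatewise_then_product[of S "coord_diffs b f"] by simp
qed

lemma continuous_map_coord_diffs: "coord_diffs b f \<in> X \<rightarrow> Y \<Longrightarrow> continuous_map (top_of_set X) (top_of_set Y) (coord_diffs b f)"
  by (simp add: continuous_on_coord_diffs continuous_map_in_subtopology Pi_iff image_subset_iff)

lemma via_differences_pullback:
  assumes \<psi>: "via_differences X b N p \<psi>" and g: "continuous_map (top_of_set X') (top_of_set X) g"
    and diffs: "\<And>f. (\<forall>j\<in>{2..b}. f j \<in> {1..<j}) \<Longrightarrow>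
      \<exists>f'. (\<forall>j\<in>{2..b'}. f' j \<in> {1..<j}) \<and> (\<forall>x\<in>X'. coord_diffs b f (g x) = coord_diffs b' f' x)"
  shows "via_differences X' b' N p (\<lambda>z. \<psi> (hom_induced p (top_of_set X') {} (top_of_set X) {} g z))"
proof -
  obtain f J \<eta> where *: "\<forall>j\<in>{2..b}. f j \<in> {1..<j}" "J \<subseteq> {2..N}" "int (card J) \<le> p" "coord_diffs b f \<in> X \<rightarrow> torus J"
      "\<eta> \<in> cdual (relhom p (torus J) {})"
      "\<And>z. z \<in> carrier (relhom p X {}) \<Longrightarrow>
        \<psi> z = \<eta> (hom_induced p (top_of_set X) {} (top_of_set (torus J)) {} (coord_diffs b f) z)"
    using \<psi> unfolding via_differences_def by blast
  obtain f' where f': "\<forall>j\<in>{2..b'}. f' j \<in> {1..<j}" "\<And>x. x \<in> X' \<Longrightarrow> coord_diffs b f (g x) = coord_diffs b' f' x"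
    using diffs[OF *(1)] by blast
  have gX: "g x \<in> X" if "x \<in> X'" for x using g that by (auto simp: continuous_map_in_subtopology)
  have d': "coord_diffs b' f' \<in> X' \<rightarrow> torus J" using *(4) gX f'(2) by (metis Pi_iff)
  \<comment> \<open>The two maps agree on \<open>X'\<close> but not as functions on the whole type;
    a constant homotopy identifies the induced maps.\<close>
  have hom: "homotopic_with (\<lambda>_. True) (top_of_set X') (top_of_set (torus J)) (coord_diffs b f \<circ> g) (coord_diffs b' f')"
    by (rule homotopic_with_equal)
      (use continuous_map_compose[OF g continuous_map_coord_diffs[OF *(4)]] f' in auto)
  have "\<psi> (hom_induced p (top_of_set X') {} (top_of_set X) {} g z) =
      \<eta> (hom_induced p (top_of_set X') {} (top_of_set (torus J)) {} (coord_diffs b' f') z)"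
    if "z \<in> carrier (relhom p X' {})" for z
    using *(6)[OF hom_induced_carrier[of p "top_of_set X'" "{}" "top_of_set X" "{}" g z]] homology_homotopy_empty[OF hom, of p]
      hom_induced_compose'[OF g _ continuous_map_coord_diffs[OF *(4)], of "{}" "{}" "{}" p z] by simp
  then show ?thesis unfolding via_differences_def using * f' d'
    by (intro exI[of _ f'] exI[of _ J] conjI bexI[of _ \<eta>]) auto
qed

lemma inj_on_atLeastAtMost_Suc:
  "inj_on x {1..Suc b} \<longleftrightarrow> inj_on x {1..b} \<and> (\<forall>j\<in>{1..b}. x (Suc b) \<noteq> x j)"
  by (auto simp: atLeastAtMostSuc_conv inj_on_insert image_iff)

lemma conf_torus_Suc: "conf_torus (Suc b) N = partial_conf b N {1..b}"
  unfolding conf_torus_def partial_conf_def inj_on_atLeastAtMost_Suc by auto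

lemma partial_conf_insert: "partial_conf b N (insert a S) = partial_conf b N S \<inter> partial_conf b N {a}"
  by (auto simp: partial_conf_def)

text \<open>If the point \<open>Suc b\<close> meets the point \<open>a\<close>, it differs from all
  points in \<open>S\<close>, because the first \<open>b\<close> points are pairwise
  distinct.\<close>

lemma partial_conf_Un:
  assumes "S \<subseteq> {1..b}" "a \<in> {1..b}" "a \<notin> S"
  shows "partial_conf b N S \<union> partial_conf b N {a} = partial_conf b N {}"
proof -
  have "x j \<noteq> x a" if "inj_on x {1..b}" "j \<in> S" for x :: "nat \<Rightarrow> complex" and j
    using that assms by (metis inj_onD subsetD)
  then show ?thesis by (force simp: partial_conf_def)
qed

lemma openin_partial_conf:
  assumes "finite S"
  shows "openin (top_of_set (partial_conf b N {})) (partial_conf b N S)"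
  using assms
proof induction
  case (insert a S)
  have c: "continuous_on (partial_conf b N {}) (\<lambda>x. x (Suc b) - x a)"
    by (intro continuous_intros continuous_on_coordinate)
  have "partial_conf b N {a} = partial_conf b N {} \<inter> (\<lambda>x. x (Suc b) - x a) -` (- {0})"
    by (auto simp: partial_conf_def)
  then have "openin (top_of_set (partial_conf b N {})) (partial_conf b N {a})"
    using continuous_openin_preimage_gen[OF c open_Compl[OF closed_singleton[of 0]]] by simp
  then show ?case using insert.IH by (subst partial_conf_insert) (rule openin_Int)
qed simp

lemma inj_on_upd_Suc: "inj_on (x(Suc b := c)) {Suc 0..b} \<longleftrightarrow> inj_on x {Suc 0..b}"
  by (rule inj_on_cong) auto

lemma partial_conf_upd:
  assumes "x \<in> partial_conf b N {}"
  shows "x(Suc b := c) \<in> partial_conf b N {}"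
  using assms by (auto simp: partial_conf_def inj_on_upd_Suc simp del: inj_on_fun_updI)

text \<open>As long as coordinate \<open>Suc b\<close> is unconstrained, moving it to
  \<open>x a + 1\<close> is homotopic to the identity, so every class has a representative that
  avoids the point \<open>a\<close>. Any nonzero number could replace 1.\<close>

lemma surj_incl_partial_conf:
  assumes "a \<in> {1..b}"
  shows "carrier (relhom p (partial_conf b N {}) {}) \<subseteq>
    incl p (partial_conf b N {a}) {} (partial_conf b N {}) {} ` carrier (relhom p (partial_conf b N {a}) {})"
proof
  let ?X = "partial_conf b N {}" and ?A = "partial_conf b N {a}"
  let ?h = "\<lambda>x :: nat \<Rightarrow> complex. x(Suc b := x a + 1)"
  fix z assume z: "z \<in> carrier (relhom p ?X {})"
  have h: "continuous_map (top_of_set ?X) (top_of_set ?A) ?h"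
  proof (rule continuous_map_upd)
    fix x assume "x \<in> ?X"
    then show "?h x \<in> ?A" using partial_conf_upd[of x b N "x a + 1"] assms by (auto simp: partial_conf_def)
  qed (intro continuous_intros continuous_on_coordinate)
  have i: "continuous_map (top_of_set ?A) (top_of_set ?X) id"
    by (auto simp: continuous_map_in_subtopology partial_conf_def)
  have "homotopic_with (\<lambda>_. True) (top_of_set ?X) (top_of_set ?X) (id \<circ> ?h) id"
  proof (rule homotopic_linear)
    show "continuous_map (top_of_set ?X) (top_of_set ?X) (id \<circ> ?h)" by (rule continuous_map_compose[OF h i])
    fix x and t :: real assume x: "x \<in> topspace (top_of_set ?X)"
    have "(\<lambda>j. (1 - t) *\<^sub>R (id \<circ> ?h) x j + t *\<^sub>R id x j) = x(Suc b := (1 - t) *\<^sub>R (x a + 1) + t *\<^sub>R x (Suc b))"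
      by (auto simp: fun_eq_iff scaleR_left_distrib[symmetric])
    then show "(\<lambda>j. (1 - t) *\<^sub>R (id \<circ> ?h) x j + t *\<^sub>R id x j) \<in> ?X"
      using partial_conf_upd x by simp
  qed simp
  from homology_homotopy_empty[OF this, of p]
  have "z = incl p ?A {} ?X {} (hom_induced p (top_of_set ?X) {} (top_of_set ?A) {} ?h z)"
    using hom_induced_compose'[OF h _ i, of "{}" "{}" "{}" p z] hom_induced_id[OF z] by simp
  then show "z \<in> incl p ?A {} ?X {} ` carrier (relhom p ?A {})"
    using hom_induced_carrier by blast
qed

text \<open>The shear that replaces coordinate \<open>Suc b\<close> by its difference from
  \<open>x a\<close> turns the single condition on the new point into the nonvanishing of a
  coordinate. The value \<open>f (Suc b) = a\<close> records it.\<close>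

lemma cogenerated_partial_conf_singleton:
  assumes b: "1 \<le> b" "Suc b \<le> N" and a: "a \<in> {1..b}"
    and K: "cogenerated (relhom p (conf_torus b N) {}) (via_differences (conf_torus b N) b N p)"
  shows "cogenerated (relhom p (partial_conf b N {a}) {}) (via_differences (partial_conf b N {a}) (Suc b) N p)"
proof -
  let ?W = "partial_conf b N {a}" and ?K = "conf_torus b N"
  let ?s = "\<lambda>x :: nat \<Rightarrow> complex. x(Suc b := x (Suc b) - x a)"
  have s: "continuous_map (top_of_set ?W) (top_of_set ?K) ?s"
    by (rule continuous_map_upd)
      (auto simp: partial_conf_def conf_torus_def inj_on_upd_Suc simp del: inj_on_fun_updI intro!: continuous_intros continuous_on_coordinate)
  show ?thesis
  proof (rule cogenerated_injective[OF _ _ hom_induced_hom _ K])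
    show "via_differences ?W (Suc b) N p (\<lambda>z. \<psi> (hom_induced p (top_of_set ?W) {} (top_of_set ?K) {} ?s z))"
      if "via_differences ?K b N p \<psi>" for \<psi>
    proof (rule via_differences_pullback[OF that s])
      fix f :: "nat \<Rightarrow> nat" assume f: "\<forall>j\<in>{2..b}. f j \<in> {1..<j}"
      have "coord_diffs b f (?s x) = coord_diffs (Suc b) (f(Suc b := a)) x" for x
      proof
        fix j
        \<comment> \<open>Since \<open>f j < j \<le> b\<close>, the old differences do not involve
          the sheared coordinate.\<close>
        have "f j \<noteq> Suc b" if "j \<in> {2..b}" using bspec[OF f that] that by auto
        then show "coord_diffs b f (?s x) j = coord_diffs (Suc b) (f(Suc b := a)) x j"
          using b by (auto simp: coord_diffs_def)
      qed
      then show "\<exists>f'. (\<forall>j\<in>{2..Suc b}. f' j \<in> {1..<j}) \<and> (\<forall>x\<in>?W. coord_diffs b f (?s x) = coord_diffs (Suc b) f' x)"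
        using f a by (intro exI[of _ "f(Suc b := a)"]) (auto simp: le_Suc_eq)
    qed
  next
    fix z assume z: "z \<in> carrier (relhom p ?W {})"
      "hom_induced p (top_of_set ?W) {} (top_of_set ?K) {} ?s z = \<one>\<^bsub>relhom p ?K {}\<^esub>"
    have "section_map (top_of_set ?W) (top_of_set ?K) ?s"
    proof -
      let ?r = "\<lambda>x :: nat \<Rightarrow> complex. x(Suc b := x (Suc b) + x a)"
      have "continuous_map (top_of_set ?K) (top_of_set ?W) ?r"
        by (rule continuous_map_upd)
          (use b a in \<open>auto simp: partial_conf_def conf_torus_def inj_on_upd_Suc simp del: inj_on_fun_updI intro!: continuous_intros continuous_on_coordinate\<close>)
      then show ?thesis unfolding section_map_def retraction_maps_def
        using s a by (intro exI[of _ ?r]) (auto simp: fun_eq_iff)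
    qed
    from hom_induced_section_eq_one[OF this z] show "z = \<one>\<^bsub>relhom p ?W {}\<^esub>" .
  qed simp_all
qed

text \<open>Induction on \<open>S\<close>: one more condition means intersecting two open sets whose
  union carries no condition on the new point, and \<open>Mayer_Vietoris_injective\<close> detects
  the homology of the intersection on the two sets.\<close>

lemma cogenerated_partial_conf:
  assumes b: "1 \<le> b" "Suc b \<le> N" and S: "S \<subseteq> {1..b}" "S \<noteq> {}"
    and K: "\<And>p. cogenerated (relhom p (conf_torus b N) {}) (via_differences (conf_torus b N) b N p)"
  shows "cogenerated (relhom p (partial_conf b N S) {}) (via_differences (partial_conf b N S) (Suc b) N p)"
proof -
  have "finite S" using S(1) finite_subset by blast
  then show ?thesis using S(2,1)
  proof (induction S rule: finite_ne_induct)
    case (singleton a)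
    then show ?case using cogenerated_partial_conf_singleton[OF b _ K] by simp
  next
    case (insert a S)
    let ?A = "partial_conf b N S" and ?B = "partial_conf b N {a}" and ?AB = "partial_conf b N (insert a S)"
    have a: "a \<in> {1..b}" and S: "S \<subseteq> {1..b}" using insert.prems by auto
    have sub: "?AB \<subseteq> ?A" "?AB \<subseteq> ?B" by (auto simp: partial_conf_def)
    have pull: "via_differences ?AB (Suc b) N p (\<lambda>z. \<psi> (incl p ?AB {} Y {} z))"
      if "via_differences Y (Suc b) N p \<psi>" "?AB \<subseteq> Y" for Y \<psi>
      by (rule via_differences_pullback[OF that(1)]) (use that(2) in \<open>auto simp: continuous_map_in_subtopology\<close>)
    show ?case
    proof (rule cogenerated_jointly_injective[OF _ _ _ incl_hom incl_hom _ insert.IH[OF S]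
          cogenerated_partial_conf_singleton[OF b a K]])
      fix z assume "z \<in> carrier (relhom p ?AB {})" "incl p ?AB {} ?A {} z = \<one>\<^bsub>relhom p ?A {}\<^esub>"
        "incl p ?AB {} ?B {} z = \<one>\<^bsub>relhom p ?B {}\<^esub>"
      then show "z = \<one>\<^bsub>relhom p ?AB {}\<^esub>"
        using Mayer_Vietoris_injective[OF openin_partial_conf[OF insert.hyps(1)] openin_partial_conf
            partial_conf_Un[OF S a insert.hyps(3)] surj_incl_partial_conf[OF a], where p = p and z = z]
        by (simp add: partial_conf_insert[of b N a S])
    qed (use pull sub in simp_all)
  qed
qed

text \<open>\<open>N\<close> stays fixed while each step turns coordinate \<open>Suc b\<close> from
  a difference into a position. For \<open>b = 1\<close> the only position is unconstrained, and the
  set is a torus.\<close>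

theorem cogenerated_conf_torus:
  assumes "1 \<le> b" "b \<le> N"
  shows "cogenerated (relhom p (conf_torus b N) {}) (via_differences (conf_torus b N) b N p)"
  using assms
proof (induction b arbitrary: p rule: dec_induct)
  case base
  have eq: "conf_torus 1 N = torus {2..N}" by (auto simp: conf_torus_def torus_def)
  have d: "coord_diffs 1 f = id" for f by (auto simp: coord_diffs_def fun_eq_iff)
  show ?case unfolding eq
  proof (rule cogenerated_mono[OF cogenerated_torus])
    fix \<psi> assume "from_smaller {2..N} p p torus (\<lambda>_. {}) \<psi>"
    then obtain J \<eta> where J: "J \<subseteq> {2..N}" "int (card J) \<le> p" "\<eta> \<in> cdual (relhom p (torus J) {})"
      "\<forall>z\<in>carrier (relhom p (torus {2..N}) {}). \<psi> z = \<eta> (incl p (torus {2..N}) {} (torus J) {} z)"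
      unfolding from_smaller_def by blast
    show "via_differences (torus {2..N}) 1 N p \<psi>"
      unfolding via_differences_def d using J torus_mono[OF J(1)]
      by (intro exI[of _ "\<lambda>_. 0"] exI[of _ J] conjI bexI[of _ \<eta>]) auto
  qed simp
next
  case (step b)
  show ?case unfolding conf_torus_Suc
    by (rule cogenerated_partial_conf) (use step in auto)
qed

section \<open>Invariance under permutations of the other points\<close>

definition fixed_off :: "nat \<Rightarrow> int \<Rightarrow> nat set \<Rightarrow> ((nat \<Rightarrow> complex) chain set \<Rightarrow> complex) \<Rightarrow> bool"
  where "fixed_off n p T \<psi> \<longleftrightarrow> (\<forall>\<sigma>. \<sigma> permutes {1..n} \<longrightarrow> (\<forall>t\<in>T. \<sigma> t = t) \<longrightarrow>
    (\<forall>z\<in>carrier (homology_group p (PConf n)).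
      \<psi> (hom_induced p (PConf n) {} (PConf n) {} (\<lambda>x. x \<circ> \<sigma>) z) = \<psi> z))"

lemma topspace_PConf: "topspace (PConf n) = extensional {1..n} \<inter> {x. inj_on x {1..n}}"
  by (auto simp: PConf_def PiE_def)

lemma continuous_map_PConf_euclidean: "continuous_map (PConf n) euclidean id"
proof -
  have "continuous_map (PConf n) euclidean (\<lambda>x. x k)" for k
  proof (cases "k \<in> {1..n}")
    case True
    then show ?thesis unfolding PConf_def
      using continuous_map_from_subtopology[OF continuous_map_product_projection[OF True, of "\<lambda>_. euclidean"]] by simp
  next
    case False
    have "continuous_map (PConf n) euclidean (\<lambda>_. undefined :: complex)" by simp
    then show ?thesis
      by (rule continuous_map_eq) (use False in \<open>auto simp: topspace_PConf extensional_def\<close>)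
  qed
  then show ?thesis unfolding euclidean_product_topology[symmetric] by (simp add: continuous_map_componentwise_UNIV)
qed

text \<open>The two spaces differ in the coordinates outside \<open>{1..n}\<close>, which are
  \<open>undefined\<close> in \<open>PConf n\<close> and arbitrary in \<open>conf_torus n n\<close>;
  restriction is a left inverse of the inclusion.\<close>

lemma section_map_PConf: "section_map (PConf n) (top_of_set (conf_torus n n)) id"
proof -
  have "continuous_map (PConf n) (top_of_set (conf_torus n n)) id"
    using continuous_map_PConf_euclidean by (auto simp: continuous_map_in_subtopology topspace_PConf conf_torus_def)
  moreover have "continuous_map (top_of_set (conf_torus n n)) (PConf n) (\<lambda>x. restrict x {1..n})"
  proof -
    have "continuous_map (top_of_set (conf_torus n n)) (product_topology (\<lambda>_. euclidean) {1..n}) (\<lambda>x. restrict x {1..n})"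
      unfolding continuous_map_componentwise
    proof (intro conjI ballI)
      fix k assume "k \<in> {1..n}"
      then show "continuous_map (top_of_set (conf_torus n n)) euclidean (\<lambda>x. restrict x {1..n} k)"
        using continuous_on_coordinate[of "conf_torus n n" k] by simp
    qed auto
    moreover have "inj_on (restrict x {1..n}) {1..n}" if "x \<in> conf_torus n n" for x
      using that by (simp add: conf_torus_def inj_on_restrict_eq)
    ultimately show ?thesis
      unfolding PConf_def continuous_map_in_subtopology by (simp add: image_subset_iff)
  qed
  ultimately show ?thesis unfolding section_map_def retraction_maps_def
    by (intro exI[of _ "\<lambda>x. restrict x {1..n}"]) (auto simp: topspace_PConf extensional_restrict)
qed

text \<open>The classes that span the cohomology involve at most \<open>p\<close> of the differences \<open>x j - x (f j)\<close>,
  hence at most \<open>2 p\<close> of the points.\<close>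

theorem cogenerated_PConf:
  assumes "1 \<le> n"
  shows "cogenerated (homology_group p (PConf n)) (\<lambda>\<psi>. \<exists>T\<subseteq>{1..n}. int (card T) \<le> 2 * p \<and> fixed_off n p T \<psi>)"
proof (rule cogenerated_injective[OF _ _ hom_induced_hom _ cogenerated_conf_torus[OF assms order_refl]])
  let ?X = "PConf n" and ?K = "top_of_set (conf_torus n n)"
  have i: "continuous_map ?X ?K id"
    using section_map_PConf by (auto simp: section_map_def retraction_maps_def)
  fix \<psi> assume "via_differences (conf_torus n n) n n p \<psi>"
  then obtain f J \<eta> where *: "\<forall>j\<in>{2..n}. f j \<in> {1..<j}" "J \<subseteq> {2..n}" "int (card J) \<le> p"
      "coord_diffs n f \<in> conf_torus n n \<rightarrow> torus J" "\<eta> \<in> cdual (relhom p (torus J) {})"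
      "\<And>z. z \<in> carrier (homology_group p ?K) \<Longrightarrow>
        \<psi> z = \<eta> (hom_induced p ?K {} (top_of_set (torus J)) {} (coord_diffs n f) z)"
    unfolding via_differences_def by blast
  note d = continuous_map_coord_diffs[OF *(4)]
  define T where "T = J \<union> f ` J"
  have "finite J" using *(2) finite_subset by blast
  then have "card T \<le> card J + card J"
    unfolding T_def using card_Un_le[of J "f ` J"] card_image_le[of J f] by linarith
  then have card: "int (card T) \<le> 2 * p" using *(3) by linarith
  have fT: "f j \<in> {1..n}" if "j \<in> J" for j using *(1,2) that by (force dest: bspec[of _ _ j])
  then have T: "T \<subseteq> {1..n}" using *(2) by (auto simp: T_def)
  have "fixed_off n p T (\<lambda>z. \<psi> (hom_induced p ?X {} ?K {} id z))"
    unfolding fixed_off_def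
  proof (intro allI impI ballI)
    fix \<sigma> z assume \<sigma>: "\<sigma> permutes {1..n}" "\<forall>t\<in>T. \<sigma> t = t" and z: "z \<in> carrier (homology_group p ?X)"
    let ?s = "\<lambda>x :: nat \<Rightarrow> complex. x \<circ> \<sigma>"
    note s = continuous_map_PConf[OF \<sigma>(1)]
    \<comment> \<open>The two maps agree in the coordinates from \<open>J\<close>, because
      \<open>\<sigma>\<close> fixes \<open>T\<close>. The other coordinates may change, but
      \<open>torus J\<close> leaves them free, so straight lines stay inside.\<close>
    have hom: "homotopic_with (\<lambda>_. True) ?X (top_of_set (torus J)) (coord_diffs n f \<circ> (id \<circ> ?s)) (coord_diffs n f \<circ> id)"
    proof (rule homotopic_linear)
      show 1: "continuous_map ?X (top_of_set (torus J)) (coord_diffs n f \<circ> id)"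
        by (rule continuous_map_compose[OF i d])
      show "continuous_map ?X (top_of_set (torus J)) (coord_diffs n f \<circ> (id \<circ> ?s))"
        by (rule continuous_map_compose[OF continuous_map_compose[OF s i] d])
      fix x and t :: real assume x: "x \<in> topspace ?X"
      have "coord_diffs n f (?s x) j = coord_diffs n f x j" if "j \<in> J" for j
        using that \<sigma>(2) by (auto simp: coord_diffs_def T_def)
      moreover have "coord_diffs n f x \<in> torus J" using 1 x by (auto simp: continuous_map_def)
      ultimately show "(\<lambda>j. (1 - t) *\<^sub>R (coord_diffs n f \<circ> (id \<circ> ?s)) x j + t *\<^sub>R (coord_diffs n f \<circ> id) x j) \<in> torus J"
        by (simp add: torus_def scaleR_left_distrib[symmetric])
    qed
    have "\<psi> (hom_induced p ?X {} ?K {} id (hom_induced p ?X {} ?X {} ?s z))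
        = \<eta> (hom_induced p ?X {} (top_of_set (torus J)) {} (coord_diffs n f \<circ> (id \<circ> ?s)) z)"
      using *(6)[OF hom_induced_carrier[of p ?X "{}" ?K "{}" id "hom_induced p ?X {} ?X {} ?s z"]]
        fun_cong[OF hom_induced_compose_empty[OF s i, of p], of z]
        fun_cong[OF hom_induced_compose_empty[OF continuous_map_compose[OF s i] d, of p], of z] by (simp del: id_o)
    also have "\<dots> = \<eta> (hom_induced p ?X {} (top_of_set (torus J)) {} (coord_diffs n f \<circ> id) z)"
      by (simp only: homology_homotopy_empty[OF hom])
    also have "\<dots> = \<psi> (hom_induced p ?X {} ?K {} id z)"
      using *(6)[OF hom_induced_carrier[of p ?X "{}" ?K "{}" id z]]
        fun_cong[OF hom_induced_compose_empty[OF i d, of p], of z] by (simp del: o_id)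
    finally show "\<psi> (hom_induced p ?X {} ?K {} id (hom_induced p ?X {} ?X {} ?s z)) = \<psi> (hom_induced p ?X {} ?K {} id z)" .
  qed
  then show "\<exists>T\<subseteq>{1..n}. int (card T) \<le> 2 * p \<and> fixed_off n p T (\<lambda>z. \<psi> (hom_induced p ?X {} ?K {} id z))"
    using T card by blast
next
  fix z assume "z \<in> carrier (homology_group p (PConf n))"
    "hom_induced p (PConf n) {} (top_of_set (conf_torus n n)) {} id z = \<one>\<^bsub>relhom p (conf_torus n n) {}\<^esub>"
  then show "z = \<one>\<^bsub>homology_group p (PConf n)\<^esub>" by (rule hom_induced_section_eq_one[OF section_map_PConf])
qed simp_all


section \<open>Cohomology as the dual of homology\<close>

text \<open>The evaluation pairing, computed with arbitrary representatives. Off the carrier the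
  value is 0 rather than \<open>undefined\<close>, so that pointwise sums and multiples of such
  functions are again of this form.\<close>

definition functional :: "nat \<Rightarrow> 'a topology \<Rightarrow> ('a chain \<Rightarrow> complex) set \<Rightarrow> 'a chain set \<Rightarrow> complex"
  where "functional p X A z =
    (if z \<in> carrier (homology_group (int p) X) then (SOME \<phi>. \<phi> \<in> A) (SOME c. c \<in> z) else 0)"

lemma cochain_add: "\<phi> \<in> cochains p X \<Longrightarrow> singular_chain p X a \<Longrightarrow> singular_chain p X b \<Longrightarrow> \<phi> (a + b) = \<phi> a + \<phi> b"
  by (simp add: cochains_iff)

lemma cochain_zero: "\<phi> \<in> cochains p X \<Longrightarrow> \<phi> 0 = 0"
  using cochain_add[of \<phi> p X 0 0] by (simp add: singular_chain_0)

lemma cochain_diff: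
  assumes "\<phi> \<in> cochains p X" "singular_chain p X a" "singular_chain p X b"
  shows "\<phi> (a - b) = \<phi> a - \<phi> b"
  using cochain_add[OF assms(1) singular_chain_diff[OF assms(2,3)] assms(3)] by simp

lemma cocycle_homologous:
  assumes \<phi>: "\<phi> \<in> cocycles p X" and c: "singular_relcycle p X {} c" and d: "homologous_rel p X {} c d"
  shows "\<phi> d = \<phi> c"
proof -
  have d': "singular_relcycle p X {} d" using homologous_rel_singular_relcycle[OF d] c by simp
  obtain e where "singular_chain (Suc p) X e" "chain_boundary (Suc p) e = c - d"
    using d by (auto simp: homologous_rel_def singular_boundary)
  then have "\<phi> (c - d) = 0" using \<phi> cocycles_iff by metis
  then show ?thesis using cochain_diff[of \<phi> p X c d] \<phi> c d' by (simp add: cocycles_iff singular_cycle)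
qed

lemma coboundary_cycle:
  assumes \<beta>: "\<beta> \<in> coboundaries p X" and c: "singular_relcycle p X {} c"
  shows "\<beta> c = 0"
proof (cases p)
  case 0
  then show ?thesis using assms by (auto simp: coboundaries_def singular_cycle)
next
  case (Suc q)
  then obtain \<phi> where "\<phi> \<in> cochains q X" "\<beta> = coboundary q X \<phi>" using \<beta> by (auto simp: coboundaries_def)
  then show ?thesis using c Suc by (simp add: coboundary_def singular_cycle cochain_zero)
qed

lemma function_module_simps [simp]:
  "carrier (function_module S F) = F"
  "\<zero>\<^bsub>function_module S F\<^esub> = (\<lambda>s\<in>S. 0)"
  "f \<oplus>\<^bsub>function_module S F\<^esub> g = (\<lambda>s\<in>S. f s + g s)"
  "c \<odot>\<^bsub>function_module S F\<^esub> f = (\<lambda>s\<in>S. c * f s)"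
  by (simp_all add: function_module_def)

definition coclass :: "nat \<Rightarrow> 'a topology \<Rightarrow> ('a chain \<Rightarrow> complex) \<Rightarrow> ('a chain \<Rightarrow> complex) set"
  where "coclass p X \<phi> = cohomology_class p X \<phi>"

lemma mem_coclass:
  "\<psi> \<in> coclass p X \<phi> \<longleftrightarrow> (\<exists>\<beta>\<in>coboundaries p X. \<psi> = (\<lambda>c\<in>carrier (chain_group p X). \<beta> c + \<phi> c))"
  by (auto simp: coclass_def a_r_coset_def r_coset_def function_module_def)

lemma zero_coboundary: "(\<lambda>c\<in>carrier (chain_group p X). 0) \<in> coboundaries p X"
proof -
  have "\<zero>\<^bsub>cocycle_module p X\<^esub> \<in> coboundaries p X"
    using subgroup.one_closed[OF submodule.axioms(1)[OF submodule_coboundaries[of p X]]] by simp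
  then show ?thesis by simp
qed

lemma cocycle_extensional: "\<phi> \<in> cocycles p X \<Longrightarrow> \<phi> = (\<lambda>c\<in>carrier (chain_group p X). \<phi> c)"
  by (auto simp: cocycles_iff cochains_iff fun_eq_iff)

lemma cocycle_in_class:
  assumes "\<phi> \<in> cocycles p X"
  shows "\<phi> \<in> coclass p X \<phi>"
  unfolding mem_coclass
  by (rule bexI[OF _ zero_coboundary]) (use cocycle_extensional[OF assms] in \<open>simp cong: restrict_cong\<close>)

text \<open>Neither choice matters: cocycles vanish on boundaries, and coboundaries vanish on
  cycles.\<close>

lemma functional_class:
  assumes \<phi>: "\<phi> \<in> cocycles p X" and c: "singular_relcycle p X {} c"
  shows "functional p X (coclass p X \<phi>) (homologous_rel_set p X {} c) = \<phi> c"
proof -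
  define \<psi> where "\<psi> = (SOME \<psi>. \<psi> \<in> coclass p X \<phi>)"
  define d where "d = (SOME d. d \<in> homologous_rel_set p X {} c)"
  have "\<psi> \<in> coclass p X \<phi>" unfolding \<psi>_def by (rule someI[of _ \<phi>]) (rule cocycle_in_class[OF \<phi>])
  then obtain \<beta> where \<beta>: "\<beta> \<in> coboundaries p X" "\<psi> = (\<lambda>c\<in>carrier (chain_group p X). \<beta> c + \<phi> c)"
    by (auto simp: mem_coclass)
  have d: "homologous_rel p X {} c d"
    unfolding d_def by (rule someI2[of _ c]) (auto simp: homologous_rel_refl)
  have d': "singular_relcycle p X {} d" using homologous_rel_singular_relcycle[OF d] c by simp
  have "\<psi> d = \<phi> d" using \<beta>(2) coboundary_cycle[OF \<beta>(1) d'] d' by (simp add: singular_cycle)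
  then have "\<psi> d = \<phi> c" using cocycle_homologous[OF \<phi> c d] by simp
  moreover have "homologous_rel_set p X {} c \<in> carrier (homology_group (int p) X)"
    using c by (auto simp: carrier_relative_homology_group)
  ultimately show ?thesis by (simp add: functional_def \<psi>_def d_def)
qed

lemma homology_group_mult:
  assumes "singular_relcycle p X {} a" "singular_relcycle p X {} b"
  shows "homologous_rel_set p X {} a \<otimes>\<^bsub>homology_group (int p) X\<^esub> homologous_rel_set p X {} b = homologous_rel_set p X {} (a + b)"
proof -
  have "homologous_rel_set p X {} \<in> hom (relcycle_group p X {}) (homology_group (int p) X)"
    using normal.r_coset_hom_Mod[OF normal_subgroup_singular_relboundary_relcycle[of p X "{}"]]
    by (simp add: relative_homology_group_def right_coset_singular_relboundary)
  from hom_mult[OF this, of a b] show ?thesis using assms by simp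
qed

lemma homology_cases:
  assumes "z \<in> carrier (homology_group (int p) X)"
  obtains c where "singular_relcycle p X {} c" "z = homologous_rel_set p X {} c"
  using assms by (auto simp: carrier_relative_homology_group)

lemma functional_cdual:
  assumes "\<phi> \<in> cocycles p X"
  shows "functional p X (coclass p X \<phi>) \<in> cdual (homology_group (int p) X)"
  unfolding cdual_def
proof (intro CollectI ballI)
  fix z w assume "z \<in> carrier (homology_group (int p) X)" "w \<in> carrier (homology_group (int p) X)"
  then obtain a b where ab: "singular_relcycle p X {} a" "z = homologous_rel_set p X {} a"
    "singular_relcycle p X {} b" "w = homologous_rel_set p X {} b"
    by (metis homology_cases)
  have "singular_chain p X a" "singular_chain p X b" "\<phi> \<in> cochains p X"
    using ab assms by (simp_all add: cocycles_iff singular_cycle)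
  with ab show "functional p X (coclass p X \<phi>) (z \<otimes>\<^bsub>homology_group (int p) X\<^esub> w) =
      functional p X (coclass p X \<phi>) z + functional p X (coclass p X \<phi>) w"
    using cochain_add[of \<phi> p X a b]
    by (simp add: homology_group_mult functional_class[OF assms] singular_relcycle_add)
qed

lemma functional_off: "z \<notin> carrier (homology_group (int p) X) \<Longrightarrow> functional p X A z = 0"
  by (simp add: functional_def)

lemma carrier_cohomology: "carrier (cohomology p X) = coclass p X ` cocycles p X"
  by (auto simp: coclass_def cohomology_def quotient_module_def A_RCOSETS_def')

text \<open>Surjectivity in the universal coefficient theorem. A functional on homology is one on
  cycles that kills boundaries; by injectivity of \<open>complex\<close> it extends to all chains,
  and the extension is a cocycle.\<close>

lemma functional_surj:
  assumes \<psi>: "\<psi> \<in> cdual (homology_group (int p) X)" and off: "\<And>z. z \<notin> carrier (homology_group (int p) X) \<Longrightarrow> \<psi> z = 0"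
  shows "\<psi> \<in> functional p X ` carrier (cohomology p X)"
proof -
  let ?Z = "relcycle_group p X {}"
  have cyc: "singular_chain p X c" if "c \<in> carrier ?Z" for c using that by (simp add: singular_cycle)
  have id: "(\<lambda>c. c) \<in> hom ?Z (chain_group p X)" by (auto simp: hom_def singular_cycle)
  have dual: "(\<lambda>c. \<psi> (homologous_rel_set p X {} c)) \<in> cdual ?Z"
    using cdualD[OF \<psi>] by (auto simp: cdual_def homology_group_mult[symmetric] carrier_relative_homology_group)
  have "\<exists>\<eta>\<in>cdual (chain_group p X). \<forall>c\<in>carrier ?Z. \<psi> (homologous_rel_set p X {} c) = \<eta> c"
  proof (rule cdual_factor[OF abelian_relcycle_group abelian_chain_group id dual])
    fix c assume "c \<in> carrier ?Z" "c = \<one>\<^bsub>chain_group p X\<^esub>"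
    then have "homologous_rel_set p X {} c = \<one>\<^bsub>homology_group (int p) X\<^esub>"
      by (simp add: homologous_rel_set_eq_relboundary singular_relboundary_0)
    then show "\<psi> (homologous_rel_set p X {} c) = 0"
      using group.cdual_one[OF group_relative_homology_group \<psi>] by simp
  qed
  then obtain \<eta> where \<eta>: "\<eta> \<in> cdual (chain_group p X)"
    "\<And>c. singular_relcycle p X {} c \<Longrightarrow> \<psi> (homologous_rel_set p X {} c) = \<eta> c" by auto
  define \<phi> where "\<phi> = (\<lambda>c\<in>carrier (chain_group p X). \<eta> c)"
  have \<phi>c: "\<phi> \<in> cochains p X"
    using cdualD[OF \<eta>(1)] by (auto simp: cochains_iff \<phi>_def singular_chain_add)
  have "\<phi> (chain_boundary (Suc p) d) = 0" if d: "singular_chain (Suc p) X d" for d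
  proof -
    have b: "singular_relboundary p X {} (chain_boundary (Suc p) d)" using d by (auto simp: singular_boundary)
    then have "homologous_rel_set p X {} (chain_boundary (Suc p) d) = \<one>\<^bsub>homology_group (int p) X\<^esub>"
      by (simp add: homologous_rel_set_eq_relboundary)
    moreover have "singular_relcycle p X {} (chain_boundary (Suc p) d)"
      using b by (rule singular_relboundary_imp_relcycle)
    ultimately show ?thesis
      using \<eta>(2) group.cdual_one[OF group_relative_homology_group \<psi>]
      by (metis \<phi>_def carrier_chain_group mem_Collect_eq restrict_apply' singular_cycle)
  qed
  then have \<phi>: "\<phi> \<in> cocycles p X" using \<phi>c by (simp add: cocycles_iff)
  have "\<psi> z = functional p X (coclass p X \<phi>) z" for z
  proof (cases "z \<in> carrier (homology_group (int p) X)")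
    case True
    then obtain c where "singular_relcycle p X {} c" "z = homologous_rel_set p X {} c" by (rule homology_cases)
    then show ?thesis using functional_class[OF \<phi>] \<eta>(2) by (simp add: \<phi>_def singular_cycle)
  qed (simp add: off functional_off)
  then have "\<psi> = functional p X (coclass p X \<phi>)" by blast
  then show ?thesis using \<phi> by (simp add: carrier_cohomology)
qed

text \<open>Injectivity in the universal coefficient theorem, where the Ext term vanishes by
  divisibility: \<open>\<phi>\<close> factors through the boundary map, and the factor extends from
  boundaries to all chains of degree \<open>q\<close>. In degree 0 every chain is a cycle.\<close>

lemma cocycle_zero_on_cycles:
  assumes \<phi>: "\<phi> \<in> cocycles p X" and zero: "\<And>c. singular_relcycle p X {} c \<Longrightarrow> \<phi> c = 0"
  shows "\<phi> \<in> coboundaries p X"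
proof (cases p)
  case 0
  have "\<phi> = (\<lambda>c\<in>carrier (chain_group p X). 0)"
    by (subst cocycle_extensional[OF \<phi>]) (use zero 0 in \<open>auto simp: singular_cycle chain_boundary_def intro!: restrict_ext\<close>)
  then show ?thesis using zero_coboundary by simp
next
  case (Suc q)
  have \<phi>c: "\<phi> \<in> cdual (chain_group p X)" using \<phi> by (auto simp: cdual_def cocycles_iff cochains_iff)
  have "chain_boundary p \<in> hom (chain_group p X) (chain_group q X)"
    using Suc by (auto simp: hom_def singular_chain_boundary_alt chain_boundary_add)
  from cdual_factor[OF abelian_chain_group abelian_chain_group this \<phi>c]
  obtain \<eta> where \<eta>: "\<eta> \<in> cdual (chain_group q X)"
    "\<And>c. singular_chain p X c \<Longrightarrow> \<phi> c = \<eta> (chain_boundary p c)"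
    using zero by (auto simp: singular_cycle)
  let ?\<theta> = "\<lambda>c\<in>carrier (chain_group q X). \<eta> c"
  have "?\<theta> \<in> cochains q X" using cdualD[OF \<eta>(1)] by (auto simp: cochains_iff singular_chain_add)
  moreover have "\<phi> = coboundary q X ?\<theta>"
    by (subst cocycle_extensional[OF \<phi>])
      (use \<eta>(2) Suc in \<open>auto simp: coboundary_def singular_chain_boundary_alt intro!: restrict_ext\<close>)
  ultimately show ?thesis using Suc by (simp add: coboundaries_def)
qed

lemma cohomology_add:
  assumes "\<phi> \<in> cocycles p X" "\<psi> \<in> cocycles p X"
  shows "coclass p X \<phi> \<oplus>\<^bsub>cohomology p X\<^esub> coclass p X \<psi> =
    coclass p X (\<lambda>c\<in>carrier (chain_group p X). \<phi> c + \<psi> c)"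
  using module_quotient_module(3)[OF module_cocycle_module submodule_coboundaries, of \<phi> p X \<psi>] assms
  by (simp add: cohomology_def coclass_def)

lemma cohomology_smult:
  assumes "\<phi> \<in> cocycles p X"
  shows "k \<odot>\<^bsub>cohomology p X\<^esub> coclass p X \<phi> = coclass p X (\<lambda>c\<in>carrier (chain_group p X). k * \<phi> c)"
  using module_quotient_module(2)[OF module_cocycle_module submodule_coboundaries, of \<phi> p X k] assms
  by (simp add: cohomology_def coclass_def)

lemma cocycles_add: "\<phi> \<in> cocycles p X \<Longrightarrow> \<psi> \<in> cocycles p X \<Longrightarrow> (\<lambda>c\<in>carrier (chain_group p X). \<phi> c + \<psi> c) \<in> cocycles p X"
  using abelian_groupE(1)[OF Module.module.axioms(2)[OF module_cocycle_module], of \<phi> p X \<psi>] by simp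

lemma cocycles_smult: "\<phi> \<in> cocycles p X \<Longrightarrow> (\<lambda>c\<in>carrier (chain_group p X). k * \<phi> c) \<in> cocycles p X"
  using Module.module.smult_closed[OF module_cocycle_module, of k \<phi> p X] by (simp add: complex_field_def)

lemma functional_eqI:
  assumes "\<And>c. singular_relcycle p X {} c \<Longrightarrow> functional p X A (homologous_rel_set p X {} c) = \<psi> (homologous_rel_set p X {} c)"
    and "\<And>z. z \<notin> carrier (homology_group (int p) X) \<Longrightarrow> \<psi> z = 0"
  shows "functional p X A = \<psi>"
proof
  fix z show "functional p X A z = \<psi> z"
    by (cases "z \<in> carrier (homology_group (int p) X)")
      (auto elim!: homology_cases simp: assms functional_off)
qed

lemma functional_add:
  assumes "A \<in> carrier (cohomology p X)" "B \<in> carrier (cohomology p X)"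
  shows "functional p X (A \<oplus>\<^bsub>cohomology p X\<^esub> B) = (\<lambda>z. functional p X A z + functional p X B z)"
proof -
  obtain \<phi> \<psi> where *: "\<phi> \<in> cocycles p X" "A = coclass p X \<phi>" "\<psi> \<in> cocycles p X" "B = coclass p X \<psi>"
    using assms by (auto simp: carrier_cohomology)
  show ?thesis
    by (rule functional_eqI)
      (simp_all add: * cohomology_add functional_class cocycles_add functional_off del: carrier_chain_group, simp add: singular_cycle)
qed

lemma functional_smult:
  assumes "A \<in> carrier (cohomology p X)"
  shows "functional p X (k \<odot>\<^bsub>cohomology p X\<^esub> A) = (\<lambda>z. k * functional p X A z)"
proof -
  obtain \<phi> where *: "\<phi> \<in> cocycles p X" "A = coclass p X \<phi>"
    using assms by (auto simp: carrier_cohomology)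
  show ?thesis
    by (rule functional_eqI)
      (simp_all add: * cohomology_smult functional_class cocycles_smult functional_off del: carrier_chain_group, simp add: singular_cycle)
qed

lemma functional_inj: "inj_on (functional p X) (carrier (cohomology p X))"
proof (rule inj_onI)
  fix A B assume A: "A \<in> carrier (cohomology p X)" "B \<in> carrier (cohomology p X)" "functional p X A = functional p X B"
  then obtain \<phi> \<psi> where *: "\<phi> \<in> cocycles p X" "A = coclass p X \<phi>" "\<psi> \<in> cocycles p X" "B = coclass p X \<psi>"
    by (auto simp: carrier_cohomology)
  let ?C = "carrier (chain_group p X)"
  interpret M: Module.module complex_field "cocycle_module p X" by (rule module_cocycle_module)
  interpret N: submodule "coboundaries p X" complex_field "cocycle_module p X" by (rule submodule_coboundaries)
  have sg: "subgroup (coboundaries p X) (add_monoid (cocycle_module p X))" by unfold_locales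
  interpret AN: abelian_subgroup "coboundaries p X" "cocycle_module p X"
    by (rule abelian_subgroupI3) (use sg M.abelian_group_axioms in \<open>auto simp: additive_subgroup_def\<close>)
  define \<beta> where "\<beta> = (\<lambda>c\<in>?C. \<phi> c + (\<lambda>c\<in>?C. -1 * \<psi> c) c)"
  have "\<beta> \<in> cocycles p X" unfolding \<beta>_def by (intro cocycles_add cocycles_smult *)
  moreover have "\<beta> c = 0" if c: "singular_relcycle p X {} c" for c
    using A(3) functional_class[OF *(1) c] functional_class[OF *(3) c] *(2,4) c
    by (simp add: \<beta>_def singular_cycle)
  ultimately have "\<beta> \<in> coboundaries p X" by (rule cocycle_zero_on_cycles)
  moreover have "\<phi> = (\<lambda>c\<in>?C. \<beta> c + \<psi> c)"
    by (subst cocycle_extensional[OF *(1)]) (auto simp: \<beta>_def intro!: restrict_ext)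
  ultimately have "\<phi> \<in> coclass p X \<psi>" by (auto simp: mem_coclass)
  then show "A = B" using AN.a_repr_independence'[of \<phi> \<psi>] * by (simp add: coclass_def)
qed

text \<open>Naturality of the pairing, which translates the action of permutations on cohomology
  into their action on homology.\<close>

lemma functional_pullback:
  assumes f: "continuous_map X Y f" and A: "A \<in> carrier (cohomology p Y)"
    and z: "z \<in> carrier (homology_group (int p) X)"
  shows "functional p X (cohomology_pullback p X f A) z = functional p Y A (hom_induced (int p) X {} Y {} f z)"
proof -
  obtain \<phi> where \<phi>: "\<phi> \<in> cocycles p Y" "A = coclass p Y \<phi>" using A by (auto simp: carrier_cohomology)
  obtain c where c: "singular_relcycle p X {} c" "z = homologous_rel_set p X {} c" using z by (rule homology_cases)
  have c': "singular_relcycle p Y {} (chain_map p f c)"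
    by (rule singular_relcycle_chain_map[OF c(1) f]) simp
  have "functional p X (cohomology_pullback p X f A) z = cochain_pullback p X f \<phi> c"
    using functional_class[OF cochain_pullback_cocycle[OF f \<phi>(1)] c(1)]
      cohomology_pullback_class[OF f \<phi>(1)] by (simp add: \<phi>(2) c(2) coclass_def)
  also have "\<dots> = \<phi> (chain_map p f c)" using c(1) by (simp add: cochain_pullback_def singular_cycle)
  also have "\<dots> = functional p Y A (homologous_rel_set p Y {} (chain_map p f c))"
    using functional_class[OF \<phi>(1) c'] \<phi>(2) by simp
  also have "homologous_rel_set p Y {} (chain_map p f c) = hom_induced (int p) X {} Y {} f z"
    unfolding c(2) by (rule hom_induced_chain_map[OF f _ c(1), symmetric]) simp
  finally show ?thesis .
qed


section \<open>Fixed vectors in Young representations\<close>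

text \<open>Right translation commutes with convolution from the left, so the sign that the column
  antisymmetrizer picks up under a column permutation passes to the Young symmetrizer and to the
  left ideal that it generates.\<close>

lemma convolution_antisymmetrizer:
  fixes \<mu> :: "nat list"
  defines "n \<equiv> sum_list \<mu>"
  assumes t: "t \<in> carrier (sym_group n)" and col: "\<forall>j\<in>{1..n}. tableau_col \<mu> (t j) = tableau_col \<mu> j"
    and sgn: "sign t = -1" and x: "x \<in> carrier (sym_group n)"
  shows "convolution n f (young_symmetrizer \<mu>) (x \<circ> t) = - convolution n f (young_symmetrizer \<mu>) x"
proof -
  let ?S = "carrier (sym_group n)" and ?b = "column_antisymmetrizer \<mu>"
  interpret G: group "sym_group n" by (rule sym_group_is_group)
  have mult: "p \<circ> q \<in> ?S" if "p \<in> ?S" "q \<in> ?S" for p q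
    using G.m_closed[OF that] by (simp add: sym_group_mult)
  have inv: "inv' p \<in> ?S" if "p \<in> ?S" for p by (rule sym_group_inv_closed[OF that])
  have b: "?b (z \<circ> t) = - ?b z" if z: "z \<in> ?S" for z
  proof -
    have "permutation z" "permutation t" using z t permutes_imp_permutation by (auto simp: sym_group_def)
    then have s: "sign (z \<circ> t) = - sign z" using sign_compose[of z t] sgn by simp
    have tp: "t permutes {1..n}" using t by (simp add: sym_group_def)
    have iff: "(\<forall>j\<in>{1..n}. tableau_col \<mu> ((z \<circ> t) j) = tableau_col \<mu> j) \<longleftrightarrow> (\<forall>j\<in>{1..n}. tableau_col \<mu> (z j) = tableau_col \<mu> j)"
      (is "?L \<longleftrightarrow> ?R")
    proof
      assume L: ?L
      show ?R
      proof
        fix j assume j: "j \<in> {1..n}"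
        obtain i where i: "i \<in> {1..n}" "t i = j"
          using that[of "inv' t j"] permutes_in_image[OF permutes_inv[OF tp], of j] permutes_inverses(1)[OF tp, of j] j by simp
        show "tableau_col \<mu> (z j) = tableau_col \<mu> j" using bspec[OF L i(1)] bspec[OF col i(1)] i(2) by simp
      qed
    next
      assume R: ?R
      show ?L
      proof
        fix j assume j: "j \<in> {1..n}"
        then have "t j \<in> {1..n}" using permutes_in_image[OF tp] by blast
        then show "tableau_col \<mu> ((z \<circ> t) j) = tableau_col \<mu> j" using bspec[OF R, of "t j"] bspec[OF col j] by simp
      qed
    qed
    have b: "?b y = (if \<forall>j\<in>{1..n}. tableau_col \<mu> (y j) = tableau_col \<mu> j then of_int (sign y) else 0)" if "y \<in> ?S" for y
      using that unfolding column_antisymmetrizer_def n_def[symmetric] by (rule restrict_apply')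
    show ?thesis unfolding b[OF z] b[OF mult[OF z t]] iff s by simp
  qed
  have c: "young_symmetrizer \<mu> (z \<circ> t) = - young_symmetrizer \<mu> z" if z: "z \<in> ?S" for z
  proof -
    have "?b (inv' y \<circ> (z \<circ> t)) = - ?b (inv' y \<circ> z)" if "y \<in> ?S" for y
      using b[OF mult[OF inv[OF that] z]] by (simp add: o_assoc)
    then show ?thesis using z mult[OF z t]
      by (simp add: young_symmetrizer_def convolution_def n_def[symmetric] sum_negf[symmetric] cong: sum.cong)
  qed
  have "young_symmetrizer \<mu> (inv' y \<circ> (x \<circ> t)) = - young_symmetrizer \<mu> (inv' y \<circ> x)" if "y \<in> ?S" for y
    using c[OF mult[OF inv[OF that] x]] by (simp add: o_assoc)
  then show ?thesis using x mult[OF x t]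
    by (simp add: convolution_def sum_negf[symmetric] cong: sum.cong)
qed

text \<open>Two points outside \<open>T\<close> lie in the same column of the tableau translated by \<open>x\<close>.  Their
  transposition fixes \<open>f\<close> from the left and, moved past \<open>x\<close>, negates it from the right.\<close>

lemma young_rep_fixed_eq_zero:
  fixes \<mu> :: "nat list"
  defines "n \<equiv> sum_list \<mu>"
  assumes f: "f \<in> carrier (young_rep \<mu>)" and T: "T \<subseteq> {1..n}"
    and col: "\<And>j. j \<in> {1..n} \<Longrightarrow> tableau_col \<mu> j \<in> C" and C: "finite C" "card C < card ({1..n} - T)"
    and fixed: "\<And>\<sigma>. \<sigma> permutes {1..n} \<Longrightarrow> \<forall>t\<in>T. \<sigma> t = t \<Longrightarrow> act (young_rep \<mu>) \<sigma> f = f"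
  shows "f = \<zero>\<^bsub>young_rep \<mu>\<^esub>"
proof -
  let ?S = "carrier (sym_group n)"
  interpret G: group "sym_group n" by (rule sym_group_is_group)
  obtain h where h: "f = convolution n h (young_symmetrizer \<mu>)"
    using f by (auto simp: young_rep_def function_module_def n_def)
  have act: "act (young_rep \<mu>) \<sigma> f = (\<lambda>x\<in>?S. f (inv' \<sigma> \<circ> x))" for \<sigma> by (simp add: young_rep_def n_def)
  have "f x = 0" if x: "x \<in> ?S" for x
  proof -
    have xp: "x permutes {1..n}" using x by (simp add: sym_group_def)
    let ?D = "{1..n} - T"
    have ip: "inv' x permutes {1..n}" by (rule permutes_inv[OF xp])
    \<comment> \<open>Pigeonhole: the points outside \<open>T\<close> outnumber the columns in which
      their preimages under \<open>x\<close> can lie.\<close>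
    have "\<not> inj_on (\<lambda>i. tableau_col \<mu> (inv' x i)) ?D"
    proof
      assume "inj_on (\<lambda>i. tableau_col \<mu> (inv' x i)) ?D"
      moreover have "(\<lambda>i. tableau_col \<mu> (inv' x i)) ` ?D \<subseteq> C"
        using col permutes_in_image[OF ip] by blast
      ultimately have "card ?D \<le> card C" using C(1) card_inj_on_le by blast
      then show False using C(2) by simp
    qed
    then obtain i j where ij: "i \<in> ?D" "j \<in> ?D" "i \<noteq> j" "tableau_col \<mu> (inv' x i) = tableau_col \<mu> (inv' x j)"
      by (auto simp: inj_on_def)
    let ?t = "Transposition.transpose (inv' x i) (inv' x j)" and ?s = "Transposition.transpose i j"
    have ne: "inv' x i \<noteq> inv' x j" using ij(3) permutes_inj[OF ip] by (auto dest: injD)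
    have mem: "inv' x i \<in> {1..n}" "inv' x j \<in> {1..n}" using ij permutes_in_image[OF ip] by auto
    have tS: "?t \<in> ?S" using permutes_swap_id[OF mem] by (simp add: sym_group_def)
    have "f (x \<circ> ?t) = - f x" unfolding h n_def
    proof (rule convolution_antisymmetrizer)
      show "?t \<in> carrier (sym_group (sum_list \<mu>))" "x \<in> carrier (sym_group (sum_list \<mu>))" using tS x n_def by auto
      show "\<forall>k\<in>{1..sum_list \<mu>}. tableau_col \<mu> (?t k) = tableau_col \<mu> k"
        using ij(4) by (auto simp: Transposition.transpose_def)
      show "sign ?t = -1" using ne by (simp add: sign_swap_id)
    qed
    moreover have "x \<circ> ?t = ?s \<circ> x"
    proof
      fix k
      have "x (inv' x l) = l" for l using permutes_inverses(1)[OF xp] by simp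
      moreover have "(k = inv' x l) = (x k = l)" for l
        using permutes_inv_eq[OF xp, of l k] by auto
      ultimately show "(x \<circ> ?t) k = (?s \<circ> x) k" by (auto simp: Transposition.transpose_def)
    qed
    moreover have "f (?s \<circ> x) = f x"
    proof -
      have sp: "?s permutes {1..n}" using ij permutes_swap_id[of i "{1..n}" j] by auto
      have "act (young_rep \<mu>) ?s f = f" by (rule fixed[OF sp]) (use ij in \<open>auto simp: Transposition.transpose_def\<close>)
      then have "f x = (\<lambda>x\<in>?S. f (inv' ?s \<circ> x)) x" unfolding act by (rule fun_cong[OF sym])
      then show ?thesis using x by simp
    qed
    ultimately have "f x = - f x" by simp
    then have "f x + f x = 0" by (metis add.right_inverse)
    then show ?thesis by (simp add: mult_2[symmetric])
  qed
  moreover have "f \<in> extensional ?S" by (simp add: h convolution_def)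
  ultimately have "f = (\<lambda>x\<in>?S. 0)" by (auto simp: fun_eq_iff extensional_def)
  then show ?thesis by (simp add: young_rep_def function_module_def n_def)
qed

text \<open>Row \<open>r\<close> is the first one whose end reaches \<open>j\<close>, so
  \<open>j\<close> exceeds the total length of the rows before it, and the truncated subtraction in
  \<open>tableau_col\<close> is exact. No row is longer than the first.\<close>

lemma tableau_col_bound:
  assumes \<mu>: "\<mu> \<noteq> []" "sorted_wrt (\<ge>) \<mu>" and j: "j \<in> {1..sum_list \<mu>}"
  shows "tableau_col \<mu> j \<in> {1..hd \<mu>}"
proof -
  define r where "r = tableau_row \<mu> j"
  have ex: "j \<le> sum_list (take (Suc (length \<mu>)) \<mu>)" using j by simp
  have le: "j \<le> sum_list (take (Suc r) \<mu>)" unfolding r_def tableau_row_def by (rule LeastI) (rule ex)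
  have gt: "sum_list (take r \<mu>) < j"
  proof (cases r)
    case 0
    then show ?thesis using j by simp
  next
    case (Suc q)
    then have "\<not> j \<le> sum_list (take (Suc q) \<mu>)"
      using not_less_Least[of q "\<lambda>r. j \<le> sum_list (take (Suc r) \<mu>)"] by (simp add: r_def tableau_row_def)
    then show ?thesis using Suc by simp
  qed
  have rl: "r < length \<mu>"
  proof (rule ccontr)
    assume "\<not> r < length \<mu>"
    then show False using le gt j by simp
  qed
  have "sum_list (take (Suc r) \<mu>) = sum_list (take r \<mu>) + \<mu> ! r" using rl by (simp add: take_Suc_conv_app_nth)
  moreover have "\<mu> ! r \<le> hd \<mu>"
    using sorted_wrt_nth_less[OF \<mu>(2), of 0 r] rl \<mu>(1) by (cases r) (auto simp: hd_conv_nth)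
  ultimately show ?thesis using le gt by (auto simp: tableau_col_def r_def[symmetric])
qed


section \<open>Complete reducibility\<close>

text \<open>The representation lives on a subspace \<open>W\<close> of an ambient vector space,
  where bases and linear projections are available; \<open>\<rho>\<close> is specified on
  \<open>W\<close> only.\<close>

locale finite_group_rep = vector_space scale
  for scale :: "complex \<Rightarrow> 'b::ab_group_add \<Rightarrow> 'b" (infixr "*v" 75) +
  fixes G :: "('g, 'x) monoid_scheme" and W :: "'b set" and \<rho> :: "'g \<Rightarrow> 'b \<Rightarrow> 'b"
  assumes group: "group G" and fin: "finite (carrier G)"
    and W: "subspace W"
    and closed: "\<And>g w. g \<in> carrier G \<Longrightarrow> w \<in> W \<Longrightarrow> \<rho> g w \<in> W"
    and add: "\<And>g v w. g \<in> carrier G \<Longrightarrow> v \<in> W \<Longrightarrow> w \<in> W \<Longrightarrow> \<rho> g (v + w) = \<rho> g v + \<rho> g w"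
    and smult: "\<And>g c w. g \<in> carrier G \<Longrightarrow> w \<in> W \<Longrightarrow> \<rho> g (c *v w) = c *v \<rho> g w"
    and one: "\<And>w. w \<in> W \<Longrightarrow> \<rho> \<one>\<^bsub>G\<^esub> w = w"
    and mult: "\<And>g h w. g \<in> carrier G \<Longrightarrow> h \<in> carrier G \<Longrightarrow> w \<in> W \<Longrightarrow> \<rho> (g \<otimes>\<^bsub>G\<^esub> h) w = \<rho> g (\<rho> h w)"
begin

sublocale G: group G by (rule group)

definition stable :: "'b set \<Rightarrow> bool"
  where "stable U \<longleftrightarrow> subspace U \<and> U \<subseteq> W \<and> (\<forall>g\<in>carrier G. \<forall>u\<in>U. \<rho> g u \<in> U)"

definition simple :: "'b set \<Rightarrow> bool"
  where "simple U \<longleftrightarrow> stable U \<and> U \<noteq> {0} \<and> (\<forall>U'. stable U' \<and> U' \<subseteq> U \<longrightarrow> U' = {0} \<or> U' = U)"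

lemma rho_zero: "g \<in> carrier G \<Longrightarrow> \<rho> g 0 = 0"
  using smult[of g 0 0] subspace_0[OF W] by simp

lemma rho_sum:
  assumes g: "g \<in> carrier G"
  shows "(\<And>a. a \<in> A \<Longrightarrow> f a \<in> W) \<Longrightarrow> \<rho> g (\<Sum>a\<in>A. f a) = (\<Sum>a\<in>A. \<rho> g (f a))"
proof (induction A rule: infinite_finite_induct)
  case (insert a A)
  then have "(\<Sum>a\<in>A. f a) \<in> W" by (intro subspace_sum[OF W]) auto
  then show ?case using insert add[OF g] by simp
qed (simp_all add: rho_zero g)

text \<open>Averaging a linear projection onto \<open>U'\<close> over the group makes it equivariant
  and keeps it a projection; its kernel in \<open>U\<close> is a stable complement.\<close>

theorem Maschke:
  assumes U: "stable U" and U': "stable U'" "U' \<subseteq> U"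
  obtains C where "stable C" "C \<subseteq> U" "C \<inter> U' = {0}" "\<And>u. u \<in> U \<Longrightarrow> \<exists>a\<in>U'. \<exists>c\<in>C. u = a + c"
proof -
  interpret pair: vector_space_pair scale scale by unfold_locales
  obtain \<pi> where \<pi>: "range \<pi> \<subseteq> U'" "Vector_Spaces.linear scale scale \<pi>" "\<And>v. v \<in> U' \<Longrightarrow> \<pi> v = v"
    using pair.linear_exists_left_inverse_on[OF linear_id, of U'] U'(1) by (auto simp: stable_def)
  interpret \<pi>: Vector_Spaces.linear scale scale \<pi> by (rule \<pi>(2))
  let ?G = "carrier G"
  have UW: "u \<in> W" if "u \<in> U" for u using that U by (auto simp: stable_def)
  have U'W: "u \<in> W" if "u \<in> U'" for u using that U' by (auto simp: stable_def)
  have su: "subspace U" "subspace U'" using U U' by (auto simp: stable_def)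
  have \<pi>W: "\<pi> v \<in> W" for v using \<pi>(1) U'W by blast
  define P where "P v = (1 / of_nat (card ?G)) *v (\<Sum>g\<in>?G. \<rho> g (\<pi> (\<rho> (inv\<^bsub>G\<^esub> g) v)))" for v
  have card: "of_nat (card ?G) \<noteq> (0 :: complex)" using fin G.one_closed by auto
  have PU': "P v \<in> U'" for v
    unfolding P_def using \<pi>(1) U'(1) by (intro subspace_scale subspace_sum su) (auto simp: stable_def)
  have Pid: "P v = v" if v: "v \<in> U'" for v
  proof -
    have "\<rho> g (\<pi> (\<rho> (inv\<^bsub>G\<^esub> g) v)) = v" if g: "g \<in> ?G" for g
    proof -
      have "\<rho> (inv\<^bsub>G\<^esub> g) v \<in> U'" using U'(1) v g by (auto simp: stable_def)
      then have "\<pi> (\<rho> (inv\<^bsub>G\<^esub> g) v) = \<rho> (inv\<^bsub>G\<^esub> g) v" by (rule \<pi>(3))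
      then show ?thesis using mult[of g "inv\<^bsub>G\<^esub> g" v] one[of v] U'W[OF v] g by simp
    qed
    then have "P v = (1 / of_nat (card ?G)) *v (\<Sum>g\<in>?G. v)" by (simp add: P_def)
    also have "(\<Sum>g\<in>?G. v) = of_nat (card ?G) *v v" by (simp add: sum_constant_scale)
    finally show ?thesis using card by simp
  qed
  have Padd: "P (v + w) = P v + P w" if "v \<in> W" "w \<in> W" for v w
  proof -
    have "\<rho> g (\<pi> (\<rho> (inv\<^bsub>G\<^esub> g) (v + w))) = \<rho> g (\<pi> (\<rho> (inv\<^bsub>G\<^esub> g) v)) + \<rho> g (\<pi> (\<rho> (inv\<^bsub>G\<^esub> g) w))"
      if g: "g \<in> ?G" for g
      using add[of "inv\<^bsub>G\<^esub> g" v w] \<open>v \<in> W\<close> \<open>w \<in> W\<close> g by (simp add: \<pi>.add add \<pi>W)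
    then show ?thesis by (simp add: P_def sum.distrib scale_right_distrib)
  qed
  have Psmult: "P (c *v v) = c *v P v" if "v \<in> W" for c v
  proof -
    have "\<rho> g (\<pi> (\<rho> (inv\<^bsub>G\<^esub> g) (c *v v))) = c *v \<rho> g (\<pi> (\<rho> (inv\<^bsub>G\<^esub> g) v))" if g: "g \<in> ?G" for g
      using smult[of "inv\<^bsub>G\<^esub> g" v c] \<open>v \<in> W\<close> g by (simp add: \<pi>.scale smult \<pi>W)
    then show ?thesis by (simp add: P_def scale_sum_right[symmetric] mult.commute)
  qed
  have Prho: "P (\<rho> h v) = \<rho> h (P v)" if h: "h \<in> ?G" and v: "v \<in> W" for h v
  proof -
    \<comment> \<open>Substituting the product of \<open>h\<close> and \<open>k\<close> for
      \<open>g\<close> moves \<open>h\<close> to the front of the average.\<close>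
    have "(\<Sum>g\<in>?G. \<rho> g (\<pi> (\<rho> (inv\<^bsub>G\<^esub> g) (\<rho> h v)))) = (\<Sum>k\<in>?G. \<rho> h (\<rho> k (\<pi> (\<rho> (inv\<^bsub>G\<^esub> k) v))))"
    proof (rule sum.reindex_bij_witness[of _ "\<lambda>k. h \<otimes>\<^bsub>G\<^esub> k" "\<lambda>g. inv\<^bsub>G\<^esub> h \<otimes>\<^bsub>G\<^esub> g"])
      fix g assume g: "g \<in> ?G"
      show "h \<otimes>\<^bsub>G\<^esub> (inv\<^bsub>G\<^esub> h \<otimes>\<^bsub>G\<^esub> g) = g" "inv\<^bsub>G\<^esub> h \<otimes>\<^bsub>G\<^esub> g \<in> ?G" using g h by (simp_all flip: G.m_assoc)
      have "\<rho> (inv\<^bsub>G\<^esub> (inv\<^bsub>G\<^esub> h \<otimes>\<^bsub>G\<^esub> g)) v = \<rho> (inv\<^bsub>G\<^esub> g) (\<rho> h v)"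
        using g h v by (simp add: G.inv_mult_group mult)
      moreover have "\<rho> h (\<rho> (inv\<^bsub>G\<^esub> h \<otimes>\<^bsub>G\<^esub> g) w) = \<rho> g w" if "w \<in> W" for w
        using g h that by (simp add: mult[symmetric]) (simp flip: G.m_assoc)
      ultimately show "\<rho> h (\<rho> (inv\<^bsub>G\<^esub> h \<otimes>\<^bsub>G\<^esub> g) (\<pi> (\<rho> (inv\<^bsub>G\<^esub> (inv\<^bsub>G\<^esub> h \<otimes>\<^bsub>G\<^esub> g)) v))) = \<rho> g (\<pi> (\<rho> (inv\<^bsub>G\<^esub> g) (\<rho> h v)))"
        using \<pi>W by simp
    next
      fix k assume k: "k \<in> ?G"
      show "inv\<^bsub>G\<^esub> h \<otimes>\<^bsub>G\<^esub> (h \<otimes>\<^bsub>G\<^esub> k) = k" "h \<otimes>\<^bsub>G\<^esub> k \<in> ?G" using k h by (simp_all flip: G.m_assoc)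
    qed
    also have "\<dots> = \<rho> h (\<Sum>k\<in>?G. \<rho> k (\<pi> (\<rho> (inv\<^bsub>G\<^esub> k) v)))"
      by (rule rho_sum[OF h, symmetric]) (intro closed \<pi>W)
    finally show ?thesis unfolding P_def
      by (simp add: smult[OF h] subspace_sum[OF W] closed \<pi>W)
  qed
  define C where "C = {v \<in> U. P v = 0}"
  have "subspace C"
  proof (rule subspaceI)
    show "0 \<in> C" using su subspace_0 Pid[of 0] by (auto simp: C_def)
  qed (auto simp: C_def Padd Psmult UW subspace_add[OF su(1)] subspace_scale[OF su(1)])
  moreover have "\<rho> g u \<in> C" if "g \<in> ?G" "u \<in> C" for g u
    using that U Prho[of g u] UW rho_zero by (auto simp: C_def stable_def)
  ultimately have "stable C" using UW by (auto simp: stable_def C_def)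
  moreover have "C \<inter> U' = {0}" using Pid su subspace_0 by (force simp: C_def)
  moreover have "\<exists>a\<in>U'. \<exists>c\<in>C. u = a + c" if u: "u \<in> U" for u
  proof (rule bexI[of _ "P u"], rule bexI[of _ "u - P u"])
    have PU: "P u \<in> U" using PU' U'(2) by blast
    have "P (u - P u) = P u + P ((-1) *v P u)"
      using Padd[of u "(-1) *v P u"] UW[OF u] UW[OF PU] subspace_neg[OF W] by simp
    also have "\<dots> = 0" using Psmult[of "P u" "-1"] UW[OF PU] Pid[OF PU'] by simp
    finally show "u - P u \<in> C" using subspace_diff[OF su(1) u PU] by (simp add: C_def)
  qed (simp_all add: PU')
  ultimately show thesis by (intro that[of C]) (auto simp: C_def)
qed

text \<open>Independence of the summands takes the place of the uniqueness clause in
  \<open>irreducible_decomposition\<close>. It is convenient for concatenation, and uniqueness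
  returns by subtracting two representations of a vector.\<close>

definition decomposes :: "'b set \<Rightarrow> nat \<Rightarrow> (nat \<Rightarrow> 'b set) \<Rightarrow> bool"
  where "decomposes U r D \<longleftrightarrow> (\<forall>j<r. simple (D j) \<and> D j \<subseteq> U) \<and>
    (\<forall>v\<in>U. \<exists>u. (\<forall>j<r. u j \<in> D j) \<and> v = (\<Sum>j<r. u j)) \<and>
    (\<forall>u. (\<forall>j<r. u j \<in> D j) \<longrightarrow> (\<Sum>j<r. u j) = 0 \<longrightarrow> (\<forall>j<r. u j = 0))"

lemma sum_lessThan_split:
  fixes f :: "nat \<Rightarrow> 'b"
  shows "(\<Sum>j<r + s. f j) = (\<Sum>j<r. f j) + (\<Sum>j<s. f (r + j))"
  by (induction s) (simp_all add: add.assoc)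

lemma decomposes_sum:
  assumes U: "stable U" and A: "stable A" "A \<subseteq> U" "decomposes A r D" and C: "stable C" "C \<subseteq> U" "decomposes C s E"
    and int: "C \<inter> A = {0}" and span: "\<And>u. u \<in> U \<Longrightarrow> \<exists>a\<in>A. \<exists>c\<in>C. u = a + c"
  shows "decomposes U (r + s) (\<lambda>j. if j < r then D j else E (j - r))" (is "decomposes U _ ?F")
  unfolding decomposes_def
proof (intro conjI allI impI ballI)
  fix j assume "j < r + s"
  then have "j - r < s" if "\<not> j < r" using that by simp
  then show "simple (?F j)" "?F j \<subseteq> U"
    using A C by (cases "j < r"; force simp: decomposes_def)+
next
  fix v assume "v \<in> U"
  then obtain a c where ac: "a \<in> A" "c \<in> C" "v = a + c" using span by blast
  obtain x where x: "\<forall>j<r. x j \<in> D j" "a = (\<Sum>j<r. x j)" using A(3) ac(1) unfolding decomposes_def by blast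
  obtain y where y: "\<forall>j<s. y j \<in> E j" "c = (\<Sum>j<s. y j)" using C(3) ac(2) unfolding decomposes_def by blast
  show "\<exists>u. (\<forall>j<r + s. u j \<in> ?F j) \<and> v = (\<Sum>j<r + s. u j)"
    by (rule exI[of _ "\<lambda>j. if j < r then x j else y (j - r)"]) (use x y ac in \<open>auto simp: sum_lessThan_split\<close>)
next
  fix u j assume u: "\<forall>j<r + s. u j \<in> ?F j" "(\<Sum>j<r + s. u j) = 0" and j: "j < r + s"
  define a where "a = (\<Sum>j<r. u j)"
  define c where "c = (\<Sum>j<s. u (r + j))"
  have uD: "\<forall>j<r. u j \<in> D j"
  proof (intro allI impI)
    fix j assume "j < r"
    then show "u j \<in> D j" using u(1)[rule_format, of j] by simp
  qed
  have uE: "\<forall>j<s. u (r + j) \<in> E j"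
  proof (intro allI impI)
    fix j assume "j < s"
    then have "u (r + j) \<in> ?F (r + j)" using u(1) by (metis nat_add_left_cancel_less)
    then show "u (r + j) \<in> E j" by simp
  qed
  have sA: "subspace A" and sC: "subspace C" using A C by (auto simp: stable_def)
  have "a \<in> A" unfolding a_def using uD A(3) by (intro subspace_sum[OF sA]) (auto simp: decomposes_def)
  moreover have "c \<in> C" unfolding c_def using uE C(3) by (intro subspace_sum[OF sC]) (auto simp: decomposes_def)
  moreover have ac: "a + c = 0" using u(2) by (simp add: a_def c_def sum_lessThan_split)
  \<comment> \<open>From \<open>a + c = 0\<close>, the vector \<open>c = - a\<close> lies in both
    summands.\<close>
  ultimately have "c \<in> C \<inter> A" using subspace_neg[OF sA] by (metis IntI add_eq_0_iff2 add.commute neg_eq_iff_add_eq_0)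
  then have "c = 0" "a = 0" using int ac by auto
  moreover have "(\<Sum>j<r. x j) = 0 \<Longrightarrow> \<forall>j<r. x j = 0" if "\<forall>j<r. x j \<in> D j" for x
    using A(3) that by (simp add: decomposes_def)
  moreover have "(\<Sum>j<s. x j) = 0 \<Longrightarrow> \<forall>j<s. x j = 0" if "\<forall>j<s. x j \<in> E j" for x
    using C(3) that by (simp add: decomposes_def)
  ultimately have "\<forall>j<r. u j = 0" "\<forall>j<s. u (r + j) = 0"
    using uD uE by (simp_all add: a_def c_def)
  then show "u j = 0" using j by (metis add_diff_inverse_nat nat_add_left_cancel_less)
qed

text \<open>A basis of \<open>A\<close> stays independent when a vector outside \<open>A\<close> is
  added. The finite set \<open>F\<close> keeps the bases in \<open>U\<close> finite, so their
  cardinalities compare strictly.\<close>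

lemma dim_less:
  assumes "subspace A" "A \<subset> U" "U \<subseteq> span F" "finite F"
  shows "dim A < dim U"
proof -
  obtain B where B: "B \<subseteq> A" "independent B" "A \<subseteq> span B" using maximal_independent_subset by blast
  obtain u where u: "u \<in> U" "u \<notin> A" using assms(2) by blast
  have "span B = A" using B span_minimal[OF B(1) assms(1)] by auto
  then have ind: "independent (insert u B)" using B(2) u(2) independent_insertI by blast
  obtain B' where B': "insert u B \<subseteq> B'" "B' \<subseteq> U" "independent B'" "U \<subseteq> span B'"
    using maximal_independent_subset_extend[of "insert u B" U] ind B(1) u(1) assms(2) by auto
  have fB': "finite B'" using independent_span_bound[OF assms(4) B'(3)] B'(2) assms(3) by blast
  have "dim A = card B" using basis_card_eq_dim[OF B(1,3,2)] by simp
  moreover have "dim U = card B'" using basis_card_eq_dim[OF B'(2,4,3)] by simp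
  moreover have "u \<notin> B" using B(1) u(2) by blast
  ultimately show ?thesis using card_mono[OF fB' B'(1)] finite_subset[OF B'(1) fB'] by simp
qed

text \<open>Maschke's theorem splits a space that is not simple into two proper stable subspaces,
  both of smaller dimension. The zero space is the empty sum.\<close>

theorem complete_reducibility:
  assumes "stable U" "U \<subseteq> span F" "finite F"
  shows "\<exists>r D. decomposes U r D"
  using assms(1,2)
proof (induction "dim U" arbitrary: U rule: less_induct)
  case less
  show ?case
  proof (cases "U = {0}")
    case True
    then show ?thesis by (intro exI[of _ 0] exI[of _ "\<lambda>_. {}"]) (simp add: decomposes_def)
  next
    case ne: False
    show ?thesis
    proof (cases "simple U")
      case True
      then show ?thesis by (intro exI[of _ 1] exI[of _ "\<lambda>_. U"]) (auto simp: decomposes_def)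
    next
      case False
      then obtain A where A: "stable A" "A \<subseteq> U" "A \<noteq> {0}" "A \<noteq> U" using ne less.prems by (auto simp: simple_def)
      obtain C where C: "stable C" "C \<subseteq> U" "C \<inter> A = {0}" "\<And>u. u \<in> U \<Longrightarrow> \<exists>a\<in>A. \<exists>c\<in>C. u = a + c"
        using Maschke[OF less.prems(1) A(1,2)] by blast
      have sA: "subspace A" and sC: "subspace C" using A C by (auto simp: stable_def)
      have "C \<noteq> U" using C(3) A(2,3) subspace_0[OF sA] by auto
      then have "dim A < dim U" "dim C < dim U"
        using dim_less[OF sA _ less.prems(2) assms(3)] dim_less[OF sC _ less.prems(2) assms(3)] A C by blast+
      then obtain r D s E where "decomposes A r D" "decomposes C s E"
        using less.hyps[of A] less.hyps[of C] A C less.prems(2) by blast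
      from decomposes_sum[OF less.prems(1) A(1,2) this(1) C(1,2) this(2) C(3,4)] show ?thesis by blast
    qed
  qed
qed

end


section \<open>Multiplicities\<close>

lemma (in linear_rep) finsum_image:
  assumes h: "\<And>v w. v \<in> carrier V \<Longrightarrow> w \<in> carrier V \<Longrightarrow> h (v \<oplus>\<^bsub>V\<^esub> w) = h v \<oplus>\<^bsub>V\<^esub> h w"
    and closed: "\<And>v. v \<in> carrier V \<Longrightarrow> h v \<in> carrier V" and zero: "h \<zero>\<^bsub>V\<^esub> = \<zero>\<^bsub>V\<^esub>"
    and A: "finite A"
  shows "a \<in> A \<rightarrow> carrier V \<Longrightarrow> h (\<Oplus>\<^bsub>V\<^esub>j\<in>A. a j) = (\<Oplus>\<^bsub>V\<^esub>j\<in>A. h (a j))"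
  using A
proof (induction A rule: finite_induct)
  case (insert x A)
  then have "a \<in> A \<rightarrow> carrier V" "a x \<in> carrier V" by auto
  then show ?case using insert by (simp add: V.finsum_insert h closed Pi_iff V.finsum_closed)
qed (simp add: zero)

lemma (in linear_rep) act_zero: "g \<in> carrier G \<Longrightarrow> act V g \<zero>\<^bsub>V\<^esub> = \<zero>\<^bsub>V\<^esub>"
  using act_add[of g "\<zero>\<^bsub>V\<^esub>" "\<zero>\<^bsub>V\<^esub>"] act_closed[of g "\<zero>\<^bsub>V\<^esub>"] V.add.l_cancel_one' by fastforce

lemma (in linear_rep) smult_carrier: "v \<in> carrier V \<Longrightarrow> c \<odot>\<^bsub>V\<^esub> v \<in> carrier V"
  using V.smult_closed[of c v] by (simp add: complex_field_def)

lemma (in linear_rep) smult_add: "v \<in> carrier V \<Longrightarrow> w \<in> carrier V \<Longrightarrow> c \<odot>\<^bsub>V\<^esub> (v \<oplus>\<^bsub>V\<^esub> w) = c \<odot>\<^bsub>V\<^esub> v \<oplus>\<^bsub>V\<^esub> c \<odot>\<^bsub>V\<^esub> w"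
  using V.smult_r_distr[of c v w] by (simp add: complex_field_def)

lemma (in linear_rep) smult_zero: "c \<odot>\<^bsub>V\<^esub> \<zero>\<^bsub>V\<^esub> = \<zero>\<^bsub>V\<^esub>"
  using V.smult_r_null[of c] by (simp add: complex_field_def)

lemma (in linear_rep) subrepI:
  assumes "U \<subseteq> carrier V" "\<zero>\<^bsub>V\<^esub> \<in> U" "\<And>v w. v \<in> U \<Longrightarrow> w \<in> U \<Longrightarrow> v \<oplus>\<^bsub>V\<^esub> w \<in> U"
    "\<And>c v. v \<in> U \<Longrightarrow> c \<odot>\<^bsub>V\<^esub> v \<in> U" "\<And>g v. g \<in> carrier G \<Longrightarrow> v \<in> U \<Longrightarrow> act V g v \<in> U"
  shows "subrep G V U"
proof -
  have "\<ominus>\<^bsub>V\<^esub> v \<in> U" if "v \<in> U" for v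
  proof -
    have v: "v \<in> carrier V" using that assms(1) by blast
    have "(\<ominus>\<^bsub>complex_field\<^esub> \<one>\<^bsub>complex_field\<^esub>) \<odot>\<^bsub>V\<^esub> v = \<ominus>\<^bsub>V\<^esub> v"
      using V.smult_l_minus[of "\<one>\<^bsub>complex_field\<^esub>" v] V.smult_one[of v] V.R.one_closed v by simp
    then show ?thesis using assms(4)[OF that] by metis
  qed
  then have "submodule U complex_field V" using assms(1-4)
    by (intro submodule.intro submodule_axioms.intro V.add.subgroupI) (auto simp: a_inv_def)
  then show ?thesis using assms(5) by (simp add: subrep_def)
qed

lemma (in linear_rep) subrepD:
  assumes "subrep G V U"
  shows "U \<subseteq> carrier V" "\<zero>\<^bsub>V\<^esub> \<in> U" "\<And>v w. v \<in> U \<Longrightarrow> w \<in> U \<Longrightarrow> v \<oplus>\<^bsub>V\<^esub> w \<in> U"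
    "\<And>c v. v \<in> U \<Longrightarrow> c \<odot>\<^bsub>V\<^esub> v \<in> U" "\<And>g v. g \<in> carrier G \<Longrightarrow> v \<in> U \<Longrightarrow> act V g v \<in> U"
proof -
  have s: "submodule U complex_field V" using assms by (simp add: subrep_def)
  have g: "subgroup U (add_monoid V)" by (rule submodule.axioms(1)[OF s])
  show "U \<subseteq> carrier V" using subgroup.subset[OF g] by simp
  show "\<zero>\<^bsub>V\<^esub> \<in> U" using subgroup.one_closed[OF g] by simp
  show "v \<oplus>\<^bsub>V\<^esub> w \<in> U" if "v \<in> U" "w \<in> U" for v w using subgroup.m_closed[OF g that] by simp
  show "c \<odot>\<^bsub>V\<^esub> v \<in> U" if "v \<in> U" for c v using submodule.smult_closed[OF s _ that] by (simp add: complex_field_def)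
  show "act V g v \<in> U" if "g \<in> carrier G" "v \<in> U" for g v using assms that by (simp add: subrep_def)
qed

section \<open>Transfer between modules and vector spaces\<close>

text \<open>\<open>f\<close> embeds the module linearly into a vector space over a whole type, where
  Maschke's theorem is available; subrepresentations of \<open>V\<close> correspond to stable
  subspaces of the image. For cohomology, \<open>f\<close> is \<open>functional\<close>.\<close>

locale embedded_rep = linear_rep G V + vector_space scale
  for G :: "('g, 'x) monoid_scheme" and V :: "('g, 'v) rep"
    and scale :: "complex \<Rightarrow> 'b::ab_group_add \<Rightarrow> 'b" (infixr "*v" 75) +
  fixes f :: "'v \<Rightarrow> 'b"
  assumes fin: "finite (carrier G)" and f_inj: "inj_on f (carrier V)"
    and f_add: "\<And>v w. v \<in> carrier V \<Longrightarrow> w \<in> carrier V \<Longrightarrow> f (v \<oplus>\<^bsub>V\<^esub> w) = f v + f w"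
    and f_smult: "\<And>c v. v \<in> carrier V \<Longrightarrow> f (c \<odot>\<^bsub>V\<^esub> v) = c *v f v"
begin

lemma f_zero: "f \<zero>\<^bsub>V\<^esub> = 0"
  using f_add[of "\<zero>\<^bsub>V\<^esub>" "\<zero>\<^bsub>V\<^esub>"] by simp

lemma subspace_image:
  assumes "U \<subseteq> carrier V" "\<zero>\<^bsub>V\<^esub> \<in> U" "\<And>v w. v \<in> U \<Longrightarrow> w \<in> U \<Longrightarrow> v \<oplus>\<^bsub>V\<^esub> w \<in> U" "\<And>c v. v \<in> U \<Longrightarrow> c \<odot>\<^bsub>V\<^esub> v \<in> U"
  shows "subspace (f ` U)"
proof (rule subspaceI)
  show "0 \<in> f ` U" using assms(2) f_zero by force
  show "x + y \<in> f ` U" if xy: "x \<in> f ` U" "y \<in> f ` U" for x y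
  proof -
    obtain v w where "v \<in> U" "w \<in> U" "x = f v" "y = f w" using xy by blast
    then show ?thesis using f_add[of v w] assms(1,3) by (metis imageI subsetD)
  qed
  show "c *v x \<in> f ` U" if x: "x \<in> f ` U" for c x
  proof -
    obtain v where "v \<in> U" "x = f v" using x by blast
    then show ?thesis using f_smult[of v c] assms(1,4) by (metis imageI subsetD)
  qed
qed

lemma f_finsum: "finite A \<Longrightarrow> a \<in> A \<rightarrow> carrier V \<Longrightarrow> f (\<Oplus>\<^bsub>V\<^esub>j\<in>A. a j) = (\<Sum>j\<in>A. f (a j))"
proof (induction A rule: finite_induct)
  case (insert x A)
  then have "a \<in> A \<rightarrow> carrier V" "a x \<in> carrier V" by auto
  then show ?case using insert by (simp add: V.finsum_insert f_add V.finsum_closed)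
qed (simp add: f_zero)

definition \<rho> :: "'g \<Rightarrow> 'b \<Rightarrow> 'b" where "\<rho> g w = f (act V g (inv_into (carrier V) f w))"

lemma \<rho>_f: "v \<in> carrier V \<Longrightarrow> \<rho> g (f v) = f (act V g v)"
  by (simp add: \<rho>_def inv_into_f_f[OF f_inj])

sublocale W: finite_group_rep scale G "f ` carrier V" \<rho>
proof (unfold_locales)
  show "finite (carrier G)" by (rule fin)
  show "subspace (f ` carrier V)" by (rule subspace_image) (auto simp: smult_carrier)
next
  fix g v w assume "g \<in> carrier G" "v \<in> f ` carrier V" "w \<in> f ` carrier V"
  then show "\<rho> g (v + w) = \<rho> g v + \<rho> g w"
    by (auto simp: f_add[symmetric] \<rho>_f act_add act_closed)
next
  fix g h w assume "g \<in> carrier G" "h \<in> carrier G" "w \<in> f ` carrier V"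
  then show "\<rho> (g \<otimes>\<^bsub>G\<^esub> h) w = \<rho> g (\<rho> h w)" by (auto simp: \<rho>_f act_mult act_closed)
qed (auto simp: \<rho>_f act_closed act_one f_smult[symmetric] smult_carrier act_smult)

definition pre :: "'b set \<Rightarrow> 'v set" where "pre D = {v \<in> carrier V. f v \<in> D}"

lemma subrep_pre:
  assumes "W.stable D"
  shows "subrep G V (pre D)" "f ` pre D = D"
proof -
  have D: "subspace D" "D \<subseteq> f ` carrier V" "\<And>g u. g \<in> carrier G \<Longrightarrow> u \<in> D \<Longrightarrow> \<rho> g u \<in> D"
    using assms by (auto simp: W.stable_def)
  show "subrep G V (pre D)"
  proof (rule subrepI)
    show "act V g v \<in> pre D" if "g \<in> carrier G" "v \<in> pre D" for g v
      using that D(3)[of g "f v"] by (simp add: pre_def \<rho>_f act_closed)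
  qed (auto simp: pre_def f_zero f_add f_smult smult_carrier subspace_0[OF D(1)] subspace_add[OF D(1)] subspace_scale[OF D(1)])
  show "f ` pre D = D" using D(2) by (auto simp: pre_def)
qed

lemma stable_image:
  assumes "subrep G V U"
  shows "W.stable (f ` U)"
proof -
  note U = subrepD[OF assms]
  have "\<rho> g x \<in> f ` U" if g: "g \<in> carrier G" and x: "x \<in> f ` U" for g x
  proof -
    obtain v where v: "v \<in> U" "x = f v" using x by blast
    then have "\<rho> g x = f (act V g v)" using \<rho>_f U(1) by blast
    then show ?thesis using U(5)[OF g v(1)] by blast
  qed
  then show ?thesis using subspace_image[OF U(1-4)] U(1) by (auto simp: W.stable_def)
qed

lemma irreducible_pre:
  assumes "W.simple D"
  shows "irreducible_subrep G V (pre D)"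
proof -
  have D: "W.stable D" "D \<noteq> {0}" "\<And>D'. W.stable D' \<Longrightarrow> D' \<subseteq> D \<Longrightarrow> D' = {0} \<or> D' = D"
    using assms by (auto simp: W.simple_def)
  note p = subrep_pre[OF D(1)]
  have "pre D \<noteq> {\<zero>\<^bsub>V\<^esub>}" using p(2) D(2) f_zero by force
  moreover have "U' = {\<zero>\<^bsub>V\<^esub>} \<or> U' = pre D" if U': "subrep G V U'" "U' \<subseteq> pre D" for U'
  proof -
    have "f ` U' = f ` {\<zero>\<^bsub>V\<^esub>} \<or> f ` U' = f ` pre D"
      using D(3)[OF stable_image[OF U'(1)]] U'(2) p(2) f_zero by auto
    then show ?thesis
      using inj_on_image_eq_iff[OF f_inj] subrepD(1)[OF U'(1)] subrepD(1)[OF p(1)] V.zero_closed by blast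
  qed
  ultimately show ?thesis using p(1) by (simp add: irreducible_subrep_def)
qed

text \<open>\<open>multiplicity_in\<close> is a definite description, so its value can be determined
  only once some decomposition is known to exist.\<close>

theorem irreducible_decomposition_exists:
  assumes "f ` carrier V \<subseteq> span F" "finite F"
  shows "\<exists>r U. irreducible_decomposition G V r U"
proof -
  have "W.stable (f ` carrier V)"
    by (rule stable_image, rule subrepI) (auto simp: smult_carrier act_closed)
  from W.complete_reducibility[OF this assms] obtain r D where rD: "W.decomposes (f ` carrier V) r D" by blast
  have simple: "W.simple (D j)" if "j < r" for j using rD that by (simp add: W.decomposes_def)
  have st: "W.stable (D j)" if "j < r" for j using simple[OF that] by (simp add: W.simple_def)
  have ex: "\<exists>u. (\<forall>j<r. u j \<in> D j) \<and> f v = (\<Sum>j<r. u j)" if "v \<in> carrier V" for v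
    using rD that by (simp add: W.decomposes_def)
  have ind: "\<forall>j<r. u j = 0" if "\<forall>j<r. u j \<in> D j" "(\<Sum>j<r. u j) = 0" for u
    using rD that by (simp add: W.decomposes_def)
  let ?U = "\<lambda>j. pre (D j)"
  have car: "a \<in> {..<r} \<rightarrow> carrier V" if "a \<in> (\<Pi>\<^sub>E j\<in>{..<r}. ?U j)" for a
    using that by (auto simp: pre_def)
  have "\<exists>!u. u \<in> (\<Pi>\<^sub>E j\<in>{..<r}. ?U j) \<and> v = (\<Oplus>\<^bsub>V\<^esub>j\<in>{..<r}. u j)" if v: "v \<in> carrier V" for v
  proof -
    obtain u where u: "\<forall>j<r. u j \<in> D j" "f v = (\<Sum>j<r. u j)" using ex[OF v] by blast
    define a where "a = (\<lambda>j\<in>{..<r}. inv_into (carrier V) f (u j))"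
    have a: "a j \<in> ?U j" "f (a j) = u j" if "j < r" for j
    proof -
      have "u j \<in> f ` carrier V" using u(1) st[OF that] that by (auto simp: W.stable_def)
      then show "a j \<in> ?U j" "f (a j) = u j" using that u(1) by (auto simp: a_def pre_def f_inv_into_f inv_into_into)
    qed
    have aP: "a \<in> (\<Pi>\<^sub>E j\<in>{..<r}. ?U j)" using a by (auto simp: a_def)
    have "f (\<Oplus>\<^bsub>V\<^esub>j\<in>{..<r}. a j) = f v"
      using f_finsum[OF finite_lessThan car[OF aP]] a u(2) by simp
    then have "v = (\<Oplus>\<^bsub>V\<^esub>j\<in>{..<r}. a j)"
      using inj_onD[OF f_inj _ V.finsum_closed[OF car[OF aP]] v] by simp
    moreover have "b = a" if b: "b \<in> (\<Pi>\<^sub>E j\<in>{..<r}. ?U j)" "v = (\<Oplus>\<^bsub>V\<^esub>j\<in>{..<r}. b j)" for b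
    proof -
      have bD: "f (b j) \<in> D j" if "j < r" for j using b(1) that by (auto simp: pre_def PiE_def Pi_def)
      have "(\<Sum>j<r. f (b j) - u j) = 0"
        using f_finsum[OF finite_lessThan car[OF b(1)]] b(2) u(2) by (simp add: sum_subtractf)
      then have "\<forall>j<r. f (b j) - u j = 0"
        using bD u(1) st by (intro ind) (auto simp: W.stable_def intro!: subspace_diff)
      then have "b j = a j" if "j < r" for j
        using that a[OF that] car[OF b(1)] car[OF aP] inj_onD[OF f_inj, of "b j" "a j"] by auto
      then show ?thesis by (intro PiE_ext[OF b(1) aP]) simp
    qed
    ultimately show ?thesis using aP by blast
  qed
  then have "irreducible_decomposition G V r ?U"
    using irreducible_pre[OF simple] by (simp add: irreducible_decomposition_def)
  then show ?thesis by blast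
qed

end

text \<open>The component of a vector in an irreducible summand is fixed by whatever fixes the vector,
  so a spanning set of vectors without counterpart in \<open>Y\<close> excludes summands isomorphic to \<open>Y\<close>.\<close>

lemma (in linear_rep) no_summand_iso:
  assumes Y: "linear_rep G Y"
    and M: "M \<subseteq> carrier V"
    and span: "\<And>Z. \<lbrakk>Z \<subseteq> carrier V; \<zero>\<^bsub>V\<^esub> \<in> Z; \<And>v w. v \<in> Z \<Longrightarrow> w \<in> Z \<Longrightarrow> v \<oplus>\<^bsub>V\<^esub> w \<in> Z;
      \<And>c v. v \<in> Z \<Longrightarrow> c \<odot>\<^bsub>V\<^esub> v \<in> Z; M \<subseteq> Z\<rbrakk> \<Longrightarrow> carrier V \<subseteq> Z"
    and fixed: "\<And>m. m \<in> M \<Longrightarrow> \<exists>K\<subseteq>carrier G. (\<forall>g\<in>K. act V g m = m) \<and>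
      (\<forall>y\<in>carrier Y. (\<forall>g\<in>K. act Y g y = y) \<longrightarrow> y = \<zero>\<^bsub>Y\<^esub>)"
    and dec: "irreducible_decomposition G V r U" and j: "j < r"
  shows "\<not> rep_iso G Y (V\<lparr>carrier := U j\<rparr>)"
proof
  assume "rep_iso G Y (V\<lparr>carrier := U j\<rparr>)"
  then obtain \<phi> where \<phi>: "bij_betw \<phi> (carrier Y) (U j)"
      "\<forall>v\<in>carrier Y. \<forall>w\<in>carrier Y. \<phi> (v \<oplus>\<^bsub>Y\<^esub> w) = \<phi> v \<oplus>\<^bsub>V\<^esub> \<phi> w"
      "\<forall>g\<in>carrier G. \<forall>v\<in>carrier Y. \<phi> (act Y g v) = act V g (\<phi> v)"
    by (auto simp: rep_iso_def)
  interpret Y: linear_rep G Y by (rule Y)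
  have sub: "subrep G V (U k)" if "k < r" for k
    using dec that by (simp add: irreducible_decomposition_def irreducible_subrep_def)
  note U = subrepD[OF sub]
  let ?P = "\<Pi>\<^sub>E k\<in>{..<r}. U k"
  define comp where "comp v = (THE u. u \<in> ?P \<and> v = (\<Oplus>\<^bsub>V\<^esub>k\<in>{..<r}. u k))" for v
  have ex1: "\<exists>!u. u \<in> ?P \<and> v = (\<Oplus>\<^bsub>V\<^esub>k\<in>{..<r}. u k)" if "v \<in> carrier V" for v
    using dec that by (simp add: irreducible_decomposition_def)
  have comp: "comp v \<in> ?P" "v = (\<Oplus>\<^bsub>V\<^esub>k\<in>{..<r}. comp v k)" if "v \<in> carrier V" for v
    using theI'[OF ex1[OF that]] by (simp_all add: comp_def)
  have car: "u \<in> {..<r} \<rightarrow> carrier V" if "u \<in> ?P" for u using that U(1) by blast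
  have comp_eq: "comp v = u" if "u \<in> ?P" "v = (\<Oplus>\<^bsub>V\<^esub>k\<in>{..<r}. u k)" for u v
  proof -
    have v: "v \<in> carrier V" using that car by (simp add: V.finsum_closed)
    show ?thesis unfolding comp_def by (rule the1_equality[OF ex1[OF v]]) (use that in blast)
  qed
  have restr: "(\<Oplus>\<^bsub>V\<^esub>k\<in>{..<r}. (\<lambda>k\<in>{..<r}. u k) k) = (\<Oplus>\<^bsub>V\<^esub>k\<in>{..<r}. u k)" if "u \<in> {..<r} \<rightarrow> carrier V" for u
    by (rule V.finsum_cong') (use that in auto)
  have compU: "comp v k \<in> U k" if "v \<in> carrier V" "k < r" for v k using comp(1)[OF that(1)] that(2) by auto
  have compc: "comp v k \<in> carrier V" if "v \<in> carrier V" "k < r" for v k using compU[OF that] U(1)[OF that(2)] by blast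
  have comp_add: "comp (v \<oplus>\<^bsub>V\<^esub> w) k = comp v k \<oplus>\<^bsub>V\<^esub> comp w k" if "v \<in> carrier V" "w \<in> carrier V" "k < r" for v w k
  proof -
    have "comp (v \<oplus>\<^bsub>V\<^esub> w) = (\<lambda>k\<in>{..<r}. comp v k \<oplus>\<^bsub>V\<^esub> comp w k)"
    proof (rule comp_eq)
      show "(\<lambda>k\<in>{..<r}. comp v k \<oplus>\<^bsub>V\<^esub> comp w k) \<in> ?P" using U(3) compU that by auto
      have "v \<oplus>\<^bsub>V\<^esub> w = (\<Oplus>\<^bsub>V\<^esub>k\<in>{..<r}. comp v k) \<oplus>\<^bsub>V\<^esub> (\<Oplus>\<^bsub>V\<^esub>k\<in>{..<r}. comp w k)"
        using comp(2)[OF that(1)] comp(2)[OF that(2)] by simp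
      also have "\<dots> = (\<Oplus>\<^bsub>V\<^esub>k\<in>{..<r}. comp v k \<oplus>\<^bsub>V\<^esub> comp w k)"
        by (rule V.finsum_addf[symmetric]) (use compc that in auto)
      also have "\<dots> = (\<Oplus>\<^bsub>V\<^esub>k\<in>{..<r}. (\<lambda>k\<in>{..<r}. comp v k \<oplus>\<^bsub>V\<^esub> comp w k) k)"
        by (rule restr[symmetric]) (use compc that in auto)
      finally show "v \<oplus>\<^bsub>V\<^esub> w = (\<Oplus>\<^bsub>V\<^esub>k\<in>{..<r}. (\<lambda>k\<in>{..<r}. comp v k \<oplus>\<^bsub>V\<^esub> comp w k) k)" .
    qed
    then show ?thesis using that(3) by simp
  qed
  \<comment> \<open>Components commute with every additive map that preserves the summands; this
    serves for the group action and for scalars alike.\<close>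
  have comp_map: "comp (h v) k = h (comp v k)"
    if h: "\<And>v w. v \<in> carrier V \<Longrightarrow> w \<in> carrier V \<Longrightarrow> h (v \<oplus>\<^bsub>V\<^esub> w) = h v \<oplus>\<^bsub>V\<^esub> h w" "h \<zero>\<^bsub>V\<^esub> = \<zero>\<^bsub>V\<^esub>"
      "\<And>v. v \<in> carrier V \<Longrightarrow> h v \<in> carrier V" "\<And>k v. k < r \<Longrightarrow> v \<in> U k \<Longrightarrow> h v \<in> U k"
      and v: "v \<in> carrier V" and k: "k < r" for h v k
  proof -
    have "comp (h v) = (\<lambda>k\<in>{..<r}. h (comp v k))"
    proof (rule comp_eq)
      show "(\<lambda>k\<in>{..<r}. h (comp v k)) \<in> ?P" using h(4) compU v by auto
      have "h v = h (\<Oplus>\<^bsub>V\<^esub>k\<in>{..<r}. comp v k)" using comp(2)[OF v] by simp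
      also have "\<dots> = (\<Oplus>\<^bsub>V\<^esub>k\<in>{..<r}. h (comp v k))"
        by (rule finsum_image[OF h(1,3,2) finite_lessThan]) (use compc v in auto)
      also have "\<dots> = (\<Oplus>\<^bsub>V\<^esub>k\<in>{..<r}. (\<lambda>k\<in>{..<r}. h (comp v k)) k)"
        by (rule restr[symmetric]) (use compc v h(3) in auto)
      finally show "h v = (\<Oplus>\<^bsub>V\<^esub>k\<in>{..<r}. (\<lambda>k\<in>{..<r}. h (comp v k)) k)" .
    qed
    then show ?thesis using k by simp
  qed
  have comp_act: "comp (act V g v) j = act V g (comp v j)" if "g \<in> carrier G" "v \<in> carrier V" for g v
    by (rule comp_map) (use that act_add act_zero act_closed U(5) j in auto)
  have comp_smult: "comp (c \<odot>\<^bsub>V\<^esub> v) j = c \<odot>\<^bsub>V\<^esub> comp v j" if "v \<in> carrier V" for c v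
    by (rule comp_map[where h = "\<lambda>v. c \<odot>\<^bsub>V\<^esub> v"]) (use that smult_add smult_zero smult_carrier U(4) j in auto)
  \<comment> \<open>The kernel of the \<open>j\<close>-th component. It will contain
    \<open>M\<close>, hence all of \<open>V\<close>, whereas a vector of \<open>U j\<close> is its
    own component; so \<open>U j\<close> would be zero.\<close>
  define Z where "Z = {v \<in> carrier V. comp v j = \<zero>\<^bsub>V\<^esub>}"
  have \<phi>0: "\<phi> \<zero>\<^bsub>Y\<^esub> = \<zero>\<^bsub>V\<^esub>"
  proof -
    have "\<phi> \<zero>\<^bsub>Y\<^esub> \<in> carrier V" using \<phi>(1) U(1)[OF j] Y.V.zero_closed by (auto simp: bij_betw_def)
    moreover have "\<phi> \<zero>\<^bsub>Y\<^esub> \<oplus>\<^bsub>V\<^esub> \<phi> \<zero>\<^bsub>Y\<^esub> = \<phi> \<zero>\<^bsub>Y\<^esub>" using \<phi>(2) Y.V.zero_closed Y.V.l_zero by metis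
    ultimately show ?thesis using V.add.l_cancel_one'[of "\<phi> \<zero>\<^bsub>Y\<^esub>" "\<phi> \<zero>\<^bsub>Y\<^esub>"] by simp
  qed
  have "m \<in> Z" if m: "m \<in> M" for m
  proof -
    obtain K where K: "K \<subseteq> carrier G" "\<forall>g\<in>K. act V g m = m" "\<forall>y\<in>carrier Y. (\<forall>g\<in>K. act Y g y = y) \<longrightarrow> y = \<zero>\<^bsub>Y\<^esub>"
      using fixed[OF m] by blast
    have mc: "m \<in> carrier V" using M m by blast
    obtain y where y: "y \<in> carrier Y" "\<phi> y = comp m j"
      using compU[OF mc j] bij_betw_imp_surj_on[OF \<phi>(1)] by (metis imageE)
    have "act Y g y = y" if g: "g \<in> K" for g
    proof -
      have gG: "g \<in> carrier G" using K(1) g by blast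
      have "\<phi> (act Y g y) = act V g (comp m j)" using \<phi>(3) gG y by simp
      also have "\<dots> = \<phi> y" using comp_act[OF gG mc] K(2) g y(2) by simp
      finally show ?thesis
        using inj_onD[of \<phi> "carrier Y" "act Y g y" y] \<phi>(1) y(1) Y.act_closed[OF gG y(1)] by (simp add: bij_betw_def)
    qed
    then have "y = \<zero>\<^bsub>Y\<^esub>" using K(3) y(1) by blast
    then show ?thesis using \<phi>0 y(2) mc by (simp add: Z_def)
  qed
  then have "carrier V \<subseteq> Z"
  proof (intro span)
    show "\<zero>\<^bsub>V\<^esub> \<in> Z" using comp_smult[of "\<zero>\<^bsub>V\<^esub>" 0] compc[of "\<zero>\<^bsub>V\<^esub>" j] j V.smult_l_null[of "comp \<zero>\<^bsub>V\<^esub> j"] smult_zero[of 0]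
      by (simp add: Z_def complex_field_def)
  qed (auto simp: Z_def comp_add comp_smult smult_zero smult_carrier j)
  moreover have "v = \<zero>\<^bsub>V\<^esub>" if v: "v \<in> U j" "v \<in> Z" for v
  proof -
    have vc: "v \<in> carrier V" using U(1)[OF j] v by blast
    have "comp v = (\<lambda>k\<in>{..<r}. if j = k then v else \<zero>\<^bsub>V\<^esub>)"
    proof (rule comp_eq)
      show "(\<lambda>k\<in>{..<r}. if j = k then v else \<zero>\<^bsub>V\<^esub>) \<in> ?P" using v(1) U(2) by auto
      have "(\<Oplus>\<^bsub>V\<^esub>k\<in>{..<r}. (\<lambda>k\<in>{..<r}. if j = k then v else \<zero>\<^bsub>V\<^esub>) k) = (\<Oplus>\<^bsub>V\<^esub>k\<in>{..<r}. if j = k then v else \<zero>\<^bsub>V\<^esub>)"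
        by (rule restr) (use vc in auto)
      also have "\<dots> = v" using V.finsum_singleton[of j "{..<r}" "\<lambda>_. v"] vc j by simp
      finally show "v = (\<Oplus>\<^bsub>V\<^esub>k\<in>{..<r}. (\<lambda>k\<in>{..<r}. if j = k then v else \<zero>\<^bsub>V\<^esub>) k)" by simp
    qed
    then show ?thesis using v(2) j by (simp add: Z_def)
  qed
  ultimately have "U j = {\<zero>\<^bsub>V\<^esub>}" using U(1)[OF j] U(2)[OF j] by blast
  then show False using dec j by (simp add: irreducible_decomposition_def irreducible_subrep_def)
qed

section \<open>Multiplicities in the cohomology of configuration spaces\<close>

interpretation funspace: vector_space "\<lambda>(c :: complex) (f :: 'a \<Rightarrow> complex) x. c * f x"
  by unfold_locales (auto simp: fun_eq_iff algebra_simps)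

text \<open>Picks one function from each class of functions that agree on \<open>A\<close>, so that
  \<open>lspan\<close> turns into a span in a vector space of functions.\<close>

definition extend_zero :: "'a set \<Rightarrow> ('a \<Rightarrow> complex) \<Rightarrow> 'a \<Rightarrow> complex"
  where "extend_zero A \<psi> x = (if x \<in> A then \<psi> x else 0)"

lemma lspan_imp_span: "\<psi> \<in> lspan A F \<Longrightarrow> extend_zero A \<psi> \<in> funspace.span (extend_zero A ` F)"
proof (induction rule: lspan.induct)
  case (lspan_zero \<psi>)
  then have "extend_zero A \<psi> = 0" unfolding zero_fun_def by (auto simp: extend_zero_def fun_eq_iff)
  then show ?case using funspace.span_zero by metis
next
  case (lspan_step \<eta> \<phi> \<psi> c)
  then have eq: "extend_zero A \<psi> = (\<lambda>x. c * extend_zero A \<eta> x) + extend_zero A \<phi>"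
    by (auto simp: extend_zero_def fun_eq_iff)
  have "(\<lambda>x. c * extend_zero A \<eta> x) \<in> funspace.span (extend_zero A ` F)"
    by (rule funspace.span_scale[OF funspace.span_base]) (rule imageI[OF lspan_step(1)])
  from funspace.span_add[OF this lspan_step.IH] show ?case by (simp only: eq)
qed

lemma PConf_cohomology_simps:
  "carrier (PConf_cohomology i n) = carrier (cohomology i (PConf n))"
  "v \<oplus>\<^bsub>PConf_cohomology i n\<^esub> w = v \<oplus>\<^bsub>cohomology i (PConf n)\<^esub> w"
  "c \<odot>\<^bsub>PConf_cohomology i n\<^esub> v = c \<odot>\<^bsub>cohomology i (PConf n)\<^esub> v"
  "act (PConf_cohomology i n) \<sigma> = cohomology_pullback i (PConf n) (\<lambda>x. x \<circ> \<sigma>)"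
  by (simp_all add: PConf_cohomology_def)

lemma embedded_PConf_cohomology:
  "embedded_rep (sym_group n) (PConf_cohomology i n) (\<lambda>c f x. c * f x) (functional i (PConf n))"
proof (intro embedded_rep.intro embedded_rep_axioms.intro linear_rep_PConf_cohomology funspace.vector_space_axioms)
  show "finite (carrier (sym_group n))" by (simp add: sym_group_def finite_permutations)
qed (auto simp: PConf_cohomology_simps functional_inj functional_add functional_smult fun_eq_iff)

text \<open>The bound \<open>2 * k \<le> n\<close> makes the first row, of length
  \<open>n - k\<close>, at least as long as every part of \<open>\<mu>\<close>, so the padded shape
  has \<open>n - k\<close> columns. At least \<open>n - 2 * i\<close> points lie outside
  \<open>T\<close>, which is more.\<close>

theorem PConf_multiplicity_zero:
  assumes \<mu>: "is_partition \<mu> k" and i: "2 * i < k" and n: "2 * k \<le> n"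
  shows "PConf_multiplicity i n \<mu> = 0"
proof -
  let ?X = "PConf n" and ?V = "PConf_cohomology i n" and ?\<nu> = "padded \<mu> n"
  let ?H = "homology_group (int i) (PConf n)"
  interpret V: embedded_rep "sym_group n" ?V "\<lambda>c f x. c * f x" "functional i ?X"
    by (rule embedded_PConf_cohomology)
  have sum: "sum_list ?\<nu> = n" using \<mu> n by (simp add: padded_def is_partition_def)
  obtain F where F: "finite F" "F \<subseteq> cdual ?H" "cdual ?H \<subseteq> lspan (carrier ?H) F"
    "\<And>\<psi>. \<psi> \<in> F \<Longrightarrow> \<exists>T\<subseteq>{1..n}. int (card T) \<le> 2 * int i \<and> fixed_off n (int i) T \<psi>"
    using cogenerated_PConf[of n "int i"] i n by (auto simp: cogenerated_def)
  let ?c = "extend_zero (carrier ?H)"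
  have span: "functional i ?X v \<in> funspace.span (?c ` F)" if v: "v \<in> carrier ?V" for v
  proof -
    obtain \<phi> where \<phi>: "\<phi> \<in> cocycles i ?X" "v = coclass i ?X \<phi>"
      using v by (auto simp: PConf_cohomology_simps carrier_cohomology)
    have "functional i ?X v = ?c (functional i ?X v)" by (auto simp: extend_zero_def functional_off)
    moreover have "functional i ?X v \<in> lspan (carrier ?H) F" using functional_cdual[OF \<phi>(1)] \<phi>(2) F(3) by blast
    ultimately show ?thesis using lspan_imp_span by metis
  qed
  have cF: "?c \<psi> \<in> functional i ?X ` carrier ?V" if "\<psi> \<in> F" for \<psi>
  proof -
    have "?c \<psi> \<in> cdual ?H"
      using F(2) that monoid.m_closed[OF group.is_monoid[OF group_relative_homology_group[of "int i" ?X "{}"]]]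
      by (auto simp: cdual_def extend_zero_def)
    then show ?thesis unfolding PConf_cohomology_simps by (rule functional_surj) (simp add: extend_zero_def)
  qed
  \<comment> \<open>The cohomology classes that correspond to the finitely many spanning
    functionals.\<close>
  define M where "M = {v \<in> carrier ?V. functional i ?X v \<in> ?c ` F}"
  have no_iso: "\<not> rep_iso (sym_group n) (young_rep ?\<nu>) (?V\<lparr>carrier := U j\<rparr>)"
    if "irreducible_decomposition (sym_group n) ?V r U" "j < r" for r U j
  proof (rule V.no_summand_iso[OF _ _ _ _ that, where M = M])
    show "linear_rep (sym_group n) (young_rep ?\<nu>)" using linear_rep_young_rep[of ?\<nu>] sum by simp
    show "M \<subseteq> carrier ?V" by (auto simp: M_def)
  next
    fix Z assume Z: "Z \<subseteq> carrier ?V" "\<zero>\<^bsub>?V\<^esub> \<in> Z" "\<And>v w. v \<in> Z \<Longrightarrow> w \<in> Z \<Longrightarrow> v \<oplus>\<^bsub>?V\<^esub> w \<in> Z"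
      "\<And>c v. v \<in> Z \<Longrightarrow> c \<odot>\<^bsub>?V\<^esub> v \<in> Z" "M \<subseteq> Z"
    have "?c ` F \<subseteq> functional i ?X ` Z" 
    proof
      fix w assume w: "w \<in> ?c ` F"
      then obtain v where v: "v \<in> carrier ?V" "w = functional i ?X v" using cF by blast
      then have "v \<in> M" using w by (simp add: M_def)
      then show "w \<in> functional i ?X ` Z" using Z(5) v(2) by blast
    qed
    then have sp: "funspace.span (?c ` F) \<subseteq> functional i ?X ` Z"
      by (rule funspace.span_minimal) (rule V.subspace_image[OF Z(1-4)])
    show "carrier ?V \<subseteq> Z"
    proof
      fix v assume v: "v \<in> carrier ?V"
      then obtain z where "z \<in> Z" "functional i ?X v = functional i ?X z" using span sp by blast
      then show "v \<in> Z" using inj_onD[OF V.f_inj _ v] Z(1) by blast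
    qed
  next
    fix m assume "m \<in> M"
    then obtain \<psi> where m: "m \<in> carrier ?V" "\<psi> \<in> F" "functional i ?X m = ?c \<psi>" by (auto simp: M_def)
    obtain T where T: "T \<subseteq> {1..n}" "int (card T) \<le> 2 * int i" "fixed_off n (int i) T \<psi>" using F(4)[OF m(2)] by blast
    let ?K = "{\<sigma>. \<sigma> permutes {1..n} \<and> (\<forall>t\<in>T. \<sigma> t = t)}"
    have KG: "?K \<subseteq> carrier (sym_group n)" by (auto simp: sym_group_def)
    have "act ?V \<sigma> m = m" if \<sigma>: "\<sigma> \<in> ?K" for \<sigma>
    proof (rule inj_onD[OF V.f_inj _ V.act_closed m(1)])
      note pb = functional_pullback[OF continuous_map_PConf[of \<sigma> n], of m i]
      show "functional i ?X (act ?V \<sigma> m) = functional i ?X m"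
      proof
        fix z show "functional i ?X (act ?V \<sigma> m) z = functional i ?X m z"
        proof (cases "z \<in> carrier ?H")
          case True
          have "functional i ?X (act ?V \<sigma> m) z = ?c \<psi> (hom_induced (int i) ?X {} ?X {} (\<lambda>x. x \<circ> \<sigma>) z)"
            using pb[OF _ _ True] \<sigma> m by (simp add: PConf_cohomology_simps)
          also have "\<dots> = \<psi> (hom_induced (int i) ?X {} ?X {} (\<lambda>x. x \<circ> \<sigma>) z)" by (simp add: extend_zero_def hom_induced_carrier)
          also have "\<dots> = \<psi> z" using T(3) \<sigma> True by (simp add: fixed_off_def)
          finally show ?thesis using True m(3) by (simp add: extend_zero_def)
        qed (simp add: functional_off)
      qed
    qed (use KG \<sigma> m in auto)
    moreover have "y = \<zero>\<^bsub>young_rep ?\<nu>\<^esub>"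
      if y: "y \<in> carrier (young_rep ?\<nu>)" "\<forall>\<sigma>\<in>?K. act (young_rep ?\<nu>) \<sigma> y = y" for y
    proof (rule young_rep_fixed_eq_zero[OF y(1), unfolded sum, OF T(1)])
      have "a \<le> n - k" if "a \<in> set \<mu>" for a
        using member_le_sum_list[OF that] \<mu> n by (simp add: is_partition_def)
      then have "sorted_wrt (\<ge>) ?\<nu>" using \<mu> by (simp add: padded_def is_partition_def)
      then show "tableau_col ?\<nu> j \<in> {1..n - k}" if "j \<in> {1..n}" for j
        using tableau_col_bound[of ?\<nu> j] that sum \<mu> by (simp add: padded_def is_partition_def)
      have "card ({1..n} - T) = n - card T" using T(1) finite_subset by (subst card_Diff_subset) auto
      then show "card {1..n - k} < card ({1..n} - T)" using T(2) i n by simp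
    qed (use y(2) in auto)
    ultimately show "\<exists>K\<subseteq>carrier (sym_group n). (\<forall>g\<in>K. act ?V g m = m) \<and>
        (\<forall>y\<in>carrier (young_rep ?\<nu>). (\<forall>g\<in>K. act (young_rep ?\<nu>) g y = y) \<longrightarrow> y = \<zero>\<^bsub>young_rep ?\<nu>\<^esub>)"
      using KG by (intro exI[of _ ?K]) auto
  qed
  have "\<exists>r U. irreducible_decomposition (sym_group n) ?V r U"
    by (rule V.irreducible_decomposition_exists[of "?c ` F"]) (use span F(1) in auto)
  then obtain r U where rU: "irreducible_decomposition (sym_group n) ?V r U" by blast
  have empty: "{j \<in> {..<r}. rep_iso (sym_group n) (young_rep ?\<nu>) (?V\<lparr>carrier := U j\<rparr>)} = {}"
    if "irreducible_decomposition (sym_group n) ?V r U" for r U using no_iso[OF that] by auto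
  show ?thesis unfolding PConf_multiplicity_def multiplicity_in_def
  proof (rule the_equality)
    show "\<exists>r U. irreducible_decomposition (sym_group n) ?V r U \<and>
        0 = card {j \<in> {..<r}. rep_iso (sym_group n) (young_rep ?\<nu>) (?V\<lparr>carrier := U j\<rparr>)}"
      using rU empty[OF rU] by (intro exI[of _ r] exI[of _ U]) simp
  next
    fix m assume "\<exists>r U. irreducible_decomposition (sym_group n) ?V r U \<and>
        m = card {j \<in> {..<r}. rep_iso (sym_group n) (young_rep ?\<nu>) (?V\<lparr>carrier := U j\<rparr>)}"
    then obtain r U where "irreducible_decomposition (sym_group n) ?V r U"
        "m = card {j \<in> {..<r}. rep_iso (sym_group n) (young_rep ?\<nu>) (?V\<lparr>carrier := U j\<rparr>)}" by blast
    then show "m = 0" using empty by simp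
  qed
qed

theorem theorem1:
  fixes k i :: nat and \<mu> :: "nat list"
  assumes "0 < k"
    and "is_partition \<mu> k"
    and "real i < real k / 2"
  shows "stable_multiplicity i \<mu> = 0"
proof -
  have "2 * i < k" using assms(3) by linarith
  then have ev: "eventually (\<lambda>n. PConf_multiplicity i n \<mu> = 0) sequentially"
    by (intro eventually_mono[OF eventually_ge_at_top[of "2 * k"]] PConf_multiplicity_zero[OF assms(2)])
  show ?thesis unfolding stable_multiplicity_def
  proof (rule the_equality)
    show "eventually (\<lambda>n. PConf_multiplicity i n \<mu> = 0) sequentially" by (rule ev)
  next
    fix d assume "eventually (\<lambda>n. PConf_multiplicity i n \<mu> = d) sequentially"
    \<comment> \<open>Two eventual values of one sequence coincide, because
      \<open>sequentially\<close> is not the trivial filter.\<close>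
    from eventually_conj[OF this ev] have "eventually (\<lambda>n :: nat. d = 0) sequentially"
      by (rule eventually_mono) simp
    then show "d = 0" by simp
  qed
qed

end
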